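(* Let $E$ be a finite set and $V \subset \mathbb R^E$ a linear subspace, with matroid Schubert variety $Y_V$ and totally non-negative matroid Schubert variety $\mathcal Y_V$. For subsets $F \subset G \subset E$ let $\mathcal Y_{FG}^\circ := \mathcal Y_V \cap (0^F \times \mathbb R_{>0}^{G \setminus F} \times \infty^{E \setminus G})$ and let $\mathcal Y_{FG}$ be the closure of $\mathcal Y_{FG}^\circ$ in the analytic topology. \begin{enumerate} \item $\mathcal Y_{FG}^\circ$ is nonempty if and only if $F \subset G$ are acyclic flats of $V$. In this case, $\mathcal Y_{FG}^\circ$ is a single connected component of $Y_{FG}^\circ$, and is a semi-algebraic cell isomorphic to $(\mathbb R_{>0})^{\mathrm{rk}(G) - \mathrm{rk}(F)}$. \item The closure $\mathcal Y_{FG}$ of a nonempty cell $\mathcal Y_{FG}^\circ$ decomposes as the disjoint union of the cells $\mathcal Y_{F'G'}^\circ$ with $F \subset F' \subset G' \subset G$ (and $F',G'$ acyclic flats). \item This decomposition makes $\mathcal Y_{FG}$ (for $\mathcal Y_{FG}^\circ$ nonempty) a regular CW complex homeomorphic to a closed ball. \end{enumerate}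
   Context: $\mathbb P^1_{\mathbb R} = \mathbb R \cup \{\infty\}$, and $(\mathbb P^1_{\mathbb R})^E$ contains $\mathbb R^E$ as an open subset. The matroid Schubert variety $Y_V$ is the Zariski closure of $V$ in $(\mathbb P^1_{\mathbb R})^E$. The totally non-negative matroid Schubert variety $\mathcal Y_V$ is the closure of $V \cap \mathbb R_{\geq 0}^E$ in $(\mathbb P^1_{\mathbb R})^E$ with respect to the analytic (Euclidean) topology. For disjoint $A,B,C$ with $A\cup B\cup C=E$, the notation $0^A \times S^B \times \infty^C$ denotes the set of points of $(\mathbb P^1_{\mathbb R})^E$ whose coordinates indexed by $A$ are $0$, whose coordinates indexed by $B$ lie in $S$, and whose coordinates indexed by $C$ are $\infty$. A flat of $V$ is a set $F \subset E$ such that there is $v \in V$ whose zero coordinates are exactly those indexed by $F$. A flat $F$ is acyclic if $V \cap (0^F \times \mathbb R_{>0}^{E \setminus F})$ is nonempty. The rank $\mathrm{rk}(F)$ of a flat $F$ is the codimension in $V$ of $V \cap \{x_i = 0 : i \in F\}$. For flats $F \subset G$, $Y_{FG}^\circ := Y_V \cap (0^F \times (\mathbb R\setminus\{0\})^{G \setminus F} \times \infty^{E \setminus G})$. A CW complex is regular if the closure of each cell is homeomorphic to a closed Euclidean ball. *)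

theory Defs
  imports "HOL-Analysis.Analysis"
begin

text \<open>P^1_R = R \<union> {\<infinity>} is modelled as real option: Some t is the real number t and
  None is the point \<infinity>.  Its topology is that of the one-point compactification of R.\<close>

definition P1top :: "real option topology" where
  "P1top = topology (\<lambda>U. open {t. Some t \<in> U} \<and>
                        (None \<in> U \<longrightarrow> (\<exists>M. \<forall>t. \<bar>t\<bar> > M \<longrightarrow> Some t \<in> U)))"

definition PT :: "('e \<Rightarrow> real option) topology" where
  "PT = product_topology (\<lambda>_. P1top) UNIV"

definition emb :: "real ^ 'e \<Rightarrow> ('e \<Rightarrow> real option)" where
  "emb v = (\<lambda>e. Some (v $ e))"

text \<open>Homogeneous coordinates of a point of P^1: t ~ [t:1], \<infinity> ~ [1:0].\<close>
fun hc :: "real option \<Rightarrow> real \<times> real" where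
  "hc (Some t) = (t, 1)"
| "hc None = (1, 0)"

text \<open>Evaluation of the multihomogeneous polynomial of multidegree d with coefficients c,
  sum over alpha \<le> d of c alpha * prod_e x_e^(alpha e) * y_e^(d e - alpha e).\<close>
definition mh_eval :: "('e::finite \<Rightarrow> nat) \<Rightarrow> (('e \<Rightarrow> nat) \<Rightarrow> real) \<Rightarrow> ('e \<Rightarrow> real option) \<Rightarrow> real" where
  "mh_eval d c p = (\<Sum>\<alpha>\<in>{\<alpha>. \<forall>e. \<alpha> e \<le> d e}.
       c \<alpha> * (\<Prod>e\<in>UNIV. fst (hc (p e)) ^ \<alpha> e * snd (hc (p e)) ^ (d e - \<alpha> e)))"

definition zariski_closure :: "('e::finite \<Rightarrow> real option) set \<Rightarrow> ('e \<Rightarrow> real option) set" where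
  "zariski_closure S = {p. \<forall>d c. (\<forall>q\<in>S. mh_eval d c q = 0) \<longrightarrow> mh_eval d c p = 0}"

definition schubert :: "(real ^ 'e::finite) set \<Rightarrow> ('e \<Rightarrow> real option) set" where
  "schubert V = zariski_closure (emb ` V)"

definition tnn_schubert :: "(real ^ 'e::finite) set \<Rightarrow> ('e \<Rightarrow> real option) set" where
  "tnn_schubert V = PT closure_of (emb ` {v \<in> V. \<forall>e. 0 \<le> v $ e})"

definition stratum :: "'e set \<Rightarrow> 'e set \<Rightarrow> real set \<Rightarrow> ('e \<Rightarrow> real option) set" where
  "stratum F G S = {p. (\<forall>e\<in>F. p e = Some 0) \<and> (\<forall>e\<in>G - F. \<exists>t\<in>S. p e = Some t)
                        \<and> (\<forall>e. e \<notin> G \<longrightarrow> p e = None)}"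

definition Y_open :: "(real ^ 'e::finite) set \<Rightarrow> 'e set \<Rightarrow> 'e set \<Rightarrow> ('e \<Rightarrow> real option) set" where
  "Y_open V F G = schubert V \<inter> stratum F G (UNIV - {0})"

definition tnnY_open :: "(real ^ 'e::finite) set \<Rightarrow> 'e set \<Rightarrow> 'e set \<Rightarrow> ('e \<Rightarrow> real option) set" where
  "tnnY_open V F G = tnn_schubert V \<inter> stratum F G {0<..}"

definition tnnY :: "(real ^ 'e::finite) set \<Rightarrow> 'e set \<Rightarrow> 'e set \<Rightarrow> ('e \<Rightarrow> real option) set" where
  "tnnY V F G = PT closure_of (tnnY_open V F G)"

definition is_flat :: "(real ^ 'e) set \<Rightarrow> 'e set \<Rightarrow> bool" where
  "is_flat V F \<longleftrightarrow> (\<exists>v\<in>V. {e. v $ e = 0} = F)"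

definition acyclic_flat :: "(real ^ 'e) set \<Rightarrow> 'e set \<Rightarrow> bool" where
  "acyclic_flat V F \<longleftrightarrow> is_flat V F \<and>
     (\<exists>v\<in>V. (\<forall>e\<in>F. v $ e = 0) \<and> (\<forall>e. e \<notin> F \<longrightarrow> 0 < v $ e))"

definition rk :: "(real ^ 'e::finite) set \<Rightarrow> 'e set \<Rightarrow> nat" where
  "rk V F = dim V - dim {v \<in> V. \<forall>e\<in>F. v $ e = 0}"

text \<open>Points of R^J (J a finite set of indices) are extensional functions in J \<rightarrow>E UNIV.\<close>
definition poly_fun :: "'v set \<Rightarrow> (('v \<Rightarrow> real) \<Rightarrow> real) \<Rightarrow> bool" where
  "poly_fun J p \<longleftrightarrow> (\<exists>A c. finite A \<and> (\<forall>\<alpha>\<in>A. \<forall>v. v \<notin> J \<longrightarrow> \<alpha> v = (0::nat)) \<and>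
      (\<forall>x. p x = (\<Sum>\<alpha>\<in>A. c \<alpha> * (\<Prod>v\<in>J. x v ^ \<alpha> v))))"

inductive semialg :: "'v set \<Rightarrow> ('v \<Rightarrow> real) set \<Rightarrow> bool" for J where
  sa_pos: "poly_fun J p \<Longrightarrow> semialg J {x \<in> J \<rightarrow>\<^sub>E UNIV. p x > 0}"
| sa_zero: "poly_fun J p \<Longrightarrow> semialg J {x \<in> J \<rightarrow>\<^sub>E UNIV. p x = 0}"
| sa_un: "semialg J A \<Longrightarrow> semialg J B \<Longrightarrow> semialg J (A \<union> B)"
| sa_compl: "semialg J A \<Longrightarrow> semialg J ((J \<rightarrow>\<^sub>E UNIV) - A)"

definition join_pt :: "('v \<Rightarrow> real) \<Rightarrow> ('w \<Rightarrow> real) \<Rightarrow> ('v + 'w \<Rightarrow> real)" where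
  "join_pt x y = (\<lambda>z. case z of Inl a \<Rightarrow> x a | Inr b \<Rightarrow> y b)"

definition semialg_iso :: "'v set \<Rightarrow> ('v \<Rightarrow> real) set \<Rightarrow> 'w set \<Rightarrow> ('w \<Rightarrow> real) set
                           \<Rightarrow> (('v \<Rightarrow> real) \<Rightarrow> ('w \<Rightarrow> real)) \<Rightarrow> bool" where
  "semialg_iso J S K T f \<longleftrightarrow> S \<subseteq> J \<rightarrow>\<^sub>E UNIV \<and> T \<subseteq> K \<rightarrow>\<^sub>E UNIV \<and>
     homeomorphic_map (subtopology euclidean S) (subtopology euclidean T) f \<and>
     semialg (Inl ` J \<union> Inr ` K) {join_pt x (f x) | x. x \<in> S}"

text \<open>Coordinates of a subset of the stratum 0^F \<times> R^(G-F) \<times> \<infinity>^(E-G), viewed in R^(G-F).\<close>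
definition coords :: "'e set \<Rightarrow> 'e set \<Rightarrow> ('e \<Rightarrow> real option) set \<Rightarrow> ('e \<Rightarrow> real) set" where
  "coords F G S = (\<lambda>p. restrict (\<lambda>e. the (p e)) (G - F)) ` S"

definition pos_orthant :: "nat \<Rightarrow> (nat \<Rightarrow> real) set" where
  "pos_orthant k = {x \<in> {..<k} \<rightarrow>\<^sub>E UNIV. \<forall>i<k. 0 < x i}"

definition closed_nball :: "nat \<Rightarrow> (nat \<Rightarrow> real) set" where
  "closed_nball n = {x \<in> {..<n} \<rightarrow>\<^sub>E UNIV. (\<Sum>i<n. (x i)\<^sup>2) \<le> 1}"

definition open_nball :: "nat \<Rightarrow> (nat \<Rightarrow> real) set" where
  "open_nball n = {x \<in> {..<n} \<rightarrow>\<^sub>E UNIV. (\<Sum>i<n. (x i)\<^sup>2) < 1}"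

definition nsphere :: "nat \<Rightarrow> (nat \<Rightarrow> real) set" where
  "nsphere n = {x \<in> {..<n} \<rightarrow>\<^sub>E UNIV. (\<Sum>i<n. (x i)\<^sup>2) = 1}"

definition finite_cw :: "'a topology \<Rightarrow> 'a set set \<Rightarrow> ('a set \<Rightarrow> nat) \<Rightarrow> bool" where
  "finite_cw X C dimf \<longleftrightarrow> Hausdorff_space X \<and> finite C \<and> {} \<notin> C \<and> disjoint C \<and>
     \<Union>C = topspace X \<and>
     (\<forall>c\<in>C. \<exists>h. continuous_map (subtopology euclidean (closed_nball (dimf c))) X h \<and>
        h ` open_nball (dimf c) = c \<and>
        homeomorphic_map (subtopology euclidean (open_nball (dimf c))) (subtopology X c) h \<and>
        h ` nsphere (dimf c) \<subseteq> \<Union>{c' \<in> C. dimf c' < dimf c})"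

definition regular_cw :: "'a topology \<Rightarrow> 'a set set \<Rightarrow> bool" where
  "regular_cw X C \<longleftrightarrow> (\<exists>dimf. finite_cw X C dimf \<and>
     (\<forall>c\<in>C. subtopology X (X closure_of c) homeomorphic_space
              subtopology euclidean (closed_nball (dimf c))))"

end

theory Submission
  imports Defs
begin

text \<open>
  A point of the closure of a cell is the endpoint \<open>a + \<infinity> u\<close> of a ray in a linear space \<open>U\<close>,
  the minor of \<open>V\<close> on \<open>G - F\<close>; this gives the non-emptiness criterion and the decomposition.
  For the ball property, fix \<open>v \<in> U\<close> positive on \<open>G - F\<close> and use the coordinates
  \<open>w\<^sub>e = exp (- x\<^sub>e / v\<^sub>e)\<close>, with \<open>w\<^sub>e = 0\<close> at \<open>x\<^sub>e = \<infinity>\<close>.  Let \<open>P\<close> be the orthogonal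
  projection to \<open>U\<close>.  As for toric moment maps, monotonicity of \<open>exp\<close> makes
  \<open>w \<mapsto> P (w\<^sub>e / v\<^sub>e)\<close> injective on the closure of \<open>U\<close>, with values in the cone dual to \<open>U \<inter> \<real>\<^bsub>\<ge>0\<^esub>\<close>,
  and translation along \<open>v\<close> becomes scaling of \<open>w\<close>.  Rescaling by \<open>max w / \<Sum>w\<close>
  turns the condition \<open>x \<ge> 0\<close>, that is \<open>max w \<le> 1\<close>, into the linear inequality \<open>b \<bullet> v \<le> 1\<close>.
  By invariance of domain the open cell maps onto the interior of the resulting convex body,
  hence the closed cell maps homeomorphically onto the body itself.
\<close>

section \<open>The projective line and limits of rays\<close>

text \<open>The ball and the semi-algebraic cell need different maps. The exponential coordinates
  extend continuously to infinity, but their graph is in general not semi-algebraic; the gradient of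
  the sum of \<open>x_e^2/2 - ln x_e\<close> is rational, but lives only on the open cell. In both
  cases surjectivity is obtained without solving an equation: the image is open by invariance of
  domain, it is relatively closed (by compactness of the closed cell, respectively by an a priori
  bound), and the target is connected. The denominators \<open>v_e\<close> serve the scaling:
  pairing the projection of \<open>w_e / v_e\<close> with \<open>v\<close> gives the sum of
  \<open>w\<close>. After the rescaling this is max \<open>w\<close>, so all the walls
  \<open>x_e = 0\<close> of the cell are flattened into the one facet
  \<open>b \<bullet> v = 1\<close>, while points at infinity go to faces of the dual cone. The
  Zariski closure enters only through linear equations: a linear form vanishing on \<open>V\<close>
  extends over infinity as a polynomial of degree at most one in each factor, which is enough to
  control the finite coordinates of a point of \<open>Y_V\<close>.\<close>

lemma istopology_P1:
  "istopology (\<lambda>U. open {t. Some t \<in> U} \<and>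
      (None \<in> U \<longrightarrow> (\<exists>M::real. \<forall>t. \<bar>t\<bar> > M \<longrightarrow> Some t \<in> U)))"
proof -
  have "open {t. Some t \<in> S \<inter> T} \<and>
      (None \<in> S \<inter> T \<longrightarrow> (\<exists>M::real. \<forall>t. \<bar>t\<bar> > M \<longrightarrow> Some t \<in> S \<inter> T))"
    if S: "open {t. Some t \<in> S}" "None \<in> S \<longrightarrow> (\<exists>M::real. \<forall>t. \<bar>t\<bar> > M \<longrightarrow> Some t \<in> S)"
      and T: "open {t. Some t \<in> T}" "None \<in> T \<longrightarrow> (\<exists>M::real. \<forall>t. \<bar>t\<bar> > M \<longrightarrow> Some t \<in> T)" for S T
  proof -
    have "{t. Some t \<in> S \<inter> T} = {t. Some t \<in> S} \<inter> {t. Some t \<in> T}" by auto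
    then have "open {t. Some t \<in> S \<inter> T}" using S(1) T(1) by auto
    moreover have "\<exists>M. \<forall>t. \<bar>t\<bar> > M \<longrightarrow> Some t \<in> S \<inter> T" if N: "None \<in> S \<inter> T"
    proof -
      obtain M1 M2 where "\<forall>t. \<bar>t\<bar> > M1 \<longrightarrow> Some t \<in> S" "\<forall>t. \<bar>t\<bar> > M2 \<longrightarrow> Some t \<in> T"
        using S(2) T(2) N by auto
      then show ?thesis by (intro exI[of _ "max M1 M2"]) auto
    qed
    ultimately show ?thesis by blast
  qed
  moreover have "open {t. Some t \<in> \<Union>\<K>} \<and>
      (None \<in> \<Union>\<K> \<longrightarrow> (\<exists>M::real. \<forall>t. \<bar>t\<bar> > M \<longrightarrow> Some t \<in> \<Union>\<K>))"
    if K: "\<forall>K\<in>\<K>. open {t. Some t \<in> K} \<and>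
      (None \<in> K \<longrightarrow> (\<exists>M::real. \<forall>t. \<bar>t\<bar> > M \<longrightarrow> Some t \<in> K))" for \<K> :: "real option set set"
  proof -
    have "{t. Some t \<in> \<Union>\<K>} = (\<Union>K\<in>\<K>. {t. Some t \<in> K})" by auto
    then have "open {t. Some t \<in> \<Union>\<K>}" using K by auto
    then show ?thesis using K by (meson UnionE UnionI)
  qed
  ultimately show ?thesis unfolding istopology_def by blast
qed

lemma openin_P1top:
  "openin P1top U \<longleftrightarrow> open {t. Some t \<in> U} \<and>
      (None \<in> U \<longrightarrow> (\<exists>M. \<forall>t. \<bar>t\<bar> > M \<longrightarrow> Some t \<in> U))"
  unfolding P1top_def by (subst topology_inverse'[OF istopology_P1]) simp

lemma topspace_P1top [simp]: "topspace P1top = UNIV"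
proof -
  have "openin P1top UNIV" by (simp add: openin_P1top)
  then show ?thesis using openin_subset by blast
qed

text \<open>Compactness and the Hausdorff property of P^1 are inherited from the general theory of
  one-point compactifications.\<close>

lemma P1top_eq_Alexandroff: "P1top = Alexandroff_compactification euclidean"
proof (rule topology_eq[THEN iffD2], intro allI iffI)
  fix U :: "real option set"
  assume U: "openin P1top U"
  show "openin (Alexandroff_compactification euclidean) U"
  proof (cases "None \<in> U")
    case False
    have "x \<in> Some ` {t. Some t \<in> U}" if "x \<in> U" for x
      using that False by (cases x) auto
    then have "U = Some ` {t. Some t \<in> U}" by auto
    then show ?thesis using U unfolding openin_P1top openin_Alexandroff_compactification by auto
  next
    case True
    define C where "C = - {t. Some t \<in> U}"
    obtain M where "\<forall>t. \<bar>t\<bar> > M \<longrightarrow> Some t \<in> U" using U True openin_P1top by auto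
    then have "C \<subseteq> cball 0 M" unfolding C_def by (auto simp: not_less[symmetric])
    moreover have "closed C" using U unfolding C_def openin_P1top by (auto simp: closed_def)
    ultimately have "compact C"
      using bounded_cball bounded_subset compact_eq_bounded_closed by blast
    moreover have "U = insert None (Some ` (topspace euclidean - C))"
    proof (intro set_eqI iffI)
      fix x assume "x \<in> U"
      then show "x \<in> insert None (Some ` (topspace euclidean - C))" by (cases x) (auto simp: C_def)
    qed (use True in \<open>auto simp: C_def\<close>)
    ultimately show ?thesis using \<open>closed C\<close>
      unfolding openin_Alexandroff_compactification by auto
  qed
next
  fix U :: "real option set"
  assume "openin (Alexandroff_compactification euclidean) U"
  then consider W where "open W" "U = Some ` W"
    | C where "compact C" "closed C" "U = insert None (Some ` (- C))"
    unfolding openin_Alexandroff_compactification by (auto simp: Compl_eq_Diff_UNIV)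
  then show "openin P1top U"
  proof cases
    case 1
    then have "{t. Some t \<in> U} = W" by auto
    then show ?thesis using 1 by (auto simp: openin_P1top)
  next
    case 2
    then have eq: "{t. Some t \<in> U} = - C" by auto
    obtain M where "\<forall>x\<in>C. \<bar>x\<bar> \<le> M"
      using compact_imp_bounded[OF 2(1)] unfolding bounded_iff by auto
    then have "\<forall>t. \<bar>t\<bar> > M \<longrightarrow> Some t \<in> U" using eq by force
    then show ?thesis using 2 eq by (auto simp: openin_P1top)
  qed
qed

lemma compact_space_P1top: "compact_space P1top"
  by (simp add: P1top_eq_Alexandroff)

lemma Hausdorff_space_P1top: "Hausdorff_space P1top"
  unfolding P1top_eq_Alexandroff Hausdorff_space_Alexandroff_compactification
  by (auto simp: locally_compact_space_euclidean)

lemma topspace_PT [simp]: "topspace PT = UNIV"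
  by (auto simp: PT_def)

lemma compact_space_PT: "compact_space PT"
  by (simp add: PT_def compact_space_product_topology compact_space_P1top)

lemma Hausdorff_space_PT: "Hausdorff_space PT"
  by (simp add: PT_def Hausdorff_space_product_topology Hausdorff_space_P1top)

text \<open>Neighbourhoods of the infinite point contain both ends of the line, so continuity there
  is a limit along \<open>at_infinity\<close>. This is why the functions fed into this criterion
  below are written with \<open>|t|\<close>.\<close>

lemma continuous_map_P1top_real:
  fixes f :: "real option \<Rightarrow> real"
  assumes "continuous_on UNIV (\<lambda>t. f (Some t))" and "((\<lambda>t. f (Some t)) \<longlongrightarrow> f None) at_infinity"
  shows "continuous_map P1top euclidean f"
  unfolding continuous_map_alt
proof (intro conjI allI impI)
  fix U :: "real set"
  assume "openin euclidean U"
  then have U: "open U" by simp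
  have "open {t. Some t \<in> f -` U}"
    using open_vimage[OF U assms(1)] by (simp add: vimage_def)
  moreover have "\<exists>M. \<forall>t. \<bar>t\<bar> > M \<longrightarrow> Some t \<in> f -` U" if "None \<in> f -` U"
  proof -
    have "eventually (\<lambda>t. f (Some t) \<in> U) at_infinity"
      using assms(2) U that by (simp add: tendsto_def)
    then obtain M where "\<forall>t. norm t \<ge> M \<longrightarrow> f (Some t) \<in> U"
      unfolding eventually_at_infinity by auto
    then show ?thesis by (intro exI[of _ M]) auto
  qed
  ultimately show "openin P1top (f -` U \<inter> topspace P1top)" by (auto simp: openin_P1top)
qed auto

lemma limitin_P1top_Some:
  assumes "(f \<longlongrightarrow> t) F"
  shows "limitin P1top (\<lambda>s. Some (f s)) (Some t) F"
  unfolding limitin_def using assms by (auto simp: openin_P1top tendsto_def)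

lemma limitin_P1top_None:
  assumes "filterlim f at_top F"
  shows "limitin P1top (\<lambda>s. Some (f s)) None F"
  unfolding limitin_def
proof (intro conjI allI impI)
  fix U assume "openin P1top U \<and> None \<in> U"
  then obtain M where M: "\<forall>t. \<bar>t\<bar> > M \<longrightarrow> Some t \<in> U" by (auto simp: openin_P1top)
  have "eventually (\<lambda>s. f s > \<bar>M\<bar>) F" using assms filterlim_at_top_dense by blast
  then show "eventually (\<lambda>s. Some (f s) \<in> U) F"
    by eventually_elim (use M in auto)
qed auto

lemma limitin_PT_iff: "limitin PT f l F \<longleftrightarrow> (\<forall>e. limitin P1top (\<lambda>s. f s e) (l e) F)"
  unfolding PT_def limitin_componentwise by auto

lemma limitin_imp_in_closure_of:
  assumes "limitin X f l F" "eventually (\<lambda>s. f s \<in> S) F" "F \<noteq> bot"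
  shows "l \<in> X closure_of S"
  unfolding in_closure_of
proof (intro conjI allI impI)
  show "l \<in> topspace X" by (rule limitin_topspace[OF assms(1)])
  fix T assume T: "l \<in> T \<and> openin X T"
  then have "eventually (\<lambda>s. f s \<in> T) F" using limitinD[OF assms(1)] by blast
  then have "eventually (\<lambda>s. f s \<in> T \<and> f s \<in> S) F" using assms(2) by (rule eventually_conj)
  then show "\<exists>y. y \<in> S \<and> y \<in> T" using eventually_happens'[OF assms(3)] by blast
qed

lemma continuous_map_PT_component: "continuous_map PT P1top (\<lambda>p. p e)"
  unfolding PT_def by (rule continuous_map_product_projection) auto

lemma openin_PT_component: "openin P1top U \<Longrightarrow> openin PT {p. p e \<in> U}"
  using openin_continuous_map_preimage[OF continuous_map_PT_component[of e], of U] by simp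

definition part_emb :: "'e set \<Rightarrow> real ^ 'e \<Rightarrow> 'e \<Rightarrow> real option" where
  "part_emb G x = (\<lambda>e. if e \<in> G then Some (x $ e) else None)"

lemma continuous_map_part_emb: "continuous_map euclidean PT (part_emb G)"
proof -
  have S: "continuous_map euclidean P1top Some"
    unfolding continuous_map_alt by (auto simp: openin_P1top vimage_def)
  have "continuous_map euclidean P1top (\<lambda>x. if e \<in> G then Some (x $ e) else None)" for e
  proof (cases "e \<in> G")
    case True
    have "continuous_map euclidean euclidean (\<lambda>x. x $ e)"
      by (intro continuous_map_iff_continuous2[THEN iffD2] continuous_intros)
    then show ?thesis using True continuous_map_compose[OF _ S, of euclidean "\<lambda>x. x $ e"]
      by (simp add: o_def)
  qed auto
  then show ?thesis unfolding PT_def part_emb_def by (auto simp: continuous_map_componentwise_UNIV)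
qed

lemma ex_pos_combination:
  fixes x y :: "'e::finite \<Rightarrow> real"
  shows "\<exists>s0\<ge>0. \<forall>s\<ge>s0. \<forall>e. 0 < y e \<longrightarrow> 0 < x e + s * y e"
proof -
  \<comment> \<open>The sum of the individual thresholds dominates each of them, since every term is
    non-negative; this avoids a maximum over a possibly empty set.\<close>
  define s0 where "s0 = (\<Sum>e\<in>UNIV. if 0 < y e then (\<bar>x e\<bar> + 1) / y e else 0)"
  have nn: "0 \<le> (if 0 < y e then (\<bar>x e\<bar> + 1) / y e else 0)" for e by auto
  have "0 < x e + s * y e" if "s \<ge> s0" "0 < y e" for s e
  proof -
    have "(\<bar>x e\<bar> + 1) / y e = (\<Sum>e\<in>{e}. if 0 < y e then (\<bar>x e\<bar> + 1) / y e else 0)" using that by auto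
    also have "\<dots> \<le> s0" unfolding s0_def by (rule sum_mono2) (use nn in auto)
    finally have "(\<bar>x e\<bar> + 1) / y e \<le> s" using that by linarith
    then have "\<bar>x e\<bar> + 1 \<le> s * y e" using that by (simp add: pos_divide_le_eq)
    then show ?thesis by linarith
  qed
  moreover have "s0 \<ge> 0" unfolding s0_def using nn by (rule sum_nonneg)
  ultimately show ?thesis by blast
qed

text \<open>A point of the closure is the endpoint of a ray \<open>a + s u\<close>, \<open>s \<rightarrow> \<infinity>\<close>, in the subspace.\<close>
definition ray_limit :: "(real ^ 'e) set \<Rightarrow> 'e set \<Rightarrow> ('e \<Rightarrow> real option) \<Rightarrow> real ^ 'e \<Rightarrow> real ^ 'e \<Rightarrow> bool" where
  "ray_limit U G p a u \<longleftrightarrow> a \<in> U \<and> u \<in> U \<and> (\<forall>e. e \<notin> G \<longrightarrow> p e = None) \<and>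
     (\<forall>e\<in>G. 0 < u $ e \<and> p e = None \<or> u $ e = 0 \<and> 0 \<le> a $ e \<and> p e = Some (a $ e))"

text \<open>The ray is perturbed to \<open>a + s u + v / s\<close>: the last term gives positivity
  wherever \<open>v\<close> is positive and disappears in the limit. The choice \<open>v = 0\<close>
  serves the closure of the non-negative part, a positive \<open>v\<close> that of the open
  cell.\<close>

lemma ray_limit_in_closure:
  fixes U :: "(real ^ 'e::finite) set"
  assumes U: "subspace U" and v: "v \<in> U" "\<forall>e\<in>G. 0 \<le> v $ e" and r: "ray_limit U G p a u"
  shows "p \<in> PT closure_of (part_emb G ` {x\<in>U. \<forall>e\<in>G. 0 \<le> x $ e \<and> (0 < v $ e \<longrightarrow> 0 < x $ e)})"
    (is "p \<in> PT closure_of ?S")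
proof -
  define x where "x s = a + s *\<^sub>R u + inverse s *\<^sub>R v" for s :: real
  have xU: "x s \<in> U" for s
    using U v r unfolding x_def ray_limit_def by (simp add: subspace_add subspace_scale)
  obtain s0 where s0: "s0 \<ge> 0" "\<forall>s\<ge>s0. \<forall>e. 0 < u $ e \<longrightarrow> 0 < a $ e + s * u $ e"
    using ex_pos_combination[of "\<lambda>e. u $ e" "\<lambda>e. a $ e"] by blast
  have "part_emb G (x s) \<in> ?S" if s: "s \<ge> s0" "s > 0" for s
  proof -
    have "0 \<le> x s $ e \<and> (0 < v $ e \<longrightarrow> 0 < x s $ e)" if e: "e \<in> G" for e
    proof -
      have "0 \<le> inverse s * v $ e" using s v e by auto
      moreover have "0 < v $ e \<longrightarrow> 0 < inverse s * v $ e" using s by auto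
      moreover have "0 \<le> a $ e + s * u $ e"
      proof (cases "u $ e = 0")
        case True
        then show ?thesis using r e unfolding ray_limit_def by auto
      next
        case False
        then have "0 < u $ e" using r e unfolding ray_limit_def by auto
        then show ?thesis using s0(2) s less_imp_le by blast
      qed
      ultimately show ?thesis by (auto simp: x_def)
    qed
    then show ?thesis using xU by auto
  qed
  then have ev: "eventually (\<lambda>s. part_emb G (x s) \<in> ?S) at_top"
    using eventually_ge_at_top[of "max s0 1"] by (auto elim!: eventually_mono)
  have "limitin PT (\<lambda>s. part_emb G (x s)) p at_top"
    unfolding limitin_PT_iff
  proof
    fix e
    have inv: "((\<lambda>s. inverse s * v $ e) \<longlongrightarrow> 0) at_top"
      using tendsto_mult_left_zero[OF tendsto_inverse_0_at_top[OF filterlim_ident]] by auto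
    consider "e \<notin> G" | "e \<in> G" "0 < u $ e" "p e = None"
      | "e \<in> G" "u $ e = 0" "p e = Some (a $ e)"
      using r unfolding ray_limit_def by (cases "e \<in> G") auto
    then show "limitin P1top (\<lambda>s. part_emb G (x s) e) (p e) at_top"
    proof cases
      case 1
      then show ?thesis using r by (simp add: part_emb_def ray_limit_def)
    next
      case 2
      have "filterlim (\<lambda>s. s * u $ e) at_top at_top"
        using filterlim_at_top_mult_tendsto_pos[OF tendsto_const 2(2) filterlim_ident] by simp
      then have "filterlim (\<lambda>s. (a $ e + inverse s * v $ e) + s * u $ e) at_top at_top"
        by (rule filterlim_tendsto_add_at_top[OF tendsto_add[OF tendsto_const inv]])
      then have "filterlim (\<lambda>s. x s $ e) at_top at_top" by (simp add: x_def algebra_simps)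
      then show ?thesis using 2 limitin_P1top_None by (simp add: part_emb_def)
    next
      case 3
      have "((\<lambda>s. x s $ e) \<longlongrightarrow> a $ e) at_top"
        using tendsto_add[OF tendsto_const inv, of "a $ e"] 3 by (simp add: x_def)
      then show ?thesis using 3 limitin_P1top_Some by (simp add: part_emb_def)
    qed
  qed
  then show ?thesis by (rule limitin_imp_in_closure_of[OF _ ev]) simp
qed

definition coord_proj :: "'e set \<Rightarrow> real ^ 'e \<Rightarrow> real ^ 'e" where
  "coord_proj G x = (\<chi> e. if e \<in> G then x $ e else 0)"

lemma linear_coord_proj: "linear (coord_proj G)"
  by (rule linearI) (auto simp: coord_proj_def vec_eq_iff)

lemma coord_proj_nth [simp]: "coord_proj G x $ e = (if e \<in> G then x $ e else 0)"
  by (simp add: coord_proj_def)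

text \<open>The base point \<open>a\<close> exists because the finite coordinates of
  \<open>p\<close> lie in the closure of a coordinate projection of \<open>U\<close>, which is a
  subspace and hence closed. For \<open>u\<close>, a vector of \<open>U\<close> close to
  \<open>p\<close> is corrected by a lift of its finite part; the lift is bounded, so coordinates
  that were large enough stay positive.\<close>

lemma closure_imp_ray_limit:
  fixes U :: "(real ^ 'e::finite) set"
  assumes U: "subspace U" and p: "p \<in> PT closure_of (part_emb G ` {x\<in>U. \<forall>e\<in>G. 0 \<le> x $ e})"
  shows "\<exists>a u. ray_limit U G p a u"
proof -
  let ?S = "{x\<in>U. \<forall>e\<in>G. 0 \<le> x $ e}"
  have meet: "\<exists>x\<in>?S. part_emb G x \<in> T" if "openin PT T" "p \<in> T" for T
    using p that unfolding in_closure_of by blast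
  have offG: "p e = None" if "e \<notin> G" for e
  proof (rule ccontr)
    assume "p e \<noteq> None"
    moreover have "openin PT {q. q e \<in> range Some}"
      by (rule openin_PT_component) (auto simp: openin_P1top)
    ultimately obtain x where "part_emb G x e \<in> range Some"
      using meet[of "{q. q e \<in> range Some}"] by auto
    then show False using that by (auto simp: part_emb_def)
  qed
  define H where "H = {e\<in>G. p e \<noteq> None}"
  define y :: "real ^ 'e" where "y = (\<chi> e. if e \<in> H then the (p e) else 0)"
  have pH: "p e = Some (y $ e)" if "e \<in> H" for e using that by (auto simp: y_def H_def)
  define near where "near \<epsilon> M = {q. \<forall>e. (e \<in> H \<longrightarrow> q e \<in> Some ` ball (y $ e) \<epsilon>) \<and>
      (e \<notin> H \<longrightarrow> q e \<in> insert None (Some ` {t. \<bar>t\<bar> > M}))}" for \<epsilon> M :: real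
  have near_ex: "\<exists>x\<in>?S. (\<forall>e\<in>H. \<bar>x $ e - y $ e\<bar> < \<epsilon>) \<and> (\<forall>e\<in>G-H. x $ e > M)"
    if "\<epsilon> > 0" for \<epsilon> M
  proof -
    have im: "{t. Some t \<in> Some ` A} = A" "{t. Some t \<in> insert None (Some ` A)} = A" for A :: "real set"
      by auto
    have "open {t::real. \<bar>t\<bar> > M}" by (intro open_Collect_less continuous_intros)
    then have far: "openin P1top (insert None (Some ` {t. \<bar>t\<bar> > M}))"
      unfolding openin_P1top im by auto
    have "openin P1top (Some ` ball c \<epsilon>)" for c
      unfolding openin_P1top im by auto
    then have "openin PT {q. (e \<in> H \<longrightarrow> q e \<in> Some ` ball (y $ e) \<epsilon>) \<and>
      (e \<notin> H \<longrightarrow> q e \<in> insert None (Some ` {t. \<bar>t\<bar> > M}))}" for e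
      using openin_PT_component[OF far, of e] openin_PT_component[of "Some ` ball (y $ e) \<epsilon>" e]
      by (cases "e \<in> H") simp_all
    then have op: "openin PT (\<Inter>e. {q. (e \<in> H \<longrightarrow> q e \<in> Some ` ball (y $ e) \<epsilon>) \<and>
      (e \<notin> H \<longrightarrow> q e \<in> insert None (Some ` {t. \<bar>t\<bar> > M}))})"
      by (intro openin_Inter) auto
    have "near \<epsilon> M = (\<Inter>e. {q. (e \<in> H \<longrightarrow> q e \<in> Some ` ball (y $ e) \<epsilon>) \<and>
      (e \<notin> H \<longrightarrow> q e \<in> insert None (Some ` {t. \<bar>t\<bar> > M}))})"
      by (simp add: near_def Collect_all_eq)
    then have "openin PT (near \<epsilon> M)" using op by simp
    moreover have "p \<in> near \<epsilon> M"
      unfolding near_def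
    proof (intro CollectI allI conjI impI)
      fix e assume "e \<in> H"
      then show "p e \<in> Some ` ball (y $ e) \<epsilon>" using pH[of e] that by simp
    next
      fix e assume "e \<notin> H"
      then have "p e = None" using offG[of e] by (auto simp: H_def)
      then show "p e \<in> insert None (Some ` {t. \<bar>t\<bar> > M})" by simp
    qed
    ultimately obtain x where x: "x \<in> ?S" "part_emb G x \<in> near \<epsilon> M"
      using meet[of "near \<epsilon> M"] by blast
    have "\<bar>x $ e - y $ e\<bar> < \<epsilon>" if "e \<in> H" for e
    proof -
      have "part_emb G x e \<in> Some ` ball (y $ e) \<epsilon>" using x(2) that unfolding near_def by blast
      moreover have "e \<in> G" using that H_def by auto
      ultimately show ?thesis by (auto simp: part_emb_def dist_real_def abs_minus_commute)
    qed
    moreover have "x $ e > M" if "e \<in> G - H" for e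
    proof -
      have "part_emb G x e \<in> insert None (Some ` {t. \<bar>t\<bar> > M})" using x(2) that unfolding near_def by blast
      \<comment> \<open>Non-negativity rules out the negative end of the neighbourhood of
        infinity.\<close>
      moreover have "0 \<le> x $ e" using x(1) that by auto
      ultimately show ?thesis using that by (auto simp: part_emb_def)
    qed
    ultimately show ?thesis using x(1) by blast
  qed
  have "y \<in> closure (coord_proj H ` U)"
    unfolding closure_approachable
  proof (intro allI impI)
    fix \<epsilon> :: real assume e: "\<epsilon> > 0"
    \<comment> \<open>The norm is at most the sum of the coordinate errors, hence at most
      \<open>CARD('e)\<close> times \<open>\<delta>\<close>; the factor 2 makes the final bound
      strict.\<close>
    define \<delta> where "\<delta> = \<epsilon> / (2 * real CARD('e))"
    have d: "\<delta> > 0" using e by (simp add: \<delta>_def)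
    obtain x where x: "x \<in> ?S" "\<forall>e\<in>H. \<bar>x $ e - y $ e\<bar> < \<delta>" using near_ex[OF d] by blast
    have "norm (coord_proj H x - y) \<le> (\<Sum>e\<in>UNIV. \<bar>(coord_proj H x - y) $ e\<bar>)"
      by (rule norm_le_l1_cart)
    also have "\<dots> \<le> (\<Sum>e\<in>(UNIV::'e set). \<delta>)"
      by (rule sum_mono) (use x(2) d in \<open>auto simp: y_def less_imp_le\<close>)
    also have "\<dots> < \<epsilon>" using e by (simp add: \<delta>_def)
    finally show "\<exists>z\<in>coord_proj H ` U. dist z y < \<epsilon>" using x(1) by (auto simp: dist_norm)
  qed
  moreover have "closed (coord_proj H ` U)"
    by (intro closed_subspace linear_subspace_image linear_coord_proj U)
  ultimately obtain a where a: "a \<in> U" "coord_proj H a = y" by auto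
  have aH: "a $ e = y $ e" if "e \<in> H" for e using a(2) that by (auto simp: vec_eq_iff split: if_splits)
  have y0: "0 \<le> y $ e" if e: "e \<in> H" for e
  proof (rule ccontr)
    assume "\<not> 0 \<le> y $ e"
    then have "0 < - y $ e" by simp
    \<comment> \<open>The error bound \<open>- y $ e\<close> is the distance of a negative
      \<open>y $ e\<close> from 0, so no non-negative coordinate can be that close.\<close>
    from near_ex[OF this, of 0] obtain x where "x \<in> ?S" "\<bar>x $ e - y $ e\<bar> < - y $ e"
      using e by blast
    moreover have "e \<in> G" using e H_def by auto
    ultimately show False by fastforce
  qed
  \<comment> \<open>A linear section of the projection to the finite coordinates, with values in
    \<open>U\<close>; being linear it is bounded.\<close>
  obtain g where g: "range g \<subseteq> U" "linear g" "\<forall>z\<in>coord_proj H ` U. coord_proj H (g z) = z"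
    using real_vector.linear_exists_right_inverse_on[of "coord_proj H" U] linear_coord_proj U
    by (auto simp: linear_def)
  obtain B where B: "B > 0" "\<And>z. norm (g z) \<le> B * norm z" using linear_bounded_pos[OF g(2)] by blast
  \<comment> \<open>An upper bound for the norm of the lifted finite part of any \<open>x\<close>
    whose finite coordinates are within 1 of \<open>y\<close>; coordinates above \<open>M\<close>
    stay positive after its subtraction.\<close>
  define M where "M = B * (norm y + real CARD('e))"
  obtain x where x: "x \<in> ?S" "\<forall>e\<in>H. \<bar>x $ e - y $ e\<bar> < 1" "\<forall>e\<in>G-H. x $ e > M"
    using near_ex[of 1 M] by auto
  define u where "u = x - g (coord_proj H x)"
  have uU: "u \<in> U" using x(1) g(1) U unfolding u_def by (auto intro: subspace_diff)
  have uH: "u $ e = 0" if "e \<in> H" for e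
  proof -
    have "coord_proj H (g (coord_proj H x)) = coord_proj H x" using g(3) x(1) by auto
    then have "coord_proj H (g (coord_proj H x)) $ e = coord_proj H x $ e" by simp
    then show ?thesis using that by (simp add: u_def)
  qed
  have "norm (coord_proj H x - y) \<le> (\<Sum>e\<in>UNIV. \<bar>(coord_proj H x - y) $ e\<bar>)"
    by (rule norm_le_l1_cart)
  also have "\<dots> \<le> (\<Sum>e\<in>(UNIV::'e set). 1)"
    by (rule sum_mono) (use x(2) in \<open>auto simp: y_def less_imp_le\<close>)
  finally have "norm (coord_proj H x) \<le> norm y + real CARD('e)"
    using norm_triangle_sub[of "coord_proj H x" y] by simp
  then have "norm (g (coord_proj H x)) \<le> M"
    using B(2)[of "coord_proj H x"] B(1) unfolding M_def by (meson mult_left_mono order_trans less_imp_le)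
  then have up: "u $ e > 0" if "e \<in> G - H" for e
  proof -
    have "M < x $ e" using x(3) that by blast
    moreover have "\<bar>g (coord_proj H x) $ e\<bar> \<le> norm (g (coord_proj H x))" by (rule component_le_norm_cart)
    ultimately show ?thesis using \<open>norm (g (coord_proj H x)) \<le> M\<close> by (simp add: u_def)
  qed
  have "ray_limit U G p a u"
    unfolding ray_limit_def
  proof (intro conjI ballI a(1) uU allI impI offG)
    fix e assume "e \<in> G"
    then show "0 < u $ e \<and> p e = None \<or> u $ e = 0 \<and> 0 \<le> a $ e \<and> p e = Some (a $ e)"
      using up[of e] uH[of e] pH[of e] aH[of e] y0[of e] by (cases "e \<in> H") (auto simp: H_def)
  qed
  then show ?thesis by blast
qed

section \<open>Cells as connected components\<close>

lemma ray_limit_Some: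
  assumes "ray_limit U G p a u" "e \<in> G" "p e \<noteq> None"
  shows "u $ e = 0" "0 \<le> a $ e" "p e = Some (a $ e)"
proof -
  have "0 < u $ e \<and> p e = None \<or> u $ e = 0 \<and> 0 \<le> a $ e \<and> p e = Some (a $ e)"
    using assms(1,2) unfolding ray_limit_def by blast
  then show "u $ e = 0" "0 \<le> a $ e" "p e = Some (a $ e)" using assms(3) by auto
qed

lemma ray_limit_None:
  assumes "ray_limit U G p a u" "e \<in> G" "p e = None"
  shows "0 < u $ e"
  using assms unfolding ray_limit_def by force

lemma emb_eq_part_emb: "emb = part_emb UNIV"
  by (auto simp: emb_def part_emb_def)

lemma in_tnn_schubert_iff:
  fixes V :: "(real ^ 'e::finite) set"
  assumes "subspace V"
  shows "p \<in> tnn_schubert V \<longleftrightarrow> (\<exists>a u. ray_limit V UNIV p a u)"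
proof
  assume "p \<in> tnn_schubert V"
  then show "\<exists>a u. ray_limit V UNIV p a u"
    using closure_imp_ray_limit[OF assms, of p UNIV] by (simp add: tnn_schubert_def emb_eq_part_emb)
next
  assume "\<exists>a u. ray_limit V UNIV p a u"
  then obtain a u where "ray_limit V UNIV p a u" by blast
  from ray_limit_in_closure[OF assms subspace_0[OF assms] _ this]
  show "p \<in> tnn_schubert V" by (simp add: tnn_schubert_def emb_eq_part_emb)
qed

lemma acyclic_flat_iff:
  "acyclic_flat V F \<longleftrightarrow> (\<exists>v\<in>V. (\<forall>e\<in>F. v $ e = 0) \<and> (\<forall>e. e \<notin> F \<longrightarrow> 0 < v $ e))"
proof -
  have "is_flat V F" if v: "v \<in> V" "\<forall>e\<in>F. v $ e = 0" "\<forall>e. e \<notin> F \<longrightarrow> 0 < v $ e" for v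
  proof -
    have "{e. v $ e = 0} = F" using v(2,3) less_irrefl by fastforce
    then show ?thesis using v(1) unfolding is_flat_def by blast
  qed
  then show ?thesis unfolding acyclic_flat_def by blast
qed

text \<open>For \<open>F \<subseteq> G\<close> this realises a minor of the matroid of coordinate
  functionals on \<open>V\<close>: restriction to \<open>G\<close> is a coordinate projection, and
  contraction of \<open>F\<close> passes to the vectors vanishing on \<open>F\<close>. Padding with
  zeros keeps all minors inside one type.\<close>

definition minor :: "(real ^ 'e::finite) set \<Rightarrow> 'e set \<Rightarrow> 'e set \<Rightarrow> (real ^ 'e) set" where
  "minor V F G = coord_proj G ` {a\<in>V. \<forall>e\<in>F. a $ e = 0}"

lemma subspace_vanishing: "subspace V \<Longrightarrow> subspace {a\<in>V. \<forall>e\<in>F. a $ e = 0}"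
  by (auto simp: subspace_def)

lemma subspace_minor: "subspace V \<Longrightarrow> subspace (minor V F G)"
  unfolding minor_def by (intro linear_subspace_image linear_coord_proj subspace_vanishing)

lemma minor_outside: "x \<in> minor V F G \<Longrightarrow> e \<notin> G - F \<Longrightarrow> x $ e = 0"
  unfolding minor_def by auto

lemma part_emb_cong: "(\<And>e. e \<in> G \<Longrightarrow> x $ e = y $ e) \<Longrightarrow> part_emb G x = part_emb G y"
  by (auto simp: part_emb_def)

lemma part_emb_coord_proj [simp]: "part_emb G (coord_proj G x) = part_emb G x"
  by (rule part_emb_cong) simp

definition minor_cell :: "(real ^ 'e::finite) set \<Rightarrow> 'e set \<Rightarrow> 'e set \<Rightarrow> (real ^ 'e) set" where
  "minor_cell V F G = {x \<in> minor V F G. \<forall>e\<in>G-F. 0 < x $ e}"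

text \<open>Points of a cell may be represented in the minor or by vectors of \<open>V\<close>,
  whose entries off \<open>G\<close> are discarded by \<open>part_emb G\<close>.\<close>

lemma part_emb_minor_cell_eq:
  "part_emb G ` minor_cell V F G =
     part_emb G ` {a\<in>V. (\<forall>e\<in>F. a $ e = 0) \<and> (\<forall>e\<in>G-F. 0 < a $ e)}" (is "?l = ?r")
proof
  show "?l \<subseteq> ?r" unfolding minor_cell_def minor_def by auto
  show "?r \<subseteq> ?l"
  proof
    fix p assume "p \<in> ?r"
    then obtain a where a: "a \<in> V" "\<forall>e\<in>F. a $ e = 0" "\<forall>e\<in>G-F. 0 < a $ e" "p = part_emb G a" by blast
    then have "coord_proj G a \<in> minor_cell V F G" by (auto simp: minor_cell_def minor_def)
    moreover have "p = part_emb G (coord_proj G a)" using a by simp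
    ultimately show "p \<in> ?l" by blast
  qed
qed

lemma part_emb_in_stratum:
  assumes "F \<subseteq> G" "\<forall>e\<in>F. a $ e = 0" "\<forall>e\<in>G-F. a $ e \<in> S"
  shows "part_emb G a \<in> stratum F G S"
  using assms by (auto simp: stratum_def part_emb_def)

text \<open>The coordinates on \<open>G\<close> are those of the base point of a ray. Conversely,
  acyclicity of \<open>G\<close> provides a direction that sends the coordinates off
  \<open>G\<close> to infinity while keeping those on \<open>G\<close> fixed.\<close>

lemma tnnY_open_eq:
  fixes V :: "(real ^ 'e::finite) set"
  assumes V: "subspace V" and FG: "F \<subseteq> G" and ac: "acyclic_flat V F" "acyclic_flat V G"
  shows "tnnY_open V F G = part_emb G ` minor_cell V F G"
proof
  show "tnnY_open V F G \<subseteq> part_emb G ` minor_cell V F G"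
  proof
    fix p assume "p \<in> tnnY_open V F G"
    then obtain a u where r: "ray_limit V UNIV p a u" and st: "p \<in> stratum F G {0<..}"
      using in_tnn_schubert_iff[OF V] unfolding tnnY_open_def by blast
    have pa: "p e = Some (a $ e)" if "e \<in> G" for e
    proof -
      have "p e \<noteq> None" using st that FG unfolding stratum_def by (cases "e \<in> F") auto
      then show ?thesis using ray_limit_Some(3)[OF r] by simp
    qed
    have "p = part_emb G a" using pa st unfolding part_emb_def stratum_def by auto
    moreover have "a $ e = 0" if "e \<in> F" for e using pa[of e] st that FG unfolding stratum_def by auto
    moreover have "0 < a $ e" if "e \<in> G - F" for e
    proof -
      have "\<exists>t\<in>{0<..}. p e = Some t" using st that unfolding stratum_def by blast
      then show ?thesis using pa[of e] that by auto
    qed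
    ultimately show "p \<in> part_emb G ` minor_cell V F G"
      unfolding part_emb_minor_cell_eq using r unfolding ray_limit_def by blast
  qed
next
  show "part_emb G ` minor_cell V F G \<subseteq> tnnY_open V F G"
  proof
    fix p assume "p \<in> part_emb G ` minor_cell V F G"
    then obtain a where a: "a \<in> V" "\<forall>e\<in>F. a $ e = 0" "\<forall>e\<in>G-F. 0 < a $ e" "p = part_emb G a"
      unfolding part_emb_minor_cell_eq by blast
    obtain u where u: "u \<in> V" "\<forall>e\<in>G. u $ e = 0" "\<forall>e. e \<notin> G \<longrightarrow> 0 < u $ e"
      using ac(2) acyclic_flat_iff by blast
    have "0 \<le> a $ e" if "e \<in> G" for e using a that by (cases "e \<in> F") (auto intro: less_imp_le)
    then have "ray_limit V UNIV p a u"
      using a u unfolding ray_limit_def part_emb_def by auto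
    then show "p \<in> tnnY_open V F G"
      using in_tnn_schubert_iff[OF V] part_emb_in_stratum[of F G a "{0<..}"] FG a
      unfolding tnnY_open_def by auto
  qed
qed

text \<open>The direction \<open>u\<close> of a ray ending at a point of the cell witnesses
  acyclicity of \<open>G\<close>: it vanishes at the finite coordinates and is positive elsewhere. A
  point far out on the ray does the same for \<open>F\<close>.\<close>

lemma tnnY_open_nonempty_iff:
  fixes V :: "(real ^ 'e::finite) set"
  assumes V: "subspace V" and FG: "F \<subseteq> G"
  shows "tnnY_open V F G \<noteq> {} \<longleftrightarrow> acyclic_flat V F \<and> acyclic_flat V G"
proof
  assume "tnnY_open V F G \<noteq> {}"
  then obtain p a u where r: "ray_limit V UNIV p a u" and st: "p \<in> stratum F G {0<..}"
    using in_tnn_schubert_iff[OF V] unfolding tnnY_open_def by blast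
  have Gi: "e \<in> G \<longleftrightarrow> p e \<noteq> None" for e
    using st FG unfolding stratum_def by (cases "e \<in> F") auto
  have u: "u $ e = 0 \<and> p e = Some (a $ e)" if "e \<in> G" for e
    using ray_limit_Some[OF r] Gi[of e] that by blast
  have u2: "0 < u $ e" if "e \<notin> G" for e using ray_limit_None[OF r] Gi[of e] that by blast
  have aG: "acyclic_flat V G" using u u2 r unfolding acyclic_flat_iff ray_limit_def by blast
  obtain s where s: "\<forall>e. 0 < u $ e \<longrightarrow> 0 < a $ e + s * u $ e"
    using ex_pos_combination[of "\<lambda>e. u $ e" "\<lambda>e. a $ e"] by blast
  have "a + s *\<^sub>R u \<in> V" using r V unfolding ray_limit_def by (simp add: subspace_add subspace_scale)
  moreover have "(a + s *\<^sub>R u) $ e = 0" if "e \<in> F" for e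
    using u[of e] st that FG unfolding stratum_def by auto
  moreover have "0 < (a + s *\<^sub>R u) $ e" if "e \<notin> F" for e
  proof (cases "e \<in> G")
    case True
    then have "\<exists>t\<in>{0<..}. p e = Some t" using st that unfolding stratum_def by blast
    then show ?thesis using u[OF True] by auto
  next
    case False
    then show ?thesis using s u2 by auto
  qed
  ultimately have "acyclic_flat V F" unfolding acyclic_flat_iff by blast
  then show "acyclic_flat V F \<and> acyclic_flat V G" using aG by simp
next
  assume ac: "acyclic_flat V F \<and> acyclic_flat V G"
  then obtain v where v: "v \<in> V" "\<forall>e\<in>F. v $ e = 0" "\<forall>e. e \<notin> F \<longrightarrow> 0 < v $ e"
    using acyclic_flat_iff by blast
  then have "part_emb G v \<in> part_emb G ` minor_cell V F G"
    unfolding part_emb_minor_cell_eq by blast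
  then show "tnnY_open V F G \<noteq> {}" using tnnY_open_eq[OF V FG] ac by blast
qed

text \<open>Any single point remembers the indices of its cell; disjointness of the cells and a
  well-defined dimension function both rest on this.\<close>

lemma tnnY_open_support:
  assumes "p \<in> tnnY_open V F G"
  shows "F = {e. p e = Some 0}" "G = {e. p e \<noteq> None}"
proof -
  have F: "p e = Some 0" if "e \<in> F" for e using assms that by (auto simp: tnnY_open_def stratum_def)
  have GF: "\<exists>t>0. p e = Some t" if "e \<in> G - F" for e
    using assms that by (auto simp: tnnY_open_def stratum_def)
  have G: "p e = None" if "e \<notin> G" for e using assms that by (auto simp: tnnY_open_def stratum_def)
  have "e \<in> F \<longleftrightarrow> p e = Some 0" "e \<in> G \<longleftrightarrow> p e \<noteq> None" for e
    using F[of e] GF[of e] G[of e] by (cases "e \<in> F"; cases "e \<in> G"; force)+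
  then show "F = {e. p e = Some 0}" "G = {e. p e \<noteq> None}" by auto
qed

section \<open>Comparison with the Zariski closure\<close>

lemma finite_exponents: "finite {\<alpha>::'e::finite \<Rightarrow> nat. \<forall>e. \<alpha> e \<le> d e}"
proof -
  have "{\<alpha>::'e \<Rightarrow> nat. \<forall>e. \<alpha> e \<le> d e} = PiE UNIV (\<lambda>e. {..d e})" by (auto simp: PiE_def Pi_def)
  then show ?thesis using finite_PiE[of UNIV "\<lambda>e. {..d e}"] by simp
qed

text \<open>If the vector \<open>y\<close> of finite coordinates were not in the projection of
  \<open>V\<close>, its component \<open>z\<close> orthogonal to that projection would be a linear
  form vanishing on \<open>V\<close> but not at \<open>y\<close>. Homogenised with degree 1 in each
  factor from \<open>G\<close>, this form is an equation for the Zariski closure, and at a point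
  finite on \<open>G\<close> it takes its affine value.\<close>

lemma schubert_finite_part:
  fixes V :: "(real ^ 'e::finite) set"
  assumes V: "subspace V" and p: "p \<in> schubert V"
  shows "\<exists>a\<in>V. \<forall>e. p e \<noteq> None \<longrightarrow> p e = Some (a $ e)"
proof -
  define G where "G = {e. p e \<noteq> None}"
  define y :: "real ^ 'e" where "y = (\<chi> e. if e \<in> G then the (p e) else 0)"
  have pG: "p e = Some (y $ e)" if "e \<in> G" for e using that by (auto simp: y_def G_def)
  let ?S = "coord_proj G ` V"
  have S: "subspace ?S" by (intro linear_subspace_image linear_coord_proj V)
  obtain y' z where z: "y' \<in> span ?S" "\<And>w. w \<in> span ?S \<Longrightarrow> orthogonal z w" "y = y' + z"
    using orthogonal_subspace_decomp_exists[of ?S y] by blast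
  define \<delta> where "\<delta> e = (\<lambda>e'. if e' = e then 1 else 0::nat)" for e :: 'e
  define d where "d = (\<lambda>e. if e \<in> G then 1 else 0::nat)"
  \<comment> \<open>The multi-index \<open>\<delta> e\<close> picks the monomial with the numerator
    of coordinate \<open>e\<close> and the denominators of the other coordinates in
    \<open>G\<close>. The sum of conditionals gives it coefficient \<open>z $ e\<close>, and all
    remaining monomials coefficient 0.\<close>
  define c where "c \<alpha> = (\<Sum>e\<in>G. if \<alpha> = \<delta> e then z $ e else 0)" for \<alpha>
  have fin: "finite {\<alpha>::'e \<Rightarrow> nat. \<forall>e. \<alpha> e \<le> d e}" by (rule finite_exponents)
  have ev: "mh_eval d c q = (\<Sum>e\<in>G. z $ e * y $ e)"
    if q: "\<And>e. e \<in> G \<Longrightarrow> q e = Some (y $ e)" for q and y :: "real ^ 'e"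
  proof -
    let ?m = "\<lambda>\<alpha>. (\<Prod>e\<in>UNIV. fst (hc (q e)) ^ \<alpha> e * snd (hc (q e)) ^ (d e - \<alpha> e))"
    have "mh_eval d c q = (\<Sum>\<alpha>\<in>{\<alpha>. \<forall>e. \<alpha> e \<le> d e}. \<Sum>e\<in>G. (if \<alpha> = \<delta> e then z $ e else 0) * ?m \<alpha>)"
      unfolding mh_eval_def c_def by (simp add: sum_distrib_right)
    also have "\<dots> = (\<Sum>e\<in>G. \<Sum>\<alpha>\<in>{\<alpha>. \<forall>e. \<alpha> e \<le> d e}. (if \<alpha> = \<delta> e then z $ e else 0) * ?m \<alpha>)"
      by (rule sum.swap)
    also have "\<dots> = (\<Sum>e\<in>G. z $ e * y $ e)"
    proof (rule sum.cong[OF refl])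
      fix e assume e: "e \<in> G"
      have mem: "\<delta> e \<in> {\<alpha>. \<forall>e. \<alpha> e \<le> d e}" using e by (auto simp: \<delta>_def d_def)
      have "(\<Sum>\<alpha>\<in>{\<alpha>. \<forall>e. \<alpha> e \<le> d e}. (if \<alpha> = \<delta> e then z $ e else 0) * ?m \<alpha>)
          = (\<Sum>\<alpha>\<in>{\<alpha>. \<forall>e. \<alpha> e \<le> d e}. if \<alpha> = \<delta> e then z $ e * ?m (\<delta> e) else 0)"
        by (rule sum.cong) auto
      also have "\<dots> = z $ e * ?m (\<delta> e)" using fin mem by simp
      also have "?m (\<delta> e) = (\<Prod>e'\<in>UNIV. if e' = e then y $ e else 1)"
        by (rule prod.cong) (use q e in \<open>auto simp: \<delta>_def d_def\<close>)
      also have "\<dots> = y $ e" by simp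
      finally show "(\<Sum>\<alpha>\<in>{\<alpha>. \<forall>e. \<alpha> e \<le> d e}. (if \<alpha> = \<delta> e then z $ e else 0) * ?m \<alpha>) = z $ e * y $ e" .
    qed
    finally show ?thesis .
  qed
  have inner: "(\<Sum>e\<in>G. z $ e * x $ e) = z \<bullet> coord_proj G x" for x
  proof -
    have "z \<bullet> coord_proj G x = (\<Sum>e\<in>UNIV. if e \<in> G then z $ e * x $ e else 0)"
      unfolding inner_vec_def by (rule sum.cong) auto
    then show ?thesis by (simp add: sum.If_cases)
  qed
  have "mh_eval d c q = 0" if "q \<in> emb ` V" for q
  proof -
    obtain x where x: "x \<in> V" "q = emb x" using \<open>q \<in> emb ` V\<close> by blast
    have "orthogonal z (coord_proj G x)" using z(2) x(1) by (simp add: span_base)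
    then show ?thesis using ev[of q x] inner[of x] x by (simp add: emb_def orthogonal_def)
  qed
  then have "mh_eval d c p = 0" using p unfolding schubert_def zariski_closure_def by blast
  then have "z \<bullet> coord_proj G y = 0" using ev[of p y] pG inner by simp
  moreover have "coord_proj G y = y" by (auto simp: vec_eq_iff y_def)
  ultimately have "z \<bullet> y = 0" by simp
  \<comment> \<open>Since \<open>y = y' + z\<close> with \<open>z\<close> orthogonal to
    \<open>y'\<close>, the pairing of \<open>z\<close> with \<open>y\<close> is the squared length
    of \<open>z\<close>.\<close>
  then have "z \<bullet> z = 0" using z(3) z(2)[OF z(1)] by (simp add: orthogonal_def inner_add_right)
  then have "y \<in> span ?S" using z by simp
  then have "y \<in> ?S" using span_eq_iff[THEN iffD2, OF S] by blast
  then obtain a where a: "a \<in> V" "y = coord_proj G a" by blast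
  have "p e = Some (a $ e)" if "p e \<noteq> None" for e
  proof -
    have "e \<in> G" using that by (simp add: G_def)
    then show ?thesis using pG[of e] a(2) by simp
  qed
  then show ?thesis using a(1) by blast
qed

text \<open>The coordinates \<open>hc\<close> are not continuous at infinity. Dividing
  \<open>(t, 1)\<close> by \<open>1 + t\<close> repairs this, and for \<open>t \<ge> 0\<close> it
  multiplies every multihomogeneous polynomial by a non-zero factor, so the zeros stay the same and
  form a closed set in the analytic topology.\<close>

lemma tnn_schubert_subset_schubert:
  fixes V :: "(real ^ 'e::finite) set"
  assumes V: "subspace V"
  shows "tnn_schubert V \<subseteq> schubert V"
  unfolding schubert_def zariski_closure_def
proof (intro subsetI CollectI allI impI)
  fix p d c assume p: "p \<in> tnn_schubert V" and van: "\<forall>q\<in>emb ` V. mh_eval d c q = 0"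
  \<comment> \<open>With \<open>|t|\<close> both functions are continuous on all of P^1, but they
    are homogeneous coordinates of the given point only when it is non-negative or infinite;
    \<open>s\<close> is the scalar that compares them with \<open>hc\<close>.\<close>
  define X where "X = (\<lambda>q::real option. case q of None \<Rightarrow> 1 | Some t \<Rightarrow> \<bar>t\<bar> / (1 + \<bar>t\<bar>))"
  define Y where "Y = (\<lambda>q::real option. case q of None \<Rightarrow> 0 | Some t \<Rightarrow> 1 / (1 + \<bar>t\<bar>))"
  define s where "s = (\<lambda>q::real option. case q of None \<Rightarrow> 1 | Some t \<Rightarrow> 1 / (1 + \<bar>t\<bar>))"
  have lim: "((\<lambda>t::real. 1 / (1 + \<bar>t\<bar>)) \<longlongrightarrow> 0) at_infinity"
  proof -
    have "filterlim (\<lambda>t::real. norm t) at_top at_infinity" by (rule filterlim_norm_at_top)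
    then have "filterlim (\<lambda>t::real. 1 + \<bar>t\<bar>) at_top at_infinity"
      using filterlim_tendsto_add_at_top[OF tendsto_const, of "\<lambda>t::real. norm t" at_infinity 1]
      by (simp only: real_norm_def)
    then show ?thesis using tendsto_inverse_0_at_top by (simp add: inverse_eq_divide[symmetric])
  qed
  have contY: "continuous_map P1top euclidean Y"
    by (rule continuous_map_P1top_real) (use lim in \<open>auto simp: Y_def intro!: continuous_intros\<close>)
  have XY: "X q = 1 - Y q" for q
    by (cases q) (auto simp: X_def Y_def field_simps)
  have cY: "continuous_map PT euclidean (\<lambda>q. Y (q e))" for e
    using continuous_map_compose[OF continuous_map_PT_component contY] by (simp add: o_def)
  define N where "N q = (\<Sum>\<alpha>\<in>{\<alpha>. \<forall>e. \<alpha> e \<le> d e}.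
       c \<alpha> * (\<Prod>e\<in>UNIV. X (q e) ^ \<alpha> e * Y (q e) ^ (d e - \<alpha> e)))" for q
  have fin: "finite {\<alpha>::'e \<Rightarrow> nat. \<forall>e. \<alpha> e \<le> d e}" by (rule finite_exponents)
  have contN: "continuous_map PT euclidean N"
    unfolding N_def XY
    by (intro continuous_map_sum continuous_map_real_mult continuous_map_prod continuous_map_real_pow
        continuous_map_diff continuous_map_canonical_const cY fin) auto
  have Neq: "N q = (\<Prod>e\<in>UNIV. s (q e) ^ d e) * mh_eval d c q"
    if nn: "\<And>e t. q e = Some t \<Longrightarrow> 0 \<le> t" for q
  proof -
    have x: "X (q e) = s (q e) * fst (hc (q e))" for e
      using nn[of e] by (cases "q e") (auto simp: X_def s_def)
    have y: "Y (q e) = s (q e) * snd (hc (q e))" for e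
      by (cases "q e") (auto simp: Y_def s_def)
    have "c \<alpha> * (\<Prod>e\<in>UNIV. X (q e) ^ \<alpha> e * Y (q e) ^ (d e - \<alpha> e)) =
      (\<Prod>e\<in>UNIV. s (q e) ^ d e) * (c \<alpha> * (\<Prod>e\<in>UNIV. fst (hc (q e)) ^ \<alpha> e * snd (hc (q e)) ^ (d e - \<alpha> e)))"
      if "\<forall>e. \<alpha> e \<le> d e" for \<alpha>
    proof -
      have "X (q e) ^ \<alpha> e * Y (q e) ^ (d e - \<alpha> e) =
        s (q e) ^ d e * (fst (hc (q e)) ^ \<alpha> e * snd (hc (q e)) ^ (d e - \<alpha> e))" for e
      proof -
        have "s (q e) ^ d e = s (q e) ^ \<alpha> e * s (q e) ^ (d e - \<alpha> e)"
          using that by (simp add: power_add[symmetric])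
        then show ?thesis unfolding x y power_mult_distrib by simp
      qed
      then show ?thesis by (simp add: prod.distrib)
    qed
    then show ?thesis unfolding N_def mh_eval_def sum_distrib_left by (intro sum.cong) auto
  qed
  have "N p = 0"
  proof -
    have "N q = 0" if "q \<in> emb ` {v \<in> V. \<forall>e. 0 \<le> v $ e}" for q
      using Neq[of q] van that by (auto simp: emb_def)
    then have "emb ` {v \<in> V. \<forall>e. 0 \<le> v $ e} \<subseteq> {q. N q = 0}" by auto
    moreover have "closedin PT {q. N q = 0}"
      using closedin_continuous_map_preimage[OF contN, of "{0}"] by simp
    ultimately have "tnn_schubert V \<subseteq> {q. N q = 0}"
      unfolding tnn_schubert_def by (rule closure_of_minimal)
    then show ?thesis using p by blast
  qed
  moreover have "0 \<le> t" if "p e = Some t" for e t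
  proof -
    obtain a u where "ray_limit V UNIV p a u" using p in_tnn_schubert_iff[OF V] by blast
    from ray_limit_Some[OF this, of e] show ?thesis using that by auto
  qed
  moreover have "s (p e) ^ d e \<noteq> 0" for e by (cases "p e") (auto simp: s_def add_nonneg_eq_0_iff)
  ultimately show "mh_eval d c p = 0" using Neq[of p] by auto
qed

lemma clopen_connected_imp_component:
  assumes "openin X C" "closedin X C" "connectedin X C" "C \<noteq> {}"
  shows "C \<in> connected_components_of X"
proof -
  obtain x where x: "x \<in> C" using assms(4) by blast
  have "x \<in> topspace X" using x assms(1) openin_subset by blast
  have "C \<subseteq> connected_component_of_set X x"
    using connected_component_of_maximal[OF assms(3) x] .
  moreover have "connected_component_of_set X x \<subseteq> C"
    using connectedin_clopen_cases[OF connectedin_connected_component_of assms(2,1), of x] x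
      \<open>C \<subseteq> connected_component_of_set X x\<close> by (auto simp: disjnt_def)
  ultimately have "C = connected_component_of_set X x" by blast
  then show ?thesis using \<open>x \<in> topspace X\<close> by (simp add: connected_component_in_connected_components_of)
qed

text \<open>Inside \<open>Y_open V F G\<close> the cell is cut out by the open condition that all
  coordinates on \<open>G - F\<close> are positive, and its complement by the open condition that
  one of them is negative. So the cell is clopen, and it is connected as the image of a convex set.
  That positivity leads back into the cell uses the description of finite coordinates in
  \<open>schubert_finite_part\<close>.\<close>

lemma tnnY_open_component:
  fixes V :: "(real ^ 'e::finite) set"
  assumes V: "subspace V" and FG: "F \<subseteq> G" and ac: "acyclic_flat V F" "acyclic_flat V G"
  shows "tnnY_open V F G \<in> connected_components_of (subtopology PT (Y_open V F G))"
proof -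
  define P where "P = {p::'e \<Rightarrow> real option. \<forall>e. e \<in> G - F \<longrightarrow> p e \<in> Some ` {0<..}}"
  define N where "N = {p::'e \<Rightarrow> real option. \<exists>e\<in>G - F. p e \<in> Some ` {..<0}}"
  have im: "{t. Some t \<in> Some ` A} = A" for A :: "real set" by auto
  have oP1: "openin P1top (Some ` A)" if "open A" for A using that by (auto simp: openin_P1top im)
  have "openin PT {p::'e \<Rightarrow> real option. e \<in> G - F \<longrightarrow> p e \<in> Some ` {0<..}}" for e
  proof (cases "e \<in> G - F")
    case True
    then show ?thesis using openin_PT_component[OF oP1[of "{0<..}"], of e] by simp
  next
    case False
    then have "{p::'e \<Rightarrow> real option. e \<in> G - F \<longrightarrow> p e \<in> Some ` {0<..}} = topspace PT" by auto
    then show ?thesis by (metis openin_topspace)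
  qed
  then have "openin PT (\<Inter>e. {p::'e \<Rightarrow> real option. e \<in> G - F \<longrightarrow> p e \<in> Some ` {0<..}})"
    by (intro openin_Inter) auto
  then have oP: "openin PT P" by (simp add: P_def Collect_all_eq)
  have "openin PT (\<Union>e\<in>G-F. {p::'e \<Rightarrow> real option. p e \<in> Some ` {..<0}})"
    by (intro openin_Union) (auto intro!: openin_PT_component oP1)
  moreover have "(\<Union>e\<in>G-F. {p::'e \<Rightarrow> real option. p e \<in> Some ` {..<0}}) = N"
    by (auto simp: N_def)
  ultimately have oN: "openin PT N" by simp
  have sub: "tnnY_open V F G \<subseteq> Y_open V F G"
  proof -
    have "stratum F G {0<..} \<subseteq> stratum F G (UNIV - {0})" unfolding stratum_def by force
    then show ?thesis using tnn_schubert_subset_schubert[OF V] unfolding tnnY_open_def Y_open_def by blast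
  qed
  have eq: "tnnY_open V F G = Y_open V F G \<inter> P"
  proof
    show "tnnY_open V F G \<subseteq> Y_open V F G \<inter> P"
    proof
      fix p assume p: "p \<in> tnnY_open V F G"
      then have "p \<in> P" by (auto simp: tnnY_open_def stratum_def P_def)
      then show "p \<in> Y_open V F G \<inter> P" using p sub by blast
    qed
    show "Y_open V F G \<inter> P \<subseteq> tnnY_open V F G"
    proof
      fix p assume p: "p \<in> Y_open V F G \<inter> P"
      then obtain a where a: "a \<in> V" "\<And>e. p e \<noteq> None \<Longrightarrow> p e = Some (a $ e)"
        using schubert_finite_part[OF V] unfolding Y_open_def by blast
      have st: "p \<in> stratum F G (UNIV - {0})" using p unfolding Y_open_def by blast
      have aG: "p e = Some (a $ e)" if "e \<in> G" for e
      proof -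
        have "p e \<noteq> None" using st that unfolding stratum_def by (cases "e \<in> F") auto
        then show ?thesis by (rule a(2))
      qed
      have "p = part_emb G a" using st aG unfolding stratum_def part_emb_def by auto
      moreover have "a $ e = 0" if "e \<in> F" for e
        using aG[of e] that FG st unfolding stratum_def by auto
      moreover have "0 < a $ e" if "e \<in> G - F" for e
      proof -
        have "p e \<in> Some ` {0<..}" using p that unfolding P_def by blast
        then show ?thesis using aG[of e] that by auto
      qed
      ultimately show "p \<in> tnnY_open V F G"
        unfolding tnnY_open_eq[OF V FG ac] part_emb_minor_cell_eq using a(1) by blast
    qed
  qed
  have "Y_open V F G - tnnY_open V F G = Y_open V F G \<inter> N"
  proof (intro set_eqI iffI)
    fix p assume p: "p \<in> Y_open V F G - tnnY_open V F G"
    then obtain e where e: "e \<in> G - F" "p e \<notin> Some ` {0<..}" unfolding eq P_def by blast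
    then obtain t where "t \<noteq> 0" "p e = Some t" using p unfolding Y_open_def stratum_def by blast
    then have "p e \<in> Some ` {..<0}" using e(2) by (auto simp: image_iff not_less)
    then show "p \<in> Y_open V F G \<inter> N" using e p unfolding N_def by blast
  next
    fix p assume p: "p \<in> Y_open V F G \<inter> N"
    then obtain e where e: "e \<in> G - F" "p e \<in> Some ` {..<0}" unfolding N_def by blast
    then have "p e \<notin> Some ` {0<..}" by auto
    then show "p \<in> Y_open V F G - tnnY_open V F G" using p e unfolding eq P_def by blast
  qed
  then have "openin (subtopology PT (Y_open V F G)) (Y_open V F G - tnnY_open V F G)"
    using oN by (auto simp: openin_subtopology)
  then have "closedin (subtopology PT (Y_open V F G)) (tnnY_open V F G)"
    using sub unfolding closedin_def by simp
  moreover have "openin (subtopology PT (Y_open V F G)) (tnnY_open V F G)"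
    using oP eq by (auto simp: openin_subtopology)
  moreover have "connectedin (subtopology PT (Y_open V F G)) (tnnY_open V F G)"
  proof -
    have "convex (minor_cell V F G)"
      unfolding convex_alt
    proof (intro ballI allI impI)
      fix x y :: "real ^ 'e" and u :: real
      assume xy: "x \<in> minor_cell V F G" "y \<in> minor_cell V F G" and u: "0 \<le> u \<and> u \<le> 1"
      have "(1 - u) *\<^sub>R x + u *\<^sub>R y \<in> minor V F G"
        using xy subspace_minor[OF V] unfolding minor_cell_def by (simp add: subspace_add subspace_scale)
      moreover have "0 < (1 - u) * x $ e + u * y $ e" if "e \<in> G - F" for e
      proof -
        have "0 < x $ e" "0 < y $ e" using xy that unfolding minor_cell_def by auto
        then show ?thesis using u
          by (cases "u = 0") (auto intro!: add_nonneg_pos)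
      qed
      ultimately show "(1 - u) *\<^sub>R x + u *\<^sub>R y \<in> minor_cell V F G" unfolding minor_cell_def by simp
    qed
    then have "connectedin euclidean (minor_cell V F G)" by (simp add: convex_connected)
    from connectedin_continuous_map_image[OF continuous_map_part_emb this]
    show ?thesis using sub by (simp add: connectedin_subtopology tnnY_open_eq[OF V FG ac])
  qed
  moreover have "tnnY_open V F G \<noteq> {}" using tnnY_open_nonempty_iff[OF V FG] ac by blast
  ultimately show ?thesis using clopen_connected_imp_component by blast
qed

section \<open>Closures of cells and ranks\<close>

text \<open>Since \<open>v\<close> is positive exactly on \<open>G - F\<close>, the open cell takes
  the shape to which \<open>ray_limit_in_closure\<close> applies.\<close>

lemma minor_cell_eq:
  assumes "v \<in> minor_cell V F G"
  shows "minor_cell V F G = {x \<in> minor V F G. \<forall>e\<in>G. 0 \<le> x $ e \<and> (0 < v $ e \<longrightarrow> 0 < x $ e)}"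
proof -
  have v: "0 < v $ e \<longleftrightarrow> e \<in> G - F" for e
    using assms minor_outside[of v V F G e] unfolding minor_cell_def by force
  have "(\<forall>e\<in>G-F. 0 < x $ e) \<longleftrightarrow> (\<forall>e\<in>G. 0 \<le> x $ e \<and> (0 < v $ e \<longrightarrow> 0 < x $ e))"
    if "x \<in> minor V F G" for x
  proof
    assume *: "\<forall>e\<in>G-F. 0 < x $ e"
    show "\<forall>e\<in>G. 0 \<le> x $ e \<and> (0 < v $ e \<longrightarrow> 0 < x $ e)"
    proof
      fix e assume "e \<in> G"
      then show "0 \<le> x $ e \<and> (0 < v $ e \<longrightarrow> 0 < x $ e)"
        using * minor_outside[OF that, of e] v[of e] by (cases "e \<in> F") (auto simp: less_imp_le)
    qed
  next
    assume *: "\<forall>e\<in>G. 0 \<le> x $ e \<and> (0 < v $ e \<longrightarrow> 0 < x $ e)"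
    then show "\<forall>e\<in>G-F. 0 < x $ e" using v by auto
  qed
  then show ?thesis unfolding minor_cell_def by auto
qed

lemma minor_cell_nonempty:
  assumes "acyclic_flat V F"
  obtains v where "v \<in> minor_cell V F G"
proof -
  obtain w where w: "w \<in> V" "\<forall>e\<in>F. w $ e = 0" "\<forall>e. e \<notin> F \<longrightarrow> 0 < w $ e"
    using assms acyclic_flat_iff by blast
  have "coord_proj G w \<in> minor_cell V F G"
    unfolding minor_cell_def minor_def using w by auto
  then show ?thesis using that by blast
qed

text \<open>Upper bound: the closure lies in that of the larger set of non-negative vectors, whose
  points are ends of rays. Lower bound: each such end is also reached from inside the open cell, by
  the perturbation along \<open>v\<close>.\<close>

lemma tnnY_eq:
  fixes V :: "(real ^ 'e::finite) set"
  assumes V: "subspace V" and FG: "F \<subseteq> G" and ac: "acyclic_flat V F" "acyclic_flat V G"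
  shows "tnnY V F G = {p. \<exists>a u. ray_limit (minor V F G) G p a u}"
proof -
  obtain v where v: "v \<in> minor_cell V F G" using minor_cell_nonempty[OF ac(1)] .
  have U: "subspace (minor V F G)" by (rule subspace_minor[OF V])
  have vU: "v \<in> minor V F G" "\<forall>e\<in>G. 0 \<le> v $ e"
    using v minor_cell_eq[OF v] by (auto simp: minor_cell_def)
  have cl: "tnnY V F G = PT closure_of (part_emb G ` {x \<in> minor V F G. \<forall>e\<in>G. 0 \<le> x $ e \<and> (0 < v $ e \<longrightarrow> 0 < x $ e)})"
    unfolding tnnY_def tnnY_open_eq[OF V FG ac] minor_cell_eq[OF v] ..
  show ?thesis
  proof (intro set_eqI iffI CollectI)
    fix p assume "p \<in> tnnY V F G"
    moreover have "tnnY V F G \<subseteq> PT closure_of (part_emb G ` {x \<in> minor V F G. \<forall>e\<in>G. 0 \<le> x $ e})"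
      unfolding cl by (rule closure_of_mono) auto
    ultimately show "\<exists>a u. ray_limit (minor V F G) G p a u"
      using closure_imp_ray_limit[OF U] by blast
  next
    fix p assume "p \<in> {p. \<exists>a u. ray_limit (minor V F G) G p a u}"
    then obtain a u where "ray_limit (minor V F G) G p a u" by blast
    from ray_limit_in_closure[OF U vU this] show "p \<in> tnnY V F G" unfolding cl .
  qed
qed

text \<open>A ray in the minor is lifted to \<open>V\<close>, and a large multiple of a vector that
  vanishes on \<open>G\<close> and is positive elsewhere is added to its direction. The end of the
  new ray is the same point, now seen in \<open>tnn_schubert V\<close>; its zero and finite
  coordinates name the smaller cell. In the other direction a ray in \<open>V\<close> is projected
  to \<open>G\<close>.\<close>

lemma tnnY_decomposition:
  fixes V :: "(real ^ 'e::finite) set"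
  assumes V: "subspace V" and FG: "F \<subseteq> G" and ac: "acyclic_flat V F" "acyclic_flat V G"
  shows "tnnY V F G = \<Union>{tnnY_open V F' G' | F' G'.
            F \<subseteq> F' \<and> F' \<subseteq> G' \<and> G' \<subseteq> G \<and> acyclic_flat V F' \<and> acyclic_flat V G'}"
proof (intro set_eqI iffI)
  fix p assume "p \<in> tnnY V F G"
  then obtain a' u' where r': "ray_limit (minor V F G) G p a' u'"
    unfolding tnnY_eq[OF V FG ac] by blast
  then obtain a u where a: "a \<in> V" "\<forall>e\<in>F. a $ e = 0" "a' = coord_proj G a"
    and u: "u \<in> V" "\<forall>e\<in>F. u $ e = 0" "u' = coord_proj G u"
    unfolding ray_limit_def minor_def by blast
  obtain g where g: "g \<in> V" "\<forall>e\<in>G. g $ e = 0" "\<forall>e. e \<notin> G \<longrightarrow> 0 < g $ e"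
    using ac(2) acyclic_flat_iff by blast
  obtain s where s: "\<forall>e. 0 < g $ e \<longrightarrow> 0 < u $ e + s * g $ e"
    using ex_pos_combination[of "\<lambda>e. g $ e" "\<lambda>e. u $ e"] by blast
  define w where "w = u + s *\<^sub>R g"
  define F' where "F' = {e. p e = Some 0}"
  define G' where "G' = {e. p e \<noteq> None}"
  have offG: "p e = None" if "e \<notin> G" for e using r' that unfolding ray_limit_def by blast
  have G'G: "G' \<subseteq> G"
  proof
    fix e assume "e \<in> G'"
    then show "e \<in> G" using offG[of e] by (cases "e \<in> G") (auto simp: G'_def)
  qed
  have some: "u $ e = 0" "0 \<le> a $ e" "p e = Some (a $ e)" if "e \<in> G'" for e
    using ray_limit_Some[OF r', of e] that G'G a(3) u(3) unfolding G'_def by auto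
  have "ray_limit V UNIV p a w"
    unfolding ray_limit_def
  proof (intro conjI allI impI ballI)
    show "a \<in> V" by fact
    show "w \<in> V" unfolding w_def using u g V by (simp add: subspace_add subspace_scale)
    fix e
    consider "e \<in> G'" | "e \<in> G - G'" | "e \<notin> G" by blast
    then show "0 < w $ e \<and> p e = None \<or> w $ e = 0 \<and> 0 \<le> a $ e \<and> p e = Some (a $ e)"
    proof cases
      case 1
      then show ?thesis using some[OF 1] g(2) G'G by (auto simp: w_def)
    next
      case 2
      then have "p e = None" by (simp add: G'_def)
      then have "0 < u $ e" using ray_limit_None[OF r', of e] 2 u(3) by simp
      then show ?thesis using \<open>p e = None\<close> 2 g(2) by (simp add: w_def)
    next
      case 3
      then show ?thesis using offG[OF 3] g(3) s by (simp add: w_def)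
    qed
  qed simp
  then have "p \<in> tnn_schubert V" using in_tnn_schubert_iff[OF V] by blast
  moreover have "p \<in> stratum F' G' {0<..}"
  proof -
    have "\<exists>t\<in>{0<..}. p e = Some t" if "e \<in> G' - F'" for e
    proof -
      have "a $ e \<noteq> 0" using some(3)[of e] that unfolding F'_def by auto
      then show ?thesis using some[of e] that by auto
    qed
    then show ?thesis unfolding stratum_def F'_def G'_def by auto
  qed
  ultimately have p: "p \<in> tnnY_open V F' G'" unfolding tnnY_open_def by blast
  have "F' \<subseteq> G'" unfolding F'_def G'_def by auto
  then have "acyclic_flat V F'" "acyclic_flat V G'" using tnnY_open_nonempty_iff[OF V] p by blast+
  moreover have "F \<subseteq> F'"
  proof
    fix e assume e: "e \<in> F"
    \<comment> \<open>\<open>u\<close> vanishes on \<open>F\<close>, so no coordinate there can run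
      off to infinity.\<close>
    then have "e \<in> G'" using ray_limit_None[OF r', of e] FG u unfolding G'_def by auto
    then show "e \<in> F'" using some(3)[of e] a(2) e unfolding F'_def by simp
  qed
  ultimately show "p \<in> \<Union>{tnnY_open V F' G' | F' G'.
            F \<subseteq> F' \<and> F' \<subseteq> G' \<and> G' \<subseteq> G \<and> acyclic_flat V F' \<and> acyclic_flat V G'}"
    using p \<open>F' \<subseteq> G'\<close> G'G by blast
next
  fix p assume "p \<in> \<Union>{tnnY_open V F' G' | F' G'.
            F \<subseteq> F' \<and> F' \<subseteq> G' \<and> G' \<subseteq> G \<and> acyclic_flat V F' \<and> acyclic_flat V G'}"
  then obtain F' G' where FG': "F \<subseteq> F'" "F' \<subseteq> G'" "G' \<subseteq> G" "acyclic_flat V F'" "acyclic_flat V G'"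
    and p: "p \<in> tnnY_open V F' G'" by blast
  then obtain a where a: "a \<in> V" "\<forall>e\<in>F'. a $ e = 0" "\<forall>e\<in>G'-F'. 0 < a $ e" "p = part_emb G' a"
    unfolding tnnY_open_eq[OF V FG'(2,4,5)] part_emb_minor_cell_eq by blast
  obtain u where u: "u \<in> V" "\<forall>e\<in>G'. u $ e = 0" "\<forall>e. e \<notin> G' \<longrightarrow> 0 < u $ e"
    using FG'(5) acyclic_flat_iff by blast
  have "ray_limit (minor V F G) G p (coord_proj G a) (coord_proj G u)"
    unfolding ray_limit_def
  proof (intro conjI allI impI ballI)
    show "coord_proj G a \<in> minor V F G" "coord_proj G u \<in> minor V F G"
      unfolding minor_def using a u FG' by (intro imageI CollectI conjI ballI; blast)+
    show "p e = None" if "e \<notin> G" for e using a(4) that FG'(3) by (auto simp: part_emb_def)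
    fix e assume "e \<in> G"
    have "0 \<le> a $ e" if "e \<in> G'" using a that by (cases "e \<in> F'") (auto simp: less_imp_le)
    then show "0 < coord_proj G u $ e \<and> p e = None \<or> coord_proj G u $ e = 0 \<and>
        0 \<le> coord_proj G a $ e \<and> p e = Some (coord_proj G a $ e)"
      using \<open>e \<in> G\<close> a(4) u by (cases "e \<in> G'") (auto simp: part_emb_def)
  qed
  then show "p \<in> tnnY V F G" unfolding tnnY_eq[OF V FG ac] by blast
qed

text \<open>On \<open>?V F\<close> the projection to \<open>G\<close> has kernel
  \<open>?V G\<close>, and the orthogonal complement \<open>W\<close> of the kernel is carried
  isomorphically to the minor. The truncated subtraction is exact because
  \<open>dim (?V G) \<le> dim (?V F) \<le> dim V\<close>.\<close>

lemma dim_minor: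
  fixes V :: "(real ^ 'e::finite) set"
  assumes V: "subspace V" and FG: "F \<subseteq> G"
  shows "dim (minor V F G) = rk V G - rk V F"
proof -
  let ?V = "\<lambda>F. {a\<in>V. \<forall>e\<in>F. a $ e = 0}"
  define W where "W = {y \<in> ?V F. \<forall>x\<in>?V G. orthogonal x y}"
  have sub: "?V G \<subseteq> ?V F" using FG by auto
  have d: "dim W + dim (?V G) = dim (?V F)"
    unfolding W_def
    by (rule dim_subspace_orthogonal_to_vectors[OF subspace_vanishing[OF V] subspace_vanishing[OF V] sub])
  have W: "subspace W"
    unfolding W_def using subspace_vanishing[OF V, of F]
    by (auto simp: subspace_def orthogonal_def inner_add_right)
  have "inj_on (coord_proj G) W"
  proof (rule linear_inj_on_iff_eq_0[THEN iffD2, OF linear_coord_proj W], intro ballI impI)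
    fix x assume x: "x \<in> W" "coord_proj G x = 0"
    have "x $ e = 0" if "e \<in> G" for e
    proof -
      have "coord_proj G x $ e = 0" using x(2) by simp
      then show ?thesis using that by simp
    qed
    then have "x \<in> ?V G" using x(1) unfolding W_def by blast
    then have "orthogonal x x" using x(1) unfolding W_def by blast
    then show "x = 0" by (simp add: orthogonal_self)
  qed
  then have "dim (coord_proj G ` W) = dim W"
    by (intro dim_image_eq linear_coord_proj) (use W in \<open>simp add: span_eq_iff[THEN iffD2]\<close>)
  moreover have "coord_proj G ` W = minor V F G"
  proof
    show "coord_proj G ` W \<subseteq> minor V F G" unfolding minor_def W_def by blast
    show "minor V F G \<subseteq> coord_proj G ` W"
    proof
      fix y assume "y \<in> minor V F G"
      then obtain a where a: "a \<in> ?V F" "y = coord_proj G a" unfolding minor_def by blast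
      obtain b c where bc: "b \<in> span (?V G)" "\<And>w. w \<in> span (?V G) \<Longrightarrow> orthogonal c w" "a = b + c"
        using orthogonal_subspace_decomp_exists[of "?V G" a] by blast
      have b: "b \<in> ?V G" using bc(1) span_eq_iff[THEN iffD2, OF subspace_vanishing[OF V, of G]] by blast
      have "c = a - b" using bc(3) by simp
      then have "c \<in> ?V F" using a(1) b sub subspace_diff[OF subspace_vanishing[OF V, of F]] by blast
      then have "c \<in> W" unfolding W_def using bc(2) by (auto simp: orthogonal_commute span_base)
      moreover have "y = coord_proj G c" using a(2) bc(3) b by (auto simp: vec_eq_iff)
      ultimately show "y \<in> coord_proj G ` W" by blast
    qed
  qed
  moreover have "dim (?V F) \<le> dim V" by (rule dim_subset) auto
  ultimately show ?thesis using d unfolding rk_def by simp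
qed

text \<open>This puts the boundary of a cell into cells of lower dimension. Passing from an acyclic
  flat to a strictly larger index set strictly shrinks the space of vectors vanishing on it, because
  the positive witness is lost; monotonicity keeps the natural subtractions exact.\<close>

lemma rk_diff_less:
  fixes V :: "(real ^ 'e::finite) set"
  assumes V: "subspace V" and FG: "F \<subseteq> F'" "F' \<subseteq> G'" "G' \<subseteq> G"
    and ac: "acyclic_flat V F" "acyclic_flat V G'" and ne: "(F', G') \<noteq> (F, G)"
  shows "rk V G' - rk V F' < rk V G - rk V F"
proof -
  let ?V = "\<lambda>F. {a\<in>V. \<forall>e\<in>F. a $ e = 0}"
  have mono: "dim (?V B) \<le> dim (?V A)" if "A \<subseteq> B" for A B
    by (rule dim_subset) (use that in auto)
  have strict: "dim (?V B) < dim (?V A)" if AB: "A \<subset> B" "acyclic_flat V A" for A B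
  proof (rule dim_psubset)
    obtain v where v: "v \<in> V" "\<forall>e\<in>A. v $ e = 0" "\<forall>e. e \<notin> A \<longrightarrow> 0 < v $ e"
      using AB(2) acyclic_flat_iff by blast
    obtain e where e: "e \<in> B - A" using AB(1) by blast
    then have "v $ e \<noteq> 0" using v(3) less_irrefl by auto
    then have "v \<in> ?V A" "v \<notin> ?V B" using v e by auto
    moreover have "?V B \<subseteq> ?V A" using AB(1) by auto
    ultimately have "?V B \<subset> ?V A" by blast
    then show "span (?V B) \<subset> span (?V A)"
      using subspace_vanishing[OF V] by (simp add: span_eq_iff[THEN iffD2])
  qed
  have "dim (?V F') < dim (?V F) \<or> dim (?V G) < dim (?V G')"
    using strict[of F F'] strict[of G' G] FG ac ne by blast
  then show ?thesis
    using mono[OF FG(1)] mono[OF FG(2)] mono[OF FG(3)] mono[of "{}" F] mono[of "{}" G]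
      mono[of "{}" F'] mono[of "{}" G'] unfolding rk_def by (simp, linarith)
qed

section \<open>Orthonormal frames and balls\<close>

text \<open>A non-empty image that is open by invariance of domain and closed by hypothesis fills a
  connected target. Openness of the target is a by-product, used for a convex body where it is not
  evident.\<close>

lemma invariance_of_domain_image_eq:
  fixes f :: "'a::euclidean_space \<Rightarrow> 'a"
  assumes U: "subspace U" and A: "openin (top_of_set U) A" "A \<noteq> {}"
    and f: "continuous_on A f" "inj_on f A" "f ` A \<subseteq> T" and T: "T \<subseteq> U" "connected T"
    and cl: "closedin (top_of_set T) (f ` A)"
  shows "f ` A = T" "openin (top_of_set U) T"
proof -
  have *: "openin (top_of_set U) (f ` A)"
    by (rule invariance_of_domain_subspaces[OF A(1) U U]) (use f T in auto)
  from this have "openin (top_of_set T) (f ` A)"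
    using f(3) T(1) by (rule openin_subset_trans)
  then show "f ` A = T" using cl T(2) A(2) unfolding connected_clopen by blast
  then show "openin (top_of_set U) T" using * by simp
qed

lemma homeomorphism_rel_interior_subset:
  fixes S :: "'a::euclidean_space set" and T :: "'b::euclidean_space set"
  assumes h: "homeomorphism S T f g" and d: "aff_dim T \<le> aff_dim S"
  shows "f ` rel_interior S \<subseteq> rel_interior T"
proof (rule rel_interior_maximal)
  have sub: "rel_interior S \<subseteq> S" by (rule rel_interior_subset)
  show "f ` rel_interior S \<subseteq> T" using h sub by (auto simp: homeomorphism_def)
  show "openin (top_of_set (affine hull T)) (f ` rel_interior S)"
  proof (rule invariance_of_domain_affine_sets)
    show "openin (top_of_set (affine hull S)) (rel_interior S)" by (rule openin_rel_interior)
    show "continuous_on (rel_interior S) f" using h sub continuous_on_subset homeomorphism_cont1 by blast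
    show "f \<in> rel_interior S \<rightarrow> affine hull T"
      using h sub hull_subset[of T affine] by (auto simp: homeomorphism_def)
    show "inj_on f (rel_interior S)"
      by (rule inj_on_inverseI[of _ g]) (use h sub in \<open>auto simp: homeomorphism_def\<close>)
  qed (use d in auto)
qed

text \<open>Invariance of domain in both directions. It lets an unspecified homeomorphism from a
  convex body to a ball carry the open cell to the open ball.\<close>

lemma homeomorphism_rel_interior:
  fixes S :: "'a::euclidean_space set" and T :: "'b::euclidean_space set"
  assumes h: "homeomorphism S T f g" and d: "aff_dim T = aff_dim S"
  shows "f ` rel_interior S = rel_interior T"
proof
  show "f ` rel_interior S \<subseteq> rel_interior T"
    using homeomorphism_rel_interior_subset[OF h] d by simp
  have "g ` rel_interior T \<subseteq> rel_interior S"
    using homeomorphism_rel_interior_subset[OF homeomorphism_symD[OF h]] d by simp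
  moreover have "f (g y) = y" if "y \<in> rel_interior T" for y
    using h that rel_interior_subset[of T] by (auto simp: homeomorphism_def)
  ultimately show "rel_interior T \<subseteq> f ` rel_interior S" by force
qed

text \<open>The basis is numbered because the model balls and orthants are sets of functions on
  \<open>{..<n}\<close>.\<close>

locale orthonormal_frame =
  fixes U :: "'a::euclidean_space set" and n :: nat and \<beta> :: "nat \<Rightarrow> 'a"
  assumes U: "subspace U" and dimU: "dim U = n"
    and \<beta>_in: "\<And>i. i < n \<Longrightarrow> \<beta> i \<in> U"
    and \<beta>_inner: "\<And>i j. i < n \<Longrightarrow> j < n \<Longrightarrow> \<beta> i \<bullet> \<beta> j = (if i = j then 1 else 0)"
    and \<beta>_expand: "\<And>x. x \<in> U \<Longrightarrow> (\<Sum>i<n. (x \<bullet> \<beta> i) *\<^sub>R \<beta> i) = x"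

lemma orthonormal_frame_exists:
  fixes U :: "'a::euclidean_space set"
  assumes U: "subspace U"
  obtains \<beta> where "orthonormal_frame U (dim U) \<beta>"
proof -
  obtain B where B: "B \<subseteq> U" "pairwise orthogonal B" "\<And>x. x \<in> B \<Longrightarrow> norm x = 1"
     "independent B" "card B = dim U" "span B = U" using orthonormal_basis_subspace[OF U] by blast
  have fin: "finite B" using B(4) independent_imp_finite by blast
  obtain \<beta> where \<beta>: "bij_betw \<beta> {..<dim U} B"
    using ex_bij_betw_nat_finite[OF fin] B(5) by (auto simp: atLeast0LessThan)
  have "orthonormal_frame U (dim U) \<beta>"
  proof
    show "\<beta> i \<in> U" if "i < dim U" for i using \<beta> that B(1) by (auto simp: bij_betw_def)
    show "\<beta> i \<bullet> \<beta> j = (if i = j then 1 else 0)" if "i < dim U" "j < dim U" for i j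
    proof (cases "i = j")
      case True
      have "\<beta> i \<in> B" using \<beta> that by (auto simp: bij_betw_def)
      then show ?thesis using True B(3) by (simp add: norm_eq_1)
    next
      case False
      have "\<beta> i \<in> B" "\<beta> j \<in> B" "\<beta> i \<noteq> \<beta> j"
        using \<beta> that False by (auto simp: bij_betw_def inj_on_def)
      then show ?thesis using B(2) False unfolding pairwise_def orthogonal_def by auto
    qed
    show "(\<Sum>i<dim U. (x \<bullet> \<beta> i) *\<^sub>R \<beta> i) = x" if "x \<in> U" for x
    proof -
      have "(\<Sum>i<dim U. (x \<bullet> \<beta> i) *\<^sub>R \<beta> i) = (\<Sum>b\<in>B. (x \<bullet> b) *\<^sub>R b)"
        by (rule sum.reindex_bij_betw[OF \<beta>])
      also have "\<dots> = x"
        using orthonormal_basis_expand[OF B(2,3) _ fin] that B(6) by blast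
      finally show ?thesis .
    qed
  qed (use U in auto)
  then show ?thesis using that by blast
qed

context orthonormal_frame
begin

definition proj :: "'a \<Rightarrow> 'a" where
  "proj w = (\<Sum>i<n. (w \<bullet> \<beta> i) *\<^sub>R \<beta> i)"

definition coord :: "'a \<Rightarrow> nat \<Rightarrow> real" where
  "coord x = restrict (\<lambda>i. x \<bullet> \<beta> i) {..<n}"

definition comb :: "(nat \<Rightarrow> real) \<Rightarrow> 'a" where
  "comb c = (\<Sum>i<n. c i *\<^sub>R \<beta> i)"

lemma comb_in: "comb c \<in> U"
  unfolding comb_def by (intro subspace_sum U subspace_scale \<beta>_in) auto

lemma proj_in: "proj w \<in> U"
  unfolding proj_def by (intro subspace_sum U subspace_scale \<beta>_in) auto

lemma inner_proj: "u \<in> U \<Longrightarrow> proj w \<bullet> u = w \<bullet> u"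
proof -
  assume "u \<in> U"
  then have "w \<bullet> u = w \<bullet> (\<Sum>i<n. (u \<bullet> \<beta> i) *\<^sub>R \<beta> i)" using \<beta>_expand by simp
  also have "\<dots> = proj w \<bullet> u"
    unfolding proj_def inner_sum_left inner_sum_right
    by (rule sum.cong) (auto simp: inner_commute)
  finally show ?thesis by simp
qed

lemma linear_proj: "linear proj"
  by (rule linearI)
    (simp_all add: proj_def inner_add_left scaleR_add_left sum.distrib scaleR_sum_right)

lemma coord_comb: "c \<in> {..<n} \<rightarrow>\<^sub>E UNIV \<Longrightarrow> coord (comb c) = c"
proof
  fix i assume c: "c \<in> {..<n} \<rightarrow>\<^sub>E UNIV"
  show "coord (comb c) i = c i"
  proof (cases "i < n")
    case True
    have "comb c \<bullet> \<beta> i = (\<Sum>j<n. c j * (\<beta> j \<bullet> \<beta> i))" by (simp add: comb_def inner_sum_left)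
    also have "\<dots> = (\<Sum>j<n. if j = i then c i else 0)"
      by (rule sum.cong) (use True \<beta>_inner in auto)
    also have "\<dots> = c i" using True by simp
    finally show ?thesis using True by (simp add: coord_def)
  next
    case False
    then show ?thesis using c by (auto simp: coord_def PiE_def extensional_def)
  qed
qed

lemma comb_coord: "x \<in> U \<Longrightarrow> comb (coord x) = x"
  using \<beta>_expand[of x] by (simp add: comb_def coord_def)

lemma homeomorphic_maps_coord:
  "homeomorphic_maps (top_of_set U) (top_of_set ({..<n} \<rightarrow>\<^sub>E UNIV)) coord comb"
proof -
  have "continuous_on U coord"
  proof (rule continuous_on_coordinatewise_then_product)
    show "continuous_on U (\<lambda>x. coord x i)" for i
      unfolding coord_def by (cases "i < n") (auto intro!: continuous_intros)
  qed
  moreover have "continuous_on ({..<n} \<rightarrow>\<^sub>E UNIV) comb"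
    unfolding comb_def
    by (intro continuous_intros continuous_on_product_then_coordinatewise[OF continuous_on_id])
  moreover have "coord x \<in> {..<n} \<rightarrow>\<^sub>E UNIV" for x by (simp add: coord_def)
  ultimately show ?thesis
    unfolding homeomorphic_maps_def by (auto simp: comb_in coord_comb comb_coord)
qed

lemma norm_coord: "x \<in> U \<Longrightarrow> (\<Sum>i<n. (coord x i)\<^sup>2) = (norm x)\<^sup>2"
proof -
  assume x: "x \<in> U"
  have "(norm x)\<^sup>2 = x \<bullet> (\<Sum>i<n. (x \<bullet> \<beta> i) *\<^sub>R \<beta> i)" using \<beta>_expand[OF x] by (simp add: dot_square_norm)
  also have "\<dots> = (\<Sum>i<n. (coord x i)\<^sup>2)"
    by (simp add: inner_sum_right coord_def power2_eq_square)
  finally show ?thesis by simp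
qed

lemma coord_image:
  assumes "\<And>x. x \<in> U \<Longrightarrow> x \<in> A \<longleftrightarrow> coord x \<in> C" "C \<subseteq> {..<n} \<rightarrow>\<^sub>E UNIV"
  shows "coord ` (U \<inter> A) = C"
proof
  show "coord ` (U \<inter> A) \<subseteq> C" using assms(1) by auto
  show "C \<subseteq> coord ` (U \<inter> A)"
  proof
    fix c assume c: "c \<in> C"
    then have "coord (comb c) = c" using coord_comb assms(2) by blast
    moreover have "comb c \<in> A" using assms(1)[OF comb_in] c \<open>coord (comb c) = c\<close> by simp
    ultimately show "c \<in> coord ` (U \<inter> A)" using comb_in by (metis Int_iff imageI)
  qed
qed

lemma coord_PiE: "coord x \<in> {..<n} \<rightarrow>\<^sub>E UNIV"
  by (simp add: coord_def)

lemma coord_cball: "coord ` (U \<inter> cball 0 1) = closed_nball n"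
proof (rule coord_image)
  show "x \<in> cball 0 1 \<longleftrightarrow> coord x \<in> closed_nball n" if "x \<in> U" for x
    using norm_coord[OF that] coord_PiE[of x] by (simp add: closed_nball_def abs_square_le_1)
qed (auto simp: closed_nball_def)

lemma coord_ball: "coord ` (U \<inter> ball 0 1) = open_nball n"
proof (rule coord_image)
  show "x \<in> ball 0 1 \<longleftrightarrow> coord x \<in> open_nball n" if "x \<in> U" for x
    using norm_coord[OF that] coord_PiE[of x] by (simp add: open_nball_def abs_square_less_1)
qed (auto simp: open_nball_def)

text \<open>The detour over the unit ball \<open>T\<close> of \<open>U\<close>, which has the same
  dimension as \<open>S\<close>, stays within Euclidean spaces; only the norm-preserving map
  \<open>coord\<close> enters the function space in which the model ball lives.\<close>

lemma compact_convex_homeomorphic_nball: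
  assumes S: "convex S" "compact S" "aff_dim S = int n"
  obtains h where "homeomorphic_map (top_of_set S) (top_of_set (closed_nball n)) h"
    "h ` rel_interior S = open_nball n"
proof -
  define T where "T = cball 0 1 \<inter> U"
  have aff: "affine U" using U by (rule subspace_imp_affine)
  have zero: "(0::'a) \<in> interior (cball 0 1) \<inter> U" using subspace_0[OF U] by simp
  have T: "convex T" "compact T"
    unfolding T_def using U
    by (auto intro: convex_Int subspace_imp_convex closed_subspace)
  have "affine hull T = U"
    unfolding T_def Int_commute[of "cball 0 1" U]
    by (subst affine_hull_affine_Int_nonempty_interior[OF aff]) (use zero aff in auto)
  then have dT: "aff_dim T = int n"
    using aff_dim_subspace[OF U] dimU aff_dim_affine_hull[of T] by simp
  have riT: "rel_interior T = ball 0 1 \<inter> U"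
  proof -
    have "interior (cball 0 1) \<inter> U \<noteq> {}" using zero by blast
    from rel_interior_convex_Int_affine[OF convex_cball aff this] show ?thesis by (simp add: T_def)
  qed
  obtain f g where fg: "homeomorphism S T f g"
    using homeomorphic_convex_compact_sets[OF S(1,2) T] S(3) dT unfolding homeomorphic_def by auto
  have "homeomorphic_map (top_of_set S) (top_of_set T) f"
    using fg by (auto simp: homeomorphic_map_maps homeomorphic_maps_def homeomorphism_def)
  moreover have "homeomorphic_map (top_of_set T) (top_of_set (closed_nball n)) coord"
  proof -
    have "homeomorphic_map (subtopology (top_of_set U) T)
        (subtopology (top_of_set ({..<n} \<rightarrow>\<^sub>E UNIV)) (closed_nball n)) coord"
      by (rule homeomorphic_map_subtopologies[OF homeomorphic_maps_imp_map[OF homeomorphic_maps_coord]])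
        (use coord_cball in \<open>auto simp: T_def closed_nball_def Int_commute\<close>)
    moreover have "U \<inter> T = T" "({..<n} \<rightarrow>\<^sub>E UNIV) \<inter> closed_nball n = closed_nball n"
      by (auto simp: T_def closed_nball_def)
    ultimately show ?thesis by (simp add: subtopology_subtopology)
  qed
  ultimately have "homeomorphic_map (top_of_set S) (top_of_set (closed_nball n)) (coord \<circ> f)"
    by (rule homeomorphic_map_compose)
  moreover have "(coord \<circ> f) ` rel_interior S = open_nball n"
  proof -
    have "f ` rel_interior S = U \<inter> ball 0 1"
      using homeomorphism_rel_interior[OF fg] S(3) dT riT by (simp add: Int_commute)
    then show ?thesis using coord_ball by (metis image_comp)
  qed
  ultimately show ?thesis using that by blast
qed

end

section \<open>Closed cells are balls\<close>

text \<open>In the application \<open>U\<close> is the minor of \<open>V\<close> for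
  \<open>F\<close> and \<open>G\<close>, and \<open>J = G - F\<close>. The set \<open>G\<close> is
  retained because coordinates in \<open>G - J\<close> are zero whereas those off \<open>G\<close>
  are infinite.\<close>

locale positive_frame = orthonormal_frame U n \<beta>
  for U :: "(real ^ 'e::finite) set" and n \<beta> +
  fixes J G :: "'e set" and v :: "real ^ 'e"
  assumes vU: "v \<in> U" and vpos: "\<And>e. e \<in> J \<Longrightarrow> 0 < v $ e" and JG: "J \<subseteq> G"
    and outside: "\<And>x e. x \<in> U \<Longrightarrow> e \<notin> J \<Longrightarrow> x $ e = 0"
begin

definition cell :: "(real ^ 'e) set" where
  "cell = {x \<in> U. \<forall>e\<in>J. 0 < x $ e}"

definition closed_cell :: "('e \<Rightarrow> real option) set" where
  "closed_cell = {p. \<exists>a u. ray_limit U G p a u}"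

text \<open>In the coordinates \<open>exp (- x\<^sub>e / v\<^sub>e)\<close>, translation along \<open>v\<close> becomes scaling.\<close>
definition wt :: "('e \<Rightarrow> real option) \<Rightarrow> real ^ 'e" where
  "wt p = (\<chi> e. if e \<in> J then (case p e of None \<Rightarrow> 0 | Some t \<Rightarrow> exp (- \<bar>t\<bar> / v $ e)) else 0)"

text \<open>For \<open>w \<ge> 0\<close>, \<open>infnorm w\<close> is the maximum. At
  \<open>w = 0\<close>, the weight of a point with all coordinates in \<open>J\<close> infinite, the
  factor is \<open>0 / 0 = 0\<close> by convention; this gives the correct limit 0, although the
  factor itself need not converge.\<close>

definition moment :: "real ^ 'e \<Rightarrow> real ^ 'e" where
  "moment w = (infnorm w / (\<Sum>e\<in>UNIV. w $ e)) *\<^sub>R proj (\<chi> e. w $ e / v $ e)"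

text \<open>The interior, in \<open>U\<close>, of the dual of the cone of non-negative vectors of
  \<open>U\<close>, cut by one half-space. As there are infinitely many strict inequalities,
  openness in \<open>U\<close> is not read off but obtained later from invariance of domain.\<close>

definition body :: "(real ^ 'e) set" where
  "body = {b \<in> U. b \<bullet> v < 1 \<and> (\<forall>u\<in>U. (\<forall>e. 0 \<le> u $ e) \<and> u \<noteq> 0 \<longrightarrow> 0 < b \<bullet> u)}"

lemma wt_nonneg: "0 \<le> wt p $ e"
  by (auto simp: wt_def split: option.splits)

lemma wt_outside: "e \<notin> J \<Longrightarrow> wt p $ e = 0"
  by (simp add: wt_def)

lemma inner_moment:
  assumes "u \<in> U"
  shows "moment w \<bullet> u = (infnorm w / (\<Sum>e\<in>UNIV. w $ e)) * (\<Sum>e\<in>UNIV. w $ e * u $ e / v $ e)"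
proof -
  have "proj (\<chi> e. w $ e / v $ e) \<bullet> u = (\<Sum>e\<in>UNIV. w $ e * u $ e / v $ e)"
    unfolding inner_proj[OF assms] by (simp add: inner_vec_def)
  then show ?thesis by (simp add: moment_def)
qed

lemma wt_eq_0_iff: "wt p = 0 \<longleftrightarrow> (\<Sum>e\<in>UNIV. wt p $ e) = 0"
  using sum_nonneg_eq_0_iff[of UNIV "\<lambda>e. wt p $ e"] wt_nonneg by (auto simp: vec_eq_iff)

text \<open>The denominators in \<open>moment\<close> cancel against \<open>v\<close>, leaving the
  sum of the weights, and the scalar factor replaces this sum by the maximum.\<close>

lemma inner_moment_v: "moment (wt p) \<bullet> v = infnorm (wt p)"
proof -
  have "wt p $ e * v $ e / v $ e = wt p $ e" for e
    using vpos[of e] wt_outside[of e p] by (cases "e \<in> J") auto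
  then have "moment (wt p) \<bullet> v = infnorm (wt p) / (\<Sum>e\<in>UNIV. wt p $ e) * (\<Sum>e\<in>UNIV. wt p $ e)"
    unfolding inner_moment[OF vU] by simp
  then show ?thesis using wt_eq_0_iff[of p] by (cases "wt p = 0") (auto simp: infnorm_0)
qed

lemma continuous_map_wt: "continuous_map PT euclidean wt"
proof -
  have "continuous_map PT euclidean (\<lambda>p. wt p $ e)" for e
  proof (cases "e \<in> J")
    case True
    let ?f = "\<lambda>q. case q of None \<Rightarrow> 0 | Some t \<Rightarrow> exp (- \<bar>t\<bar> / v $ e)"
    have "continuous_map P1top euclidean ?f"
    proof (rule continuous_map_P1top_real)
      have "filterlim (\<lambda>t::real. norm t) at_top at_infinity" by (rule filterlim_norm_at_top)
      then have "filterlim (\<lambda>t::real. \<bar>t\<bar> * (1 / v $ e)) at_top at_infinity"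
        using filterlim_at_top_mult_tendsto_pos[OF tendsto_const, of "1 / v $ e" "\<lambda>t::real. norm t" at_infinity]
          vpos[OF True] by simp
      then have "filterlim (\<lambda>t::real. - (\<bar>t\<bar> * (1 / v $ e))) at_bot at_infinity"
        by (simp add: filterlim_uminus_at_bot)
      then have "((\<lambda>t. exp (- (\<bar>t\<bar> * (1 / v $ e)))) \<longlongrightarrow> 0) at_infinity"
        by (rule filterlim_compose[OF exp_at_bot])
      then show "((\<lambda>t. ?f (Some t)) \<longlongrightarrow> ?f None) at_infinity" by simp
    qed (use vpos[OF True] in \<open>auto intro!: continuous_intros\<close>)
    from continuous_map_compose[OF continuous_map_PT_component this]
    show ?thesis using True by (simp add: wt_def o_def)
  qed (simp add: wt_def)
  then have "continuous_map PT euclidean (\<lambda>p. wt p $ e *\<^sub>R axis e (1::real))" for e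
    using continuous_map_compose[of PT euclidean "\<lambda>p. wt p $ e" euclidean "\<lambda>t. t *\<^sub>R axis e (1::real)"]
    by (simp add: o_def continuous_on_scaleR)
  then have "continuous_map PT euclidean (\<lambda>p. \<Sum>e\<in>UNIV. wt p $ e *\<^sub>R axis e (1::real))"
    by (intro continuous_map_sum) auto
  moreover have "(\<Sum>e\<in>UNIV. wt p $ e *\<^sub>R axis e (1::real)) = wt p" for p
    by (simp add: vec_eq_iff axis_def if_distrib cong: if_cong)
  ultimately show ?thesis by simp
qed

text \<open>Away from 0 the denominator does not vanish. At 0 the bound of \<open>norm w\<close> by
  the sum of its entries absorbs the denominator, so the moment is at most a constant times
  \<open>infnorm w\<close>.\<close>

lemma continuous_on_moment: "continuous_on {w. \<forall>e. 0 \<le> w $ e} moment"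
proof -
  define L where "L w = proj (\<chi> e. w $ e / v $ e)" for w
  have div: "linear (\<lambda>w. \<chi> e. w $ e / v $ e)"
    by (rule linearI) (simp_all add: vec_eq_iff add_divide_distrib)
  have L: "linear L"
    unfolding L_def using linear_compose[OF div linear_proj] by (simp add: o_def)
  obtain B where B: "B > 0" "\<And>w. norm (L w) \<le> B * norm w" using linear_bounded_pos[OF L] by blast
  show ?thesis
    unfolding continuous_on_eq_continuous_within
  proof
    fix w0 :: "real ^ 'e" assume w0: "w0 \<in> {w. \<forall>e. 0 \<le> w $ e}"
    show "continuous (at w0 within {w. \<forall>e. 0 \<le> w $ e}) moment"
    proof (cases "w0 = 0")
      case False
      then have "(\<Sum>e\<in>UNIV. w0 $ e) \<noteq> 0"
        using sum_nonneg_eq_0_iff[of UNIV "\<lambda>e. w0 $ e"] w0 by (auto simp: vec_eq_iff)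
      moreover have "isCont L w0" using L by (simp add: linear_continuous_at linear_conv_bounded_linear)
      ultimately have "isCont (\<lambda>w. (infnorm w / (\<Sum>e\<in>UNIV. w $ e)) *\<^sub>R L w) w0"
        by (intro continuous_intros) auto
      then show ?thesis
        unfolding moment_def L_def[symmetric] by (rule continuous_at_imp_continuous_at_within)
    next
      case True
      have bd: "norm (moment w) \<le> B * infnorm w" if w: "\<forall>e. 0 \<le> w $ e" for w
      proof (cases "(\<Sum>e\<in>UNIV. w $ e) = 0")
        case True
        then show ?thesis using B by (simp add: moment_def infnorm_pos_le)
      next
        case False
        have pos: "0 < (\<Sum>e\<in>UNIV. w $ e)" using False w by (simp add: order_less_le sum_nonneg)
        have "norm w \<le> (\<Sum>e\<in>UNIV. w $ e)" using norm_le_l1_cart[of w] w by simp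
        then have "norm (L w) \<le> B * (\<Sum>e\<in>UNIV. w $ e)" using B mult_left_mono order_trans less_imp_le by meson
        then have "infnorm w / (\<Sum>e\<in>UNIV. w $ e) * norm (L w)
            \<le> infnorm w / (\<Sum>e\<in>UNIV. w $ e) * (B * (\<Sum>e\<in>UNIV. w $ e))"
          using pos by (intro mult_left_mono) (auto simp: infnorm_pos_le)
        also have "\<dots> = B * infnorm w" using pos by simp
        finally show ?thesis using pos by (simp add: moment_def L_def[symmetric] infnorm_pos_le real_abs_infnorm)
      qed
      have "((\<lambda>w::real ^ 'e. B * infnorm w) \<longlongrightarrow> B * infnorm (0::real ^ 'e)) (at 0 within {w. \<forall>e. 0 \<le> w $ e})"
        by (rule tendsto_mult[OF tendsto_const tendsto_infnorm[OF tendsto_ident_at]])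
      then have "((\<lambda>w::real ^ 'e. B * infnorm w) \<longlongrightarrow> 0) (at 0 within {w. \<forall>e. 0 \<le> w $ e})"
        by (simp add: infnorm_0)
      then have "(moment \<longlongrightarrow> 0) (at 0 within {w. \<forall>e. 0 \<le> w $ e})"
        by (rule Lim_null_comparison[rotated]) (use bd in \<open>auto simp: eventually_at_filter\<close>)
      moreover have "moment 0 = 0" by (simp add: moment_def infnorm_0)
      ultimately show ?thesis using True by (simp add: continuous_within)
    qed
  qed
qed

lemma continuous_map_moment_wt: "continuous_map PT euclidean (\<lambda>p. moment (wt p))"
proof -
  have "continuous_map PT (top_of_set {w. \<forall>e. 0 \<le> w $ e}) wt"
    using continuous_map_wt wt_nonneg by (auto simp: continuous_map_in_subtopology)
  moreover have "continuous_map (top_of_set {w. \<forall>e. 0 \<le> w $ e}) euclidean moment"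
    using continuous_on_moment by simp
  ultimately show ?thesis using continuous_map_compose[of PT _ wt euclidean moment] by (simp add: o_def)
qed

lemma wt_ray_limit:
  assumes r: "ray_limit U G p a u" and e: "e \<in> J"
  shows "wt p $ e = (if 0 < u $ e then 0 else exp (- a $ e / v $ e))" "0 \<le> u $ e"
proof -
  have eG: "e \<in> G" using e JG by blast
  have "wt p $ e = (if 0 < u $ e then 0 else exp (- a $ e / v $ e)) \<and> 0 \<le> u $ e"
  proof (cases "p e")
    case None
    then show ?thesis using ray_limit_None[OF r eG] e by (simp add: wt_def)
  next
    case (Some t)
    then have "u $ e = 0" "0 \<le> a $ e" "p e = Some (a $ e)" using ray_limit_Some[OF r eG] by auto
    then show ?thesis using e by (simp add: wt_def)
  qed
  then show "wt p $ e = (if 0 < u $ e then 0 else exp (- a $ e / v $ e))" "0 \<le> u $ e" by auto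
qed

text \<open>The weights see only the coordinates in \<open>J\<close>, but the others agree for all
  points of the closed cell: 0 on \<open>G - J\<close> and infinite off \<open>G\<close>. On
  \<open>J\<close> the coordinates are non-negative, so the weight determines them in spite of the
  absolute value in \<open>wt\<close>.\<close>

lemma closed_cell_eqI:
  assumes p: "ray_limit U G p a u" and q: "ray_limit U G q b w" and eq: "wt p = wt q"
  shows "p = q"
proof
  fix e
  have nn: "0 \<le> t" if "ray_limit U G p a u" "e \<in> G" "p e = Some t" for p a u t
    using ray_limit_Some[OF that(1,2)] that(3) by auto
  have F: "p e = Some 0" if r: "ray_limit U G p a u" and "e \<in> G - J" for p a u
  proof -
    have "u \<in> U" "a \<in> U" using r unfolding ray_limit_def by auto
    then have "u $ e = 0" "a $ e = 0" using outside that(2) by auto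
    then show ?thesis using ray_limit_None[OF r, of e] ray_limit_Some(3)[OF r, of e] that(2)
      by (cases "p e") auto
  qed
  consider "e \<notin> G" | "e \<in> G - J" | "e \<in> J" using JG by blast
  then show "p e = q e"
  proof cases
    case 1
    then show ?thesis using p q unfolding ray_limit_def by auto
  next
    case 2
    then show ?thesis using F[OF p] F[OF q] by simp
  next
    case 3
    have "wt p $ e = wt q $ e" using eq by simp
    moreover have "e \<in> G" using 3 JG by blast
    ultimately show ?thesis
      using 3 vpos[OF 3] nn[OF p] nn[OF q]
      by (cases "p e"; cases "q e") (auto simp: wt_def)
  qed
qed

text \<open>The pairing of the difference of two moments with the difference of (points far out on)
  the two rays has only non-positive terms.\<close>
lemma inj_on_moment_wt: "inj_on (\<lambda>p. moment (wt p)) closed_cell"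
proof (rule inj_onI)
  fix p q assume pq: "p \<in> closed_cell" "q \<in> closed_cell" and eq: "moment (wt p) = moment (wt q)"
  obtain a u where p: "ray_limit U G p a u" using pq(1) unfolding closed_cell_def by blast
  obtain b w where q: "ray_limit U G q b w" using pq(2) unfolding closed_cell_def by blast
  have inU: "a \<in> U" "u \<in> U" "b \<in> U" "w \<in> U" using p q unfolding ray_limit_def by auto
  \<comment> \<open>Pairing with \<open>v\<close> recovers the maximal weight, so it remains to
    compare the two weight vectors up to a positive scalar.\<close>
  have norm_eq: "infnorm (wt p) = infnorm (wt q)"
    using inner_moment_v[of p] inner_moment_v[of q] eq by simp
  have "wt p = wt q"
  proof (cases "wt p = 0")
    case True
    then show ?thesis using norm_eq infnorm_eq_0 by (metis infnorm_0)
  next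
    case False
    define S where "S = (\<Sum>e\<in>UNIV. wt p $ e)"
    define S' where "S' = (\<Sum>e\<in>UNIV. wt q $ e)"
    define k where "k = infnorm (wt p)"
    have k: "k > 0" using False by (simp add: k_def infnorm_pos_lt)
    then have "wt q \<noteq> 0" using norm_eq by (auto simp: k_def infnorm_0)
    then have S: "S > 0" "S' > 0"
      using False wt_eq_0_iff[of p] wt_eq_0_iff[of q] wt_nonneg
      by (auto simp: S_def S'_def order_less_le intro!: sum_nonneg)
    \<comment> \<open>Dividing the weights by their sum \<open>S\<close> is a translation of the ray
      by \<open>ln S\<close> along \<open>v\<close>; likewise for \<open>S'\<close> and
      \<open>y\<close>. The normalised weights are thus again exponentials of points on parallel
      rays.\<close>
    define x where "x = a + ln S *\<^sub>R v"
    define y where "y = b + ln S' *\<^sub>R v"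
    have xw: "wt p $ e / S = (if 0 < u $ e then 0 else exp (- x $ e / v $ e))" if "e \<in> J" for e
    proof -
      have "- x $ e / v $ e = - a $ e / v $ e - ln S" using vpos[OF that] by (simp add: x_def field_simps)
      then have "exp (- x $ e / v $ e) = exp (- a $ e / v $ e) / S" using S by (simp add: exp_diff)
      then show ?thesis using wt_ray_limit[OF p that] by simp
    qed
    have yw: "wt q $ e / S' = (if 0 < w $ e then 0 else exp (- y $ e / v $ e))" if "e \<in> J" for e
    proof -
      have "- y $ e / v $ e = - b $ e / v $ e - ln S'" using vpos[OF that] by (simp add: y_def field_simps)
      then have "exp (- y $ e / v $ e) = exp (- b $ e / v $ e) / S'" using S by (simp add: exp_diff)
      then show ?thesis using wt_ray_limit[OF q that] by simp
    qed
    obtain s1 where s1: "\<forall>s\<ge>s1. \<forall>e. 0 < u $ e \<longrightarrow> 0 < (x - y) $ e + s * u $ e"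
      using ex_pos_combination[of "\<lambda>e. u $ e" "\<lambda>e. (x - y) $ e"] by blast
    obtain s2 where s2: "\<forall>s\<ge>s2. \<forall>e. 0 < w $ e \<longrightarrow> 0 < (y - x) $ e + s * w $ e"
      using ex_pos_combination[of "\<lambda>e. w $ e" "\<lambda>e. (y - x) $ e"] by blast
    \<comment> \<open>For this \<open>s\<close> the sign of \<open>l\<close> below is decided by the
      directions wherever exactly one of the two rays is infinite; where both are infinite, both
      weights are zero and the term vanishes.\<close>
    define s where "s = max s1 s2"
    define l where "l = x - y + s *\<^sub>R (u - w)"
    have lU: "l \<in> U" unfolding l_def x_def y_def
      using inU vU U by (intro subspace_add subspace_diff subspace_scale) auto
    define T where "T e = (wt p $ e / S - wt q $ e / S') * (l $ e / v $ e)" for e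
    have T: "T e \<le> 0 \<and> (T e = 0 \<longrightarrow> wt p $ e / S = wt q $ e / S')" for e
    proof (cases "e \<in> J")
      case False
      then show ?thesis by (simp add: T_def wt_outside)
    next
      case True
      have ve: "0 < v $ e" using vpos[OF True] .
      have uw: "0 \<le> u $ e" "0 \<le> w $ e" using wt_ray_limit(2)[OF p True] wt_ray_limit(2)[OF q True] by auto
      consider "0 < u $ e" "0 < w $ e" | "0 < u $ e" "w $ e = 0" | "u $ e = 0" "0 < w $ e"
        | "u $ e = 0" "w $ e = 0" using uw by linarith
      then show ?thesis
      proof cases
        case 1
        then show ?thesis unfolding T_def xw[OF True] yw[OF True] by simp
      next
        case 2
        have "0 < l $ e / v $ e" using s1 2 ve by (simp add: l_def s_def)
        then have "T e < 0" unfolding T_def xw[OF True] yw[OF True]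
          using 2 by (intro mult_neg_pos) simp_all
        then show ?thesis by simp
      next
        case 3
        have "0 < (y - x) $ e + s * w $ e" using s2 3 by (simp add: s_def)
        then have "l $ e / v $ e < 0" using 3 ve by (simp add: l_def divide_neg_pos)
        then have "T e < 0" unfolding T_def xw[OF True] yw[OF True]
          using 3 by (intro mult_pos_neg) simp_all
        then show ?thesis by simp
      next
        case 4
        define X where "X = x $ e / v $ e"
        define Y where "Y = y $ e / v $ e"
        \<comment> \<open>Both coordinates are finite here: strict monotonicity of
          \<open>exp\<close> makes this product negative unless \<open>X = Y\<close>.\<close>
        have Te: "T e = (exp (- X) - exp (- Y)) * (X - Y)"
          unfolding T_def xw[OF True] yw[OF True] using 4 ve
          by (simp add: l_def X_def Y_def diff_divide_distrib)
        consider "X < Y" | "X = Y" | "Y < X" by linarith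
        then have "T e < 0 \<or> X = Y"
          by cases (auto simp: Te mult_pos_neg mult_neg_pos)
        moreover have "T e = 0 \<and> wt p $ e / S = wt q $ e / S'" if "X = Y"
          using that Te xw[OF True] yw[OF True] 4 by (simp add: X_def Y_def)
        ultimately show ?thesis by auto
      qed
    qed
    have "(\<Sum>e\<in>UNIV. T e) = 0"
    proof -
      have "k / S * (\<Sum>e\<in>UNIV. wt p $ e * l $ e / v $ e) = k / S' * (\<Sum>e\<in>UNIV. wt q $ e * l $ e / v $ e)"
        using inner_moment[OF lU, of "wt p"] inner_moment[OF lU, of "wt q"] eq norm_eq
        by (simp add: k_def S_def S'_def)
      then have "k * ((\<Sum>e\<in>UNIV. wt p $ e * l $ e / v $ e) / S) = k * ((\<Sum>e\<in>UNIV. wt q $ e * l $ e / v $ e) / S')"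
        by (simp only: times_divide_eq_left times_divide_eq_right)
      then have "(\<Sum>e\<in>UNIV. wt p $ e * l $ e / v $ e) / S = (\<Sum>e\<in>UNIV. wt q $ e * l $ e / v $ e) / S'"
        using k by (simp only: mult_cancel_left) simp
      moreover have "T e = wt p $ e * l $ e / v $ e / S - wt q $ e * l $ e / v $ e / S'" for e
        by (simp add: T_def left_diff_distrib right_diff_distrib diff_divide_distrib mult.commute)
      ultimately show ?thesis by (simp only: sum_subtractf sum_divide_distrib[symmetric])
    qed
    then have "T e = 0" for e
      using sum_nonneg_eq_0_iff[of UNIV "\<lambda>e. - T e"] T by (auto simp: sum_negf)
    then have "wt p $ e / S = wt q $ e / S'" for e using T by blast
    then have scal: "wt p = (S / S') *\<^sub>R wt q" using S by (simp add: vec_eq_iff field_simps)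
    \<comment> \<open>Proportional weight vectors with the same maximum \<open>k > 0\<close> are
      equal.\<close>
    then have "k = S / S' * k" using norm_eq S infnorm_mul[of "S / S'" "wt q"] by (simp add: k_def)
    then have "S = S'" using k S by (simp add: field_simps)
    then show ?thesis using scal S by simp
  qed
  then show "p = q" using closed_cell_eqI[OF p q] by simp
qed

lemma part_emb_cell_subset: "part_emb G ` cell \<subseteq> closed_cell"
proof
  fix p assume "p \<in> part_emb G ` cell"
  then obtain x where x: "x \<in> U" "\<forall>e\<in>J. 0 < x $ e" "p = part_emb G x" unfolding cell_def by blast
  have "0 \<le> x $ e" for e using x outside[OF x(1), of e] by (cases "e \<in> J") (auto simp: less_imp_le)
  then have "ray_limit U G p x 0" using x subspace_0[OF U] by (auto simp: ray_limit_def part_emb_def)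
  then show "p \<in> closed_cell" unfolding closed_cell_def by blast
qed

text \<open>Positive coordinates make all weights less than 1, hence also the pairing with
  \<open>v\<close>; finite coordinates make the weights on \<open>J\<close> positive, hence the
  pairing with every non-zero non-negative vector of \<open>U\<close>.\<close>

lemma moment_cell_in_body:
  assumes "x \<in> cell"
  shows "moment (wt (part_emb G x)) \<in> body"
proof -
  let ?w = "wt (part_emb G x)"
  have x: "x \<in> U" "\<And>e. e \<in> J \<Longrightarrow> 0 < x $ e" using assms unfolding cell_def by auto
  have w: "?w $ e = exp (- x $ e / v $ e)" if "e \<in> J" for e
    using that JG x(2)[OF that] by (auto simp: wt_def part_emb_def)
  have lt: "\<bar>?w $ e\<bar> < 1" for e
    using w[of e] x(2)[of e] vpos[of e] wt_outside[of e] by (cases "e \<in> J") auto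
  have "infnorm ?w < 1"
    unfolding infnorm_Max
    by (subst Max_less_iff) (auto simp: lt cart_eq_inner_axis[symmetric] Basis_vec_def)
  moreover have "0 < moment ?w \<bullet> u" if u: "u \<in> U" "\<forall>e. 0 \<le> u $ e" "u \<noteq> 0" for u
  proof -
    obtain e where e: "u $ e \<noteq> 0" using u(3) by (auto simp: vec_eq_iff)
    then have eJ: "e \<in> J" using outside[OF u(1)] by blast
    have we: "0 < ?w $ e" using w[OF eJ] by simp
    have wn: "?w \<noteq> 0" using we by auto
    then have "0 < infnorm ?w" by (simp add: infnorm_pos_lt)
    moreover have "0 < (\<Sum>e\<in>UNIV. ?w $ e)"
      using wn wt_eq_0_iff wt_nonneg by (simp add: order_less_le sum_nonneg)
    moreover have "0 < (\<Sum>e\<in>UNIV. ?w $ e * u $ e / v $ e)"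
    proof (rule sum_pos2[of _ e])
      show "0 < ?w $ e * u $ e / v $ e" using we e u(2) vpos[OF eJ] by (simp add: order_less_le)
      show "0 \<le> ?w $ i * u $ i / v $ i" for i
        using wt_nonneg[of _ i] wt_outside[of i] u(2) vpos[of i]
        by (cases "i \<in> J") (auto simp: less_imp_le)
    qed auto
    ultimately show ?thesis unfolding inner_moment[OF u(1)] by simp
  qed
  moreover have "moment ?w \<in> U" unfolding moment_def by (intro subspace_scale U proj_in)
  ultimately show ?thesis unfolding body_def using inner_moment_v by simp
qed

text \<open>Weights vanish wherever \<open>u\<close> is positive, so a non-zero direction would pair
  to 0 with the moment, which \<open>body\<close> forbids. The bound by 1 on the maximal weight then
  makes every coordinate in \<open>J\<close> strictly positive.\<close>

lemma moment_in_body_imp_cell: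
  assumes p: "p \<in> closed_cell" and b: "moment (wt p) \<in> body"
  shows "p \<in> part_emb G ` cell"
proof -
  obtain a u where r: "ray_limit U G p a u" using p unfolding closed_cell_def by blast
  have au: "a \<in> U" "u \<in> U" using r unfolding ray_limit_def by auto
  have unn: "0 \<le> u $ e" for e using wt_ray_limit(2)[OF r, of e] outside[OF au(2), of e] by (cases "e \<in> J") auto
  have "u = 0"
  proof (rule ccontr)
    assume "u \<noteq> 0"
    then have "0 < moment (wt p) \<bullet> u" using b au unn unfolding body_def by blast
    moreover have "wt p $ e * u $ e / v $ e = 0" for e
    proof (cases "e \<in> J")
      case True
      then show ?thesis using wt_ray_limit[OF r True] by auto
    qed (simp add: wt_outside)
    ultimately show False unfolding inner_moment[OF au(2)] by simp
  qed
  then have pe: "p e = Some (a $ e)" if "e \<in> G" for e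
    using ray_limit_None[OF r that] ray_limit_Some(3)[OF r that] by (cases "p e") auto
  have "0 < a $ e" if e: "e \<in> J" for e
  proof -
    have "exp (- a $ e / v $ e) = wt p $ e" using wt_ray_limit(1)[OF r e] \<open>u = 0\<close> by simp
    also have "\<dots> \<le> infnorm (wt p)" using component_le_infnorm_cart[of "wt p" e] by simp
    also have "\<dots> < 1" using b inner_moment_v[of p] unfolding body_def by simp
    finally show ?thesis using vpos[OF e] by (simp add: zero_less_divide_iff)
  qed
  then have "a \<in> cell" using au unfolding cell_def by blast
  moreover have "p = part_emb G a" using pe r unfolding ray_limit_def part_emb_def by auto
  ultimately show ?thesis by blast
qed

lemma openin_cell: "openin (top_of_set U) cell"
proof -
  have "open (\<Inter>e\<in>J. {x::real ^ 'e. 0 < x $ e})"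
    by (intro open_INT ballI open_Collect_less continuous_intros) auto
  moreover have "cell = U \<inter> (\<Inter>e\<in>J. {x. 0 < x $ e})" unfolding cell_def by auto
  ultimately show ?thesis by (auto simp: openin_open)
qed

lemma convex_body: "convex body"
  unfolding convex_alt
proof (intro ballI allI impI)
  fix x y :: "real ^ 'e" and t :: real
  assume xy: "x \<in> body" "y \<in> body" and t: "0 \<le> t \<and> t \<le> 1"
  have pos: "0 < (1 - t) * r + t * s" if "0 < r" "0 < s" for r s :: real
    using t that by (cases "t = 0") (auto intro!: add_nonneg_pos)
  have "(1 - t) *\<^sub>R x + t *\<^sub>R y \<in> U"
    using xy U unfolding body_def by (simp add: subspace_add subspace_scale)
  moreover have "((1 - t) *\<^sub>R x + t *\<^sub>R y) \<bullet> v < 1"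
    using pos[of "1 - x \<bullet> v" "1 - y \<bullet> v"] xy unfolding body_def by (simp add: algebra_simps)
  moreover have "0 < ((1 - t) *\<^sub>R x + t *\<^sub>R y) \<bullet> u" if "u \<in> U" "(\<forall>e. 0 \<le> u $ e) \<and> u \<noteq> 0" for u
    using pos[of "x \<bullet> u" "y \<bullet> u"] xy that unfolding body_def by (simp add: inner_add_left)
  ultimately show "(1 - t) *\<^sub>R x + t *\<^sub>R y \<in> body" unfolding body_def by blast
qed

lemma closed_cell_homeomorphic_nball:
  assumes cl: "PT closure_of (part_emb G ` cell) = closed_cell"
  obtains h where "homeomorphic_map (subtopology PT closed_cell) (top_of_set (closed_nball n)) h"
    "h ` part_emb G ` cell = open_nball n"
proof -
  define f where "f = (\<lambda>p. moment (wt p))"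
  define g where "g = (\<lambda>x. f (part_emb G x))"
  have f: "continuous_map PT euclidean f" unfolding f_def by (rule continuous_map_moment_wt)
  have injf: "inj_on f closed_cell" unfolding f_def by (rule inj_on_moment_wt)
  have closed: "closedin PT closed_cell" using cl closedin_closure_of[of PT "part_emb G ` cell"] by simp
  then have "compactin PT closed_cell" by (rule closedin_compact_space[OF compact_space_PT])
  then have cpt: "compact (f ` closed_cell)" using image_compactin[OF _ f] by simp
  \<comment> \<open>Boundary points of the cell miss \<open>body\<close>, so the image of the open
    cell is the trace of a compact set on \<open>body\<close>. This is the closedness required by
    the clopen argument.\<close>
  have gcell: "g ` cell = f ` closed_cell \<inter> body"
    using part_emb_cell_subset moment_cell_in_body moment_in_body_imp_cell
    unfolding g_def f_def by blast
  have "continuous_map euclidean euclidean g"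
    using continuous_map_compose[OF continuous_map_part_emb f] by (simp add: g_def o_def)
  then have contg: "continuous_on cell g" using continuous_on_subset by fastforce
  have injg: "inj_on g cell"
  proof (rule inj_onI)
    fix x y assume xy: "x \<in> cell" "y \<in> cell" "g x = g y"
    have "f (part_emb G x) = f (part_emb G y)" using xy(3) by (simp add: g_def)
    moreover have "part_emb G x \<in> closed_cell" "part_emb G y \<in> closed_cell"
      using part_emb_cell_subset xy by blast+
    ultimately have "part_emb G x = part_emb G y" using injf unfolding inj_on_def by blast
    then have "(part_emb G x) e = (part_emb G y) e" for e by simp
    then have "x $ e = y $ e" if "e \<in> G" for e
      using that by (metis option.inject part_emb_def)
    moreover have "x $ e = y $ e" if "e \<notin> J" for e
      using that outside[of x e] outside[of y e] xy unfolding cell_def by simp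
    ultimately show "x = y" using JG by (auto simp: vec_eq_iff)
  qed
  have vc: "v \<in> cell" using vU vpos unfolding cell_def by blast
  have sub: "body \<subseteq> U" unfolding body_def by blast
  have clg: "closedin (top_of_set body) (g ` cell)"
    unfolding gcell using cpt compact_imp_closed closedin_closed_Int by (metis Int_commute)
  have body_eq: "g ` cell = body" and opn: "openin (top_of_set U) body"
    using invariance_of_domain_image_eq[OF U openin_cell _ contg injg _ sub convex_connected[OF convex_body] clg]
      vc gcell by blast+
  have im: "f ` closed_cell = closure body"
  proof
    have "f ` (PT closure_of (part_emb G ` cell)) \<subseteq> euclidean closure_of (f ` part_emb G ` cell)"
      by (rule continuous_map_image_closure_subset[OF f])
    moreover have "f ` part_emb G ` cell = body" using body_eq by (simp add: g_def image_image)
    ultimately show "f ` closed_cell \<subseteq> closure body" unfolding cl by simp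
    show "closure body \<subseteq> f ` closed_cell"
      using gcell body_eq compact_imp_closed[OF cpt] by (intro closure_minimal) auto
  qed
  have ne: "body \<noteq> {}" using body_eq vc by blast
  have ad: "aff_dim (closure body) = int n"
    using aff_dim_openin[OF opn subspace_imp_affine[OF U] ne] aff_dim_subspace[OF U] dimU by simp
  have "affine hull body \<subseteq> U" using sub subspace_imp_affine[OF U] by (rule hull_minimal)
  then have "openin (top_of_set (affine hull body)) body"
    using openin_subset_trans[OF opn] hull_subset[of body affine] by blast
  \<comment> \<open>\<open>body\<close> is convex and open in its affine hull, so taking the closure
    adds no interior points; the open cell therefore corresponds to the open ball.\<close>
  then have ri: "rel_interior (closure body) = body"
    using convex_rel_interior_closure[OF convex_body] by (simp add: rel_interior_eq)
  obtain h where h: "homeomorphic_map (top_of_set (closure body)) (top_of_set (closed_nball n)) h"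
    "h ` rel_interior (closure body) = open_nball n"
    using compact_convex_homeomorphic_nball[OF convex_closure[OF convex_body] _ ad] cpt im by metis
  have "homeomorphic_map (subtopology PT closed_cell) (top_of_set (closure body)) f"
  proof (rule continuous_imp_homeomorphic_map)
    show "continuous_map (subtopology PT closed_cell) (top_of_set (closure body)) f"
      using f im by (auto simp: continuous_map_in_subtopology continuous_map_from_subtopology)
    show "compact_space (subtopology PT closed_cell)"
      using \<open>compactin PT closed_cell\<close> by (simp add: compact_space_subtopology)
  qed (use im injf in \<open>auto simp: Hausdorff_space_subtopology\<close>)
  then have "homeomorphic_map (subtopology PT closed_cell) (top_of_set (closed_nball n)) (h \<circ> f)"
    using h(1) by (rule homeomorphic_map_compose)
  moreover have "(h \<circ> f) ` part_emb G ` cell = open_nball n"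
  proof -
    have "(h \<circ> f) ` part_emb G ` cell = h ` g ` cell" by (simp add: g_def image_image)
    then show ?thesis using h(2) body_eq ri by simp
  qed
  ultimately show ?thesis using that by blast
qed

end

section \<open>Semialgebraic cells\<close>

text \<open>\<open>poly_fun\<close> asks for a set of exponents; here terms are indexed by any
  finite set, and equal exponents are collected. Sums and products of polynomials can then use the
  index sets \<open>A <+> B\<close> and \<open>A \<times> B\<close> directly.\<close>

lemma poly_funI:
  assumes fin: "finite I" and off: "\<And>i v. i \<in> I \<Longrightarrow> v \<notin> J \<Longrightarrow> \<alpha> i v = (0::nat)"
    and p: "\<And>x. p x = (\<Sum>i\<in>I. c i * (\<Prod>v\<in>J. x v ^ \<alpha> i v))"
  shows "poly_fun J p"
  unfolding poly_fun_def
proof (intro exI conjI allI ballI impI)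
  show "finite (\<alpha> ` I)" using fin by simp
  show "a v = 0" if "a \<in> \<alpha> ` I" "v \<notin> J" for a v using that off by auto
  fix x
  have "p x = (\<Sum>a\<in>\<alpha> ` I. \<Sum>i\<in>{i\<in>I. \<alpha> i = a}. c i * (\<Prod>v\<in>J. x v ^ \<alpha> i v))"
    unfolding p by (rule sum.image_gen[OF fin])
  also have "\<dots> = (\<Sum>a\<in>\<alpha> ` I. (\<Sum>i\<in>{i\<in>I. \<alpha> i = a}. c i) * (\<Prod>v\<in>J. x v ^ a v))"
    by (simp add: sum_distrib_right)
  finally show "p x = (\<Sum>a\<in>\<alpha> ` I. (\<Sum>i\<in>{i\<in>I. \<alpha> i = a}. c i) * (\<Prod>v\<in>J. x v ^ a v))" .
qed

lemma poly_fun_const: "poly_fun J (\<lambda>x. k)"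
  by (rule poly_funI[of "{()}" J "\<lambda>_ _. 0" _ "\<lambda>_. k"]) auto

lemma poly_fun_var:
  assumes "finite J" "v \<in> J"
  shows "poly_fun J (\<lambda>x. x v)"
proof (rule poly_funI[of "{()}" J "\<lambda>_ w. if w = v then 1 else 0" _ "\<lambda>_. 1"])
  fix x :: "'a \<Rightarrow> real"
  have "(\<Prod>w\<in>J. x w ^ (if w = v then 1 else 0)) = (\<Prod>w\<in>J. if w = v then x v else 1)"
    by (rule prod.cong) auto
  then show "x v = (\<Sum>i\<in>{()}. 1 * (\<Prod>w\<in>J. x w ^ (if w = v then 1 else 0)))" using assms by simp
qed (use assms in auto)

lemma poly_fun_add:
  assumes "poly_fun J p" "poly_fun J q"
  shows "poly_fun J (\<lambda>x. p x + q x)"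
proof -
  obtain A c where A: "finite A" "\<forall>\<alpha>\<in>A. \<forall>v. v \<notin> J \<longrightarrow> \<alpha> v = (0::nat)"
    "\<forall>x. p x = (\<Sum>\<alpha>\<in>A. c \<alpha> * (\<Prod>v\<in>J. x v ^ \<alpha> v))" using assms(1) unfolding poly_fun_def by blast
  obtain B d where B: "finite B" "\<forall>\<alpha>\<in>B. \<forall>v. v \<notin> J \<longrightarrow> \<alpha> v = (0::nat)"
    "\<forall>x. q x = (\<Sum>\<alpha>\<in>B. d \<alpha> * (\<Prod>v\<in>J. x v ^ \<alpha> v))" using assms(2) unfolding poly_fun_def by blast
  show ?thesis
    by (rule poly_funI[of "A <+> B" J "case_sum id id" _ "case_sum c d"])
      (use A B in \<open>auto simp: sum.Plus\<close>)
qed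

lemma poly_fun_mult:
  assumes "poly_fun J p" "poly_fun J q"
  shows "poly_fun J (\<lambda>x. p x * q x)"
proof -
  obtain A c where A: "finite A" "\<forall>\<alpha>\<in>A. \<forall>v. v \<notin> J \<longrightarrow> \<alpha> v = (0::nat)"
    "\<forall>x. p x = (\<Sum>\<alpha>\<in>A. c \<alpha> * (\<Prod>v\<in>J. x v ^ \<alpha> v))" using assms(1) unfolding poly_fun_def by blast
  obtain B d where B: "finite B" "\<forall>\<alpha>\<in>B. \<forall>v. v \<notin> J \<longrightarrow> \<alpha> v = (0::nat)"
    "\<forall>x. q x = (\<Sum>\<alpha>\<in>B. d \<alpha> * (\<Prod>v\<in>J. x v ^ \<alpha> v))" using assms(2) unfolding poly_fun_def by blast
  show ?thesis
  proof (rule poly_funI[of "A \<times> B" J "\<lambda>(a, b) v. a v + b v" _ "\<lambda>(a, b). c a * d b"])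
    fix x
    show "p x * q x = (\<Sum>i\<in>A \<times> B. (case i of (a, b) \<Rightarrow> c a * d b) *
        (\<Prod>v\<in>J. x v ^ (case i of (a, b) \<Rightarrow> \<lambda>v. a v + b v) v))"
      unfolding A(3)[rule_format] B(3)[rule_format] sum_product sum.cartesian_product
      by (rule sum.cong) (auto simp: power_add prod.distrib)
  qed (use A B in auto)
qed

lemma poly_fun_diff:
  assumes "poly_fun J p" "poly_fun J q"
  shows "poly_fun J (\<lambda>x. p x - q x)"
  using poly_fun_add[OF assms(1) poly_fun_mult[OF poly_fun_const[of J "-1"] assms(2)]] by simp

lemma poly_fun_sum:
  assumes "finite I" "\<And>i. i \<in> I \<Longrightarrow> poly_fun J (p i)"
  shows "poly_fun J (\<lambda>x. \<Sum>i\<in>I. p i x)"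
  using assms by (induction I rule: finite_induct) (auto intro: poly_fun_const poly_fun_add)

lemma poly_fun_prod:
  assumes "finite I" "\<And>i. i \<in> I \<Longrightarrow> poly_fun J (p i)"
  shows "poly_fun J (\<lambda>x. \<Prod>i\<in>I. p i x)"
  using assms by (induction I rule: finite_induct) (auto intro: poly_fun_const poly_fun_mult)

lemma semialg_subset: "semialg J A \<Longrightarrow> A \<subseteq> J \<rightarrow>\<^sub>E UNIV"
  by (induction rule: semialg.induct) auto

lemma semialg_Int:
  assumes "semialg J A" "semialg J B"
  shows "semialg J (A \<inter> B)"
proof -
  have "semialg J ((J \<rightarrow>\<^sub>E UNIV) - (((J \<rightarrow>\<^sub>E UNIV) - A) \<union> ((J \<rightarrow>\<^sub>E UNIV) - B)))"
    by (intro semialg.intros assms)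
  moreover have "(J \<rightarrow>\<^sub>E UNIV) - (((J \<rightarrow>\<^sub>E UNIV) - A) \<union> ((J \<rightarrow>\<^sub>E UNIV) - B)) = A \<inter> B"
    using semialg_subset[OF assms(1)] by blast
  ultimately show ?thesis by simp
qed

lemma semialg_conj:
  assumes "semialg J {x \<in> J \<rightarrow>\<^sub>E UNIV. P x}" "semialg J {x \<in> J \<rightarrow>\<^sub>E UNIV. Q x}"
  shows "semialg J {x \<in> J \<rightarrow>\<^sub>E UNIV. P x \<and> Q x}"
proof -
  have "{x \<in> J \<rightarrow>\<^sub>E UNIV. P x \<and> Q x} = {x \<in> J \<rightarrow>\<^sub>E UNIV. P x} \<inter> {x \<in> J \<rightarrow>\<^sub>E UNIV. Q x}" by auto
  then show ?thesis using semialg_Int[OF assms] by simp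
qed

lemma semialg_ball:
  assumes "finite I" "\<And>i. i \<in> I \<Longrightarrow> semialg J {x \<in> J \<rightarrow>\<^sub>E UNIV. P i x}"
  shows "semialg J {x \<in> J \<rightarrow>\<^sub>E UNIV. \<forall>i\<in>I. P i x}"
  using assms
proof (induction I rule: finite_induct)
  case empty
  have "semialg J {x \<in> J \<rightarrow>\<^sub>E UNIV. (0::real) = 0}" by (intro semialg.sa_zero poly_fun_const)
  then show ?case by simp
next
  case (insert i I)
  then have "semialg J {x \<in> J \<rightarrow>\<^sub>E UNIV. P i x \<and> (\<forall>i\<in>I. P i x)}" by (intro semialg_conj) auto
  then show ?case by simp
qed

text \<open>The inverse of \<open>s \<mapsto> s - 1/s\<close> on the positive reals.\<close>
definition pos_root :: "real \<Rightarrow> real" where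
  "pos_root t = (t + sqrt (t\<^sup>2 + 4)) / 2"

lemma pos_root_pos: "0 < pos_root t"
proof -
  have "\<bar>t\<bar> < sqrt (t\<^sup>2 + 4)" by (rule real_less_rsqrt) simp
  then have "0 < t + sqrt (t\<^sup>2 + 4)" by (simp add: abs_less_iff)
  then show ?thesis by (simp add: pos_root_def)
qed

lemma pos_root_eq: "pos_root t - 1 / pos_root t = t"
proof -
  have "(pos_root t)\<^sup>2 = t * pos_root t + 1"
    unfolding pos_root_def by (simp add: field_simps power2_eq_square)
  then show ?thesis using pos_root_pos[of t] by (simp add: field_simps power2_eq_square)
qed

text \<open>The function \<open>s - 1/s\<close> is strictly increasing on the positive
  reals.\<close>

lemma pos_root_unique:
  assumes "0 < s" "s - 1 / s = t"
  shows "s = pos_root t"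
proof (rule ccontr)
  let ?r = "pos_root t"
  assume "s \<noteq> ?r"
  then consider "s < ?r" | "?r < s" by linarith
  then show False
  proof cases
    case 1
    then have "1 / ?r < 1 / s" using assms by (simp add: frac_less2)
    then show False using 1 assms pos_root_eq[of t] by linarith
  next
    case 2
    then have "1 / s < 1 / ?r" using pos_root_pos[of t] by (simp add: frac_less2)
    then show False using 2 assms pos_root_eq[of t] by linarith
  qed
qed

text \<open>The exponential would be the usual identification, but its graph is not semi-algebraic;
  \<open>pos_root\<close> and its rational inverse are.\<close>

lemma homeomorphic_maps_pos_orthant:
  "homeomorphic_maps (top_of_set ({..<n} \<rightarrow>\<^sub>E UNIV)) (top_of_set (pos_orthant n))
     (\<lambda>c. restrict (\<lambda>i. pos_root (c i)) {..<n}) (\<lambda>s. restrict (\<lambda>i. s i - 1 / s i) {..<n})"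
proof -
  have coord: "continuous_on A (\<lambda>c::nat \<Rightarrow> real. c i)" for i A
    by (rule continuous_on_product_then_coordinatewise[OF continuous_on_id])
  have pr: "continuous_on UNIV pos_root" unfolding pos_root_def by (intro continuous_intros) auto
  have "continuous_on ({..<n} \<rightarrow>\<^sub>E UNIV) (\<lambda>c. restrict (\<lambda>i. pos_root (c i)) {..<n})"
  proof (rule continuous_on_coordinatewise_then_product)
    show "continuous_on ({..<n} \<rightarrow>\<^sub>E UNIV) (\<lambda>c. restrict (\<lambda>i. pos_root (c i)) {..<n} i)" for i
      using continuous_on_compose2[OF pr coord] by (cases "i < n") simp_all
  qed
  moreover have "continuous_on (pos_orthant n) (\<lambda>s. restrict (\<lambda>i. s i - 1 / s i) {..<n})"
  proof (rule continuous_on_coordinatewise_then_product)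
    show "continuous_on (pos_orthant n) (\<lambda>s. restrict (\<lambda>i. s i - 1 / s i) {..<n} i)" for i
    proof (cases "i < n")
      case True
      then have "\<forall>s\<in>pos_orthant n. s i \<noteq> 0" unfolding pos_orthant_def by fastforce
      then have "continuous_on (pos_orthant n) (\<lambda>s. s i - 1 / s i)"
        by (intro continuous_on_diff continuous_on_divide continuous_on_const coord)
      then show ?thesis using True by simp
    qed simp
  qed
  moreover have "restrict (\<lambda>i. pos_root (c i)) {..<n} \<in> pos_orthant n" for c
    by (auto simp: pos_orthant_def pos_root_pos)
  moreover have "restrict (\<lambda>i. restrict (\<lambda>i. pos_root (c i)) {..<n} i - 1 / restrict (\<lambda>i. pos_root (c i)) {..<n} i) {..<n} = c"
    if "c \<in> {..<n} \<rightarrow>\<^sub>E UNIV" for c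
    using that by (auto simp: fun_eq_iff pos_root_eq PiE_def extensional_def restrict_def)
  moreover have "restrict (\<lambda>i. pos_root (restrict (\<lambda>i. s i - 1 / s i) {..<n} i)) {..<n} = s"
    if "s \<in> pos_orthant n" for s
  proof
    fix i
    show "restrict (\<lambda>i. pos_root (restrict (\<lambda>i. s i - 1 / s i) {..<n} i)) {..<n} i = s i"
    proof (cases "i < n")
      case True
      then show ?thesis using that pos_root_unique[of "s i"] by (simp add: pos_orthant_def)
    next
      case False
      then show ?thesis using that by (auto simp: pos_orthant_def PiE_def extensional_def)
    qed
  qed
  ultimately show ?thesis unfolding homeomorphic_maps_def by (auto simp: Pi_def)
qed

section \<open>A rational homeomorphism from the open cell to \<open>U\<close>\<close>

context positive_frame
begin

text \<open>The gradient of \<open>\<Sum> x\<^sub>e\<^sup>2/2 - ln x\<^sub>e\<close> maps the positive part of \<open>U\<close> bijectively to \<open>U\<close>.\<close>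
definition bar :: "real ^ 'e \<Rightarrow> real ^ 'e" where
  "bar x = proj (\<chi> e. x $ e - 1 / x $ e)"

lemma inner_J:
  assumes "u \<in> U"
  shows "w \<bullet> u = (\<Sum>e\<in>J. w $ e * u $ e)"
proof -
  have "w \<bullet> u = (\<Sum>e\<in>UNIV. if e \<in> J then w $ e * u $ e else 0)"
    unfolding inner_vec_def by (rule sum.cong) (use outside[OF assms] in auto)
  then show ?thesis by (simp add: sum.If_cases)
qed

lemma inner_bar: "u \<in> U \<Longrightarrow> bar x \<bullet> u = (\<Sum>e\<in>J. (x $ e - 1 / x $ e) * u $ e)"
  unfolding bar_def inner_proj by (subst inner_J) simp_all

lemma bar_in: "bar x \<in> U"
  unfolding bar_def by (rule proj_in)

lemma continuous_on_bar: "continuous_on cell bar"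
proof -
  have "continuous_on cell (\<lambda>x. \<chi> e. x $ e - 1 / x $ e)"
  proof (rule continuous_on_vec_lambda)
    show "continuous_on cell (\<lambda>x. x $ e - 1 / x $ e)" for e
    proof (cases "e \<in> J")
      case True
      then show ?thesis unfolding cell_def by (intro continuous_intros) auto
    next
      case False
      \<comment> \<open>Off \<open>J\<close> the coordinate is constantly 0, and
        \<open>1 / 0 = 0\<close>, so this component is the zero function on the cell.\<close>
      then have "continuous_on cell (\<lambda>x. 0::real)" by simp
      then show ?thesis
        by (rule continuous_on_eq) (use False outside in \<open>auto simp: cell_def\<close>)
    qed
  qed
  moreover have "continuous_on UNIV proj"
    using linear_proj by (simp add: linear_continuous_on linear_conv_bounded_linear)
  ultimately show ?thesis
    unfolding bar_def using continuous_on_compose2[of UNIV proj cell] by blast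
qed

text \<open>The gradient of a strictly convex function is strictly monotone: paired with
  \<open>x - y\<close>, the difference of the two values is at least the squared length of
  \<open>x - y\<close>.\<close>

lemma inj_on_bar: "inj_on bar cell"
proof (rule inj_onI)
  fix x y assume xy: "x \<in> cell" "y \<in> cell" "bar x = bar y"
  have U': "x \<in> U" "y \<in> U" "x - y \<in> U" using xy U unfolding cell_def by (auto intro: subspace_diff)
  define T where "T e = ((x $ e - 1 / x $ e) - (y $ e - 1 / y $ e)) * (x $ e - y $ e)" for e
  have "(\<Sum>e\<in>J. T e) = 0"
    using inner_bar[OF U'(3), of x] inner_bar[OF U'(3), of y] xy(3)
    by (simp add: T_def left_diff_distrib sum_subtractf)
  moreover have T: "(x $ e - y $ e)\<^sup>2 \<le> T e" if "e \<in> J" for e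
  proof -
    have pos: "0 < x $ e" "0 < y $ e" using xy that unfolding cell_def by auto
    then have "T e = (x $ e - y $ e)\<^sup>2 + (x $ e - y $ e)\<^sup>2 / (x $ e * y $ e)"
      by (simp add: T_def field_simps power2_eq_square)
    then show ?thesis using pos by simp
  qed
  ultimately have "T e = 0" if "e \<in> J" for e
    using that sum_nonneg_eq_0_iff[of J T] by (meson finite order_trans zero_le_power2)
  then have "x $ e = y $ e" if "e \<in> J" for e using T[OF that] that by simp
  moreover have "x $ e = y $ e" if "e \<notin> J" for e using outside[OF U'(1) that] outside[OF U'(2) that] by simp
  ultimately show "x = y" by (auto simp: vec_eq_iff)
qed

text \<open>The logarithm acts as a barrier. If the gradient stays bounded, pairing it with
  \<open>x\<close> bounds \<open>x\<close>, and pairing it with \<open>v\<close> keeps the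
  coordinates in \<open>J\<close> away from 0. So a convergent sequence of values comes from a
  compact part of the cell.\<close>

lemma closed_bar_image: "closed (bar ` cell)"
  unfolding closed_sequential_limits
proof (intro allI impI)
  fix f y assume *: "(\<forall>k. f k \<in> bar ` cell) \<and> f \<longlonglongrightarrow> y"
  then have "bounded (range f)" by (meson convergent_def convergent_imp_bounded)
  then obtain R where R: "R > 0" "\<And>k. norm (f k) \<le> R" unfolding bounded_pos by auto
  \<comment> \<open>For \<open>norm x > 1\<close>, the estimate of the squared norm by
    \<open>card J + R * norm x\<close> gives \<open>norm x \<le> card J + R\<close>; the extra 1
    covers shorter vectors.\<close>
  define M where "M = real (card J) + R + 1"
  \<comment> \<open>Bounds the sum of \<open>v_e / x_e\<close> over \<open>J\<close>, which is the
    pairing of \<open>x - bar x\<close> with \<open>v\<close>; the extra 1 makes \<open>N\<close>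
    positive.\<close>
  define N where "N = norm v * (M + R) + 1"
  \<comment> \<open>The lower bounds on the coordinates are multiplied out, so that \<open>K\<close>
    is visibly closed.\<close>
  define K where "K = {x. norm x \<le> M} \<inter> U \<inter> (\<Inter>e\<in>J. {x. v $ e \<le> N * x $ e})"
  have N: "N > 0" using R unfolding N_def M_def by (simp add: add_nonneg_pos)
  have Kc: "K \<subseteq> cell"
  proof
    fix x assume x: "x \<in> K"
    have "0 < x $ e" if "e \<in> J" for e
    proof -
      have "v $ e \<le> N * x $ e" using x that unfolding K_def by blast
      then have "0 < N * x $ e" using vpos[OF that] by linarith
      then show ?thesis using N by (simp add: zero_less_mult_iff)
    qed
    then show "x \<in> cell" using x unfolding K_def cell_def by blast
  qed
  have "closed ({x. norm x \<le> M} \<inter> U \<inter> (\<Inter>e\<in>J. {x. v $ e \<le> N * x $ e}))"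
    by (intro closed_Int closed_INT closed_subspace U ballI closed_Collect_le continuous_intros)
  moreover have "bounded K" unfolding K_def bounded_iff by blast
  ultimately have "compact K" unfolding K_def by (simp add: compact_eq_bounded_closed)
  then have "closed (bar ` K)"
    using Kc continuous_on_bar by (meson compact_continuous_image compact_imp_closed continuous_on_subset)
  moreover have "f k \<in> bar ` K" for k
  proof -
    obtain x where x: "x \<in> cell" "f k = bar x" using * by blast
    have xU: "x \<in> U" and xp: "\<And>e. e \<in> J \<Longrightarrow> 0 < x $ e" using x(1) unfolding cell_def by auto
    have bR: "norm (bar x) \<le> R" using R(2)[of k] x(2) by simp
    have "bar x \<bullet> x = (\<Sum>e\<in>J. x $ e * x $ e - 1)"
      unfolding inner_bar[OF xU] by (rule sum.cong) (use xp in \<open>auto simp: left_diff_distrib less_imp_neq[symmetric]\<close>)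
    also have "\<dots> = (norm x)\<^sup>2 - card J"
      by (simp add: sum_subtractf inner_J[OF xU, symmetric] dot_square_norm)
    finally have "(norm x)\<^sup>2 = card J + bar x \<bullet> x" by simp
    also have "\<dots> \<le> card J + R * norm x"
      using norm_cauchy_schwarz[of "bar x" x] bR mult_right_mono[OF bR, of "norm x"] by simp
    finally have sq: "norm x * norm x \<le> card J + R * norm x" by (simp add: power2_eq_square)
    have nM: "norm x \<le> M"
    proof (cases "norm x \<le> 1")
      case True
      then show ?thesis using R unfolding M_def by simp
    next
      case False
      then have "real (card J) \<le> card J * norm x" by (simp add: mult_le_cancel_left1)
      then have "norm x * norm x \<le> (card J + R) * norm x" using sq by (simp add: distrib_right)
      then have "norm x \<le> card J + R" using False by (cases "x = 0") (auto simp: mult_le_cancel_right)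
      then show ?thesis unfolding M_def by simp
    qed
    have "v $ e \<le> N * x $ e" if e: "e \<in> J" for e
    proof -
      have "v $ e / x $ e \<le> (\<Sum>e\<in>J. v $ e / x $ e)"
        using e by (intro member_le_sum) (auto simp: vpos xp less_imp_le)
      also have "\<dots> = x \<bullet> v - bar x \<bullet> v"
        unfolding inner_bar[OF vU] by (simp add: inner_J[OF vU] left_diff_distrib sum_subtractf)
      also have "\<dots> \<le> norm x * norm v + norm (bar x) * norm v"
        using norm_cauchy_schwarz[of x v] norm_cauchy_schwarz[of "- bar x" v] by simp
      also have "\<dots> \<le> M * norm v + R * norm v"
        using nM bR by (intro add_mono mult_right_mono) auto
      also have "\<dots> \<le> N" by (simp add: N_def algebra_simps)
      finally show ?thesis using xp[OF e] by (simp add: pos_divide_le_eq)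
    qed
    then have "x \<in> K" using nM xU unfolding K_def by blast
    then show ?thesis using x(2) by blast
  qed
  ultimately have "y \<in> bar ` K" using * closed_sequential_limits by blast
  then show "y \<in> bar ` cell" using Kc by blast
qed

lemma homeomorphic_map_bar: "homeomorphic_map (top_of_set cell) (top_of_set U) bar"
proof (rule bijective_open_imp_homeomorphic_map)
  show "continuous_map (top_of_set cell) (top_of_set U) bar"
    using continuous_on_bar bar_in by auto
  show "open_map (top_of_set cell) (top_of_set U) bar"
    unfolding open_map_def
  proof (intro allI impI)
    fix W assume W: "openin (top_of_set cell) W"
    then have "W \<subseteq> cell" using openin_imp_subset by blast
    then show "openin (top_of_set U) (bar ` W)"
      using openin_trans[OF W openin_cell] continuous_on_subset[OF continuous_on_bar]
        inj_on_subset[OF inj_on_bar] bar_in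
      by (intro invariance_of_domain_subspaces[OF _ U U]) auto
  qed
  have "v \<in> cell" using vU vpos unfolding cell_def by blast
  then have "cell \<noteq> {}" by blast
  then have "bar ` cell = U"
    using closed_bar_image bar_in U
    by (intro invariance_of_domain_image_eq(1)[OF U openin_cell _ continuous_on_bar inj_on_bar])
      (auto intro: closed_subset convex_connected subspace_imp_convex)
  then show "bar ` topspace (top_of_set cell) = topspace (top_of_set U)" by simp
  show "inj_on bar (topspace (top_of_set cell))" using inj_on_bar by simp
qed

definition vec_of :: "('e \<Rightarrow> real) \<Rightarrow> real ^ 'e" where
  "vec_of \<xi> = (\<chi> e. if e \<in> J then \<xi> e else 0)"

definition cell_coords :: "('e \<Rightarrow> real) set" where
  "cell_coords = (\<lambda>x. restrict (($) x) J) ` cell"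

lemma vec_of_restrict: "x \<in> U \<Longrightarrow> vec_of (restrict (($) x) J) = x"
  using outside by (auto simp: vec_of_def vec_eq_iff)

lemma restrict_vec_of: "\<xi> \<in> J \<rightarrow>\<^sub>E UNIV \<Longrightarrow> restrict (($) (vec_of \<xi>)) J = \<xi>"
  by (auto simp: vec_of_def fun_eq_iff PiE_def extensional_def)

lemma cell_coords_iff: "\<xi> \<in> cell_coords \<longleftrightarrow> \<xi> \<in> J \<rightarrow>\<^sub>E UNIV \<and> vec_of \<xi> \<in> cell"
proof
  assume "\<xi> \<in> cell_coords"
  then obtain x where x: "x \<in> cell" "\<xi> = restrict (($) x) J" unfolding cell_coords_def by blast
  then show "\<xi> \<in> J \<rightarrow>\<^sub>E UNIV \<and> vec_of \<xi> \<in> cell" using vec_of_restrict[of x] unfolding cell_def by auto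
next
  assume "\<xi> \<in> J \<rightarrow>\<^sub>E UNIV \<and> vec_of \<xi> \<in> cell"
  then show "\<xi> \<in> cell_coords" using restrict_vec_of[of \<xi>] unfolding cell_coords_def by (metis imageI)
qed

lemma homeomorphic_map_vec_of: "homeomorphic_map (top_of_set cell_coords) (top_of_set cell) vec_of"
proof -
  have "continuous_on cell_coords vec_of"
    unfolding vec_of_def
  proof (rule continuous_on_vec_lambda)
    show "continuous_on cell_coords (\<lambda>\<xi>. if e \<in> J then \<xi> e else 0)" for e
      by (cases "e \<in> J") (auto intro: continuous_on_product_then_coordinatewise[OF continuous_on_id])
  qed
  moreover have "continuous_on cell (\<lambda>x. restrict (($) x) J)"
  proof (rule continuous_on_coordinatewise_then_product)
    show "continuous_on cell (\<lambda>x. restrict (($) x) J e)" for e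
      by (cases "e \<in> J") (auto intro!: continuous_intros)
  qed
  moreover have "restrict (($) x) J \<in> cell_coords" if "x \<in> cell" for x
    using that unfolding cell_coords_def by blast
  ultimately have "homeomorphic_maps (top_of_set cell_coords) (top_of_set cell) vec_of (\<lambda>x. restrict (($) x) J)"
    unfolding homeomorphic_maps_def
    by (auto simp: cell_coords_iff restrict_vec_of vec_of_restrict cell_def)
  then show ?thesis by (rule homeomorphic_maps_imp_map)
qed

definition orthant_map :: "('e \<Rightarrow> real) \<Rightarrow> nat \<Rightarrow> real" where
  "orthant_map \<xi> = restrict (\<lambda>i. pos_root (coord (bar (vec_of \<xi>)) i)) {..<n}"

lemma homeomorphic_map_orthant:
  "homeomorphic_map (top_of_set cell_coords) (top_of_set (pos_orthant n)) orthant_map"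
proof -
  have "homeomorphic_map (top_of_set cell_coords) (top_of_set (pos_orthant n))
     ((\<lambda>c. restrict (\<lambda>i. pos_root (c i)) {..<n}) \<circ> (coord \<circ> (bar \<circ> vec_of)))"
    by (intro homeomorphic_map_compose[OF homeomorphic_map_compose[OF homeomorphic_map_compose[OF
        homeomorphic_map_vec_of homeomorphic_map_bar] homeomorphic_maps_imp_map[OF homeomorphic_maps_coord]]
        homeomorphic_maps_imp_map[OF homeomorphic_maps_pos_orthant]])
  moreover have "(\<lambda>c. restrict (\<lambda>i. pos_root (c i)) {..<n}) \<circ> (coord \<circ> (bar \<circ> vec_of)) = orthant_map"
    by (auto simp: orthant_map_def fun_eq_iff)
  ultimately show ?thesis by simp
qed

lemma coord_bar:
  assumes "i < n" "\<And>e. e \<in> J \<Longrightarrow> 0 < \<xi> e"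
  shows "coord (bar (vec_of \<xi>)) i = (\<Sum>e\<in>J. (\<xi> e - 1 / \<xi> e) * \<beta> i $ e)"
  using assms inner_bar[OF \<beta>_in[OF assms(1)]] by (simp add: coord_def vec_of_def)

text \<open>The equation \<open>s - 1/s = \<Sum> b\<^sub>e (x\<^sub>e - 1/x\<^sub>e)\<close> after clearing denominators.\<close>
lemma cleared_equation_iff:
  fixes x b :: "'e \<Rightarrow> real" and s :: real
  assumes x: "\<And>e. e \<in> J \<Longrightarrow> 0 < x e" and s: "0 < s"
  shows "s * (\<Sum>e\<in>J. b e * ((x e * x e - 1) * (\<Prod>e'\<in>J-{e}. x e'))) - (s * s - 1) * (\<Prod>e\<in>J. x e) = 0
    \<longleftrightarrow> s - 1 / s = (\<Sum>e\<in>J. (x e - 1 / x e) * b e)"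
proof -
  define P where "P = (\<Prod>e\<in>J. x e)"
  have P: "P > 0" unfolding P_def using x by (intro prod_pos) auto
  have "(\<Sum>e\<in>J. b e * ((x e * x e - 1) * (\<Prod>e'\<in>J-{e}. x e'))) = (\<Sum>e\<in>J. P * ((x e - 1 / x e) * b e))"
  proof (rule sum.cong[OF refl])
    fix e assume e: "e \<in> J"
    have "P = x e * (\<Prod>e'\<in>J-{e}. x e')" unfolding P_def by (rule prod.remove) (use e in auto)
    then show "b e * ((x e * x e - 1) * (\<Prod>e'\<in>J-{e}. x e')) = P * ((x e - 1 / x e) * b e)"
      using x[OF e] by (simp add: field_simps)
  qed
  also have "\<dots> = P * (\<Sum>e\<in>J. (x e - 1 / x e) * b e)" by (rule sum_distrib_left[symmetric])
  finally have eq: "(\<Sum>e\<in>J. b e * ((x e * x e - 1) * (\<Prod>e'\<in>J-{e}. x e'))) = P * (\<Sum>e\<in>J. (x e - 1 / x e) * b e)" .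
  define T where "T = (\<Sum>e\<in>J. (x e - 1 / x e) * b e)"
  have "s * (P * T) - (s * s - 1) * P = 0 \<longleftrightarrow> P * (s * T - (s * s - 1)) = 0" by (simp add: algebra_simps)
  also have "\<dots> \<longleftrightarrow> s * T = s * s - 1" using P by simp
  also have "\<dots> \<longleftrightarrow> s - 1 / s = T" using s by (auto simp: field_simps)
  finally show ?thesis unfolding eq P_def[symmetric] T_def .
qed

text \<open>The graph is the set of positive solutions of polynomial equations. Membership in
  \<open>U\<close> becomes the linear system saying that orthogonal projection, written in the basis
  \<open>\<beta>\<close>, fixes the vector; the values satisfy the cleared equations, where
  positivity selects the right root.\<close>

lemma semialg_iso_orthant_map: "semialg_iso J cell_coords {..<n} (pos_orthant n) orthant_map"
proof -
  define K where "K = Inl ` J \<union> Inr ` {..<n}"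
  define cond where "cond z \<longleftrightarrow> (\<forall>e\<in>J. z (Inl e) > 0) \<and> (\<forall>i\<in>{..<n}. z (Inr i) > 0) \<and>
     (\<forall>e\<in>J. z (Inl e) - (\<Sum>i<n. (\<Sum>e'\<in>J. z (Inl e') * \<beta> i $ e') * \<beta> i $ e) = 0) \<and>
     (\<forall>i\<in>{..<n}. z (Inr i) * (\<Sum>e\<in>J. \<beta> i $ e * ((z (Inl e) * z (Inl e) - 1) * (\<Prod>e'\<in>J-{e}. z (Inl e'))))
         - (z (Inr i) * z (Inr i) - 1) * (\<Prod>e\<in>J. z (Inl e)) = 0)" for z :: "'e + nat \<Rightarrow> real"
  have finK: "finite K" unfolding K_def by simp
  have varl: "poly_fun K (\<lambda>z. z (Inl e))" if "e \<in> J" for e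
    using that finK by (auto intro!: poly_fun_var simp: K_def)
  have varr: "poly_fun K (\<lambda>z. z (Inr i))" if "i < n" for i
    using that finK by (auto intro!: poly_fun_var simp: K_def)
  have sa: "semialg K {z \<in> K \<rightarrow>\<^sub>E UNIV. cond z}"
    unfolding cond_def
    by (intro semialg_conj semialg_ball semialg.sa_pos semialg.sa_zero poly_fun_diff poly_fun_mult
        poly_fun_sum poly_fun_prod poly_fun_const varl varr) auto
  have "{join_pt \<xi> (orthant_map \<xi>) | \<xi>. \<xi> \<in> cell_coords} = {z \<in> K \<rightarrow>\<^sub>E UNIV. cond z}"
  proof (intro set_eqI iffI)
    fix z assume "z \<in> {join_pt \<xi> (orthant_map \<xi>) | \<xi>. \<xi> \<in> cell_coords}"
    then obtain \<xi> where \<xi>: "\<xi> \<in> cell_coords" "z = join_pt \<xi> (orthant_map \<xi>)" by blast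
    have ext: "\<xi> \<in> J \<rightarrow>\<^sub>E UNIV" and cl: "vec_of \<xi> \<in> cell" using \<xi>(1) cell_coords_iff by auto
    have zl: "z (Inl e) = \<xi> e" for e using \<xi>(2) by (simp add: join_pt_def)
    have zr: "z (Inr i) = orthant_map \<xi> i" for i using \<xi>(2) by (simp add: join_pt_def)
    have pos: "0 < \<xi> e" if "e \<in> J" for e using cl that unfolding cell_def by (auto simp: vec_of_def)
    have "z k = undefined" if "k \<notin> K" for k
      using that ext by (cases k) (auto simp: zl zr K_def orthant_map_def PiE_def extensional_def image_iff)
    then have zK: "z \<in> K \<rightarrow>\<^sub>E UNIV" by (auto simp: PiE_def extensional_def)
    have rpos: "z (Inr i) > 0" if "i < n" for i using that by (simp add: zr orthant_map_def pos_root_pos)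
    have lin: "z (Inl e) - (\<Sum>i<n. (\<Sum>e'\<in>J. z (Inl e') * \<beta> i $ e') * \<beta> i $ e) = 0" if e: "e \<in> J" for e
    proof -
      have "(\<Sum>i<n. (vec_of \<xi> \<bullet> \<beta> i) *\<^sub>R \<beta> i) $ e = vec_of \<xi> $ e"
        using \<beta>_expand[of "vec_of \<xi>"] cl unfolding cell_def by auto
      moreover have "vec_of \<xi> \<bullet> \<beta> i = (\<Sum>e'\<in>J. \<xi> e' * \<beta> i $ e')" if "i < n" for i
        using inner_J[OF \<beta>_in[OF that], of "vec_of \<xi>"] by (simp add: vec_of_def)
      ultimately show ?thesis using e by (simp add: zl vec_of_def)
    qed
    have eqn: "z (Inr i) * (\<Sum>e\<in>J. \<beta> i $ e * ((z (Inl e) * z (Inl e) - 1) * (\<Prod>e'\<in>J-{e}. z (Inl e'))))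
         - (z (Inr i) * z (Inr i) - 1) * (\<Prod>e\<in>J. z (Inl e)) = 0" if i: "i < n" for i
    proof -
      have "z (Inr i) = pos_root (\<Sum>e\<in>J. (\<xi> e - 1 / \<xi> e) * \<beta> i $ e)"
        using i coord_bar[OF i pos] by (simp add: zr orthant_map_def)
      then show ?thesis
        using cleared_equation_iff[where x = \<xi> and s = "z (Inr i)" and b = "\<lambda>e. \<beta> i $ e", OF pos] pos_root_pos pos_root_eq
        by (simp add: zl)
    qed
    have lpos: "z (Inl e) > 0" if "e \<in> J" for e using pos[OF that] by (simp add: zl)
    show "z \<in> {z \<in> K \<rightarrow>\<^sub>E UNIV. cond z}"
      unfolding cond_def by (intro CollectI conjI ballI zK lpos rpos lin eqn) auto
  next
    fix z assume "z \<in> {z \<in> K \<rightarrow>\<^sub>E UNIV. cond z}"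
    then have zK: "z \<in> K \<rightarrow>\<^sub>E UNIV" and c: "cond z" by auto
    define \<xi> where "\<xi> e = z (Inl e)" for e
    have undef: "z k = undefined" if "k \<notin> K" for k using zK that by (auto simp: PiE_def extensional_def)
    have ext: "\<xi> \<in> J \<rightarrow>\<^sub>E UNIV"
      by (auto simp: \<xi>_def PiE_def extensional_def K_def intro!: undef)
    have pos: "0 < \<xi> e" if "e \<in> J" for e using c that unfolding cond_def \<xi>_def by blast
    have spos: "0 < z (Inr i)" if "i < n" for i using c that unfolding cond_def by blast
    \<comment> \<open>The linear part of \<open>cond\<close>, read backwards: the vector is fixed by
      the projection and therefore lies in \<open>U\<close>.\<close>
    have "vec_of \<xi> $ e = proj (vec_of \<xi>) $ e" for e
    proof (cases "e \<in> J")
      case True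
      have "vec_of \<xi> \<bullet> \<beta> i = (\<Sum>e'\<in>J. \<xi> e' * \<beta> i $ e')" if "i < n" for i
        using inner_J[OF \<beta>_in[OF that], of "vec_of \<xi>"] by (simp add: vec_of_def)
      then have "proj (vec_of \<xi>) $ e = (\<Sum>i<n. (\<Sum>e'\<in>J. \<xi> e' * \<beta> i $ e') * \<beta> i $ e)"
        by (simp add: proj_def)
      moreover have "\<xi> e - (\<Sum>i<n. (\<Sum>e'\<in>J. \<xi> e' * \<beta> i $ e') * \<beta> i $ e) = 0"
        using c True unfolding cond_def \<xi>_def by blast
      ultimately show ?thesis using True by (simp add: vec_of_def)
    next
      case False
      then show ?thesis using outside[OF proj_in] by (simp add: vec_of_def)
    qed
    then have "vec_of \<xi> = proj (vec_of \<xi>)" by (simp add: vec_eq_iff)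
    then have "vec_of \<xi> \<in> U" using proj_in by metis
    then have "vec_of \<xi> \<in> cell" unfolding cell_def using pos by (simp add: vec_of_def)
    then have cc: "\<xi> \<in> cell_coords" using ext cell_coords_iff by blast
    have "z (Inr i) = orthant_map \<xi> i" for i
    proof (cases "i < n")
      case True
      have "z (Inr i) * (\<Sum>e\<in>J. \<beta> i $ e * ((\<xi> e * \<xi> e - 1) * (\<Prod>e'\<in>J-{e}. \<xi> e')))
         - (z (Inr i) * z (Inr i) - 1) * (\<Prod>e\<in>J. \<xi> e) = 0"
        using c True unfolding cond_def \<xi>_def by blast
      then have "z (Inr i) - 1 / z (Inr i) = (\<Sum>e\<in>J. (\<xi> e - 1 / \<xi> e) * \<beta> i $ e)"
        using cleared_equation_iff[where x = \<xi> and s = "z (Inr i)" and b = "\<lambda>e. \<beta> i $ e", OF pos spos[OF True]] by blast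
      from pos_root_unique[OF spos[OF True] this]
      show ?thesis using True coord_bar[OF True pos] by (simp add: orthant_map_def)
    next
      case False
      then have "Inr i \<notin> K" by (auto simp: K_def)
      then show ?thesis using undef False by (simp add: orthant_map_def)
    qed
    then have "z = join_pt \<xi> (orthant_map \<xi>)"
      by (auto simp: join_pt_def \<xi>_def fun_eq_iff split: sum.splits)
    then show "z \<in> {join_pt \<xi> (orthant_map \<xi>) | \<xi>. \<xi> \<in> cell_coords}" using cc by blast
  qed
  then have "semialg (Inl ` J \<union> Inr ` {..<n}) {join_pt \<xi> (orthant_map \<xi>) | \<xi>. \<xi> \<in> cell_coords}"
    using sa by (simp add: K_def)
  moreover have "cell_coords \<subseteq> J \<rightarrow>\<^sub>E UNIV" using cell_coords_iff by blast
  moreover have "pos_orthant n \<subseteq> {..<n} \<rightarrow>\<^sub>E UNIV" unfolding pos_orthant_def by blast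
  ultimately show ?thesis
    unfolding semialg_iso_def using homeomorphic_map_orthant by blast
qed

end

section \<open>The cell decomposition\<close>

lemma positive_frame_minor:
  fixes V :: "(real ^ 'e::finite) set"
  assumes V: "subspace V" and FG: "F \<subseteq> G" and ac: "acyclic_flat V F"
  obtains \<beta> v where "positive_frame (minor V F G) (rk V G - rk V F) \<beta> (G - F) G v"
proof -
  obtain \<beta> where \<beta>: "orthonormal_frame (minor V F G) (rk V G - rk V F) \<beta>"
    using orthonormal_frame_exists[OF subspace_minor[OF V, of F G]] unfolding dim_minor[OF V FG] .
  obtain v where v: "v \<in> minor_cell V F G" using minor_cell_nonempty[OF ac] .
  have "positive_frame (minor V F G) (rk V G - rk V F) \<beta> (G - F) G v"
    by (intro positive_frame.intro positive_frame_axioms.intro \<beta> minor_outside)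
      (use v in \<open>auto simp: minor_cell_def\<close>)
  then show ?thesis using that by blast
qed

lemma tnnY_homeomorphic_nball:
  fixes V :: "(real ^ 'e::finite) set"
  assumes V: "subspace V" and FG: "F \<subseteq> G" and ac: "acyclic_flat V F" "acyclic_flat V G"
  obtains h where
    "homeomorphic_map (subtopology PT (tnnY V F G)) (top_of_set (closed_nball (rk V G - rk V F))) h"
    "h ` tnnY_open V F G = open_nball (rk V G - rk V F)"
proof -
  obtain \<beta> v where "positive_frame (minor V F G) (rk V G - rk V F) \<beta> (G - F) G v"
    using positive_frame_minor[OF V FG ac(1)] .
  then interpret positive_frame "minor V F G" "rk V G - rk V F" \<beta> "G - F" G v .
  have c: "cell = minor_cell V F G" by (simp add: cell_def minor_cell_def)
  have cc: "closed_cell = tnnY V F G" by (simp add: closed_cell_def tnnY_eq[OF V FG ac])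
  have "PT closure_of (part_emb G ` cell) = closed_cell"
    unfolding cc c tnnY_def tnnY_open_eq[OF V FG ac] ..
  from closed_cell_homeomorphic_nball[OF this]
  show ?thesis unfolding cc c tnnY_open_eq[OF V FG ac, symmetric] using that .
qed

lemma tnnY_open_semialg_iso:
  fixes V :: "(real ^ 'e::finite) set"
  assumes V: "subspace V" and FG: "F \<subseteq> G" and ac: "acyclic_flat V F" "acyclic_flat V G"
  shows "\<exists>f. semialg_iso (G - F) (coords F G (tnnY_open V F G))
            {..<rk V G - rk V F} (pos_orthant (rk V G - rk V F)) f"
proof -
  obtain \<beta> v where "positive_frame (minor V F G) (rk V G - rk V F) \<beta> (G - F) G v"
    using positive_frame_minor[OF V FG ac(1)] .
  then interpret positive_frame "minor V F G" "rk V G - rk V F" \<beta> "G - F" G v .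
  have c: "cell = minor_cell V F G" by (simp add: cell_def minor_cell_def)
  have "restrict (\<lambda>e. the (part_emb G x e)) (G - F) = restrict (($) x) (G - F)" for x :: "real ^ 'e"
    by (auto simp: part_emb_def fun_eq_iff)
  then have "coords F G (tnnY_open V F G) = cell_coords"
    unfolding coords_def cell_coords_def tnnY_open_eq[OF V FG ac] c image_image by simp
  then show ?thesis using semialg_iso_orthant_map by auto
qed

lemma tnnY_open_disjoint:
  assumes "(F1, G1) \<noteq> (F2, G2)"
  shows "tnnY_open V F1 G1 \<inter> tnnY_open V F2 G2 = {}"
proof (rule ccontr)
  assume "tnnY_open V F1 G1 \<inter> tnnY_open V F2 G2 \<noteq> {}"
  then obtain p where "p \<in> tnnY_open V F1 G1" "p \<in> tnnY_open V F2 G2" by blast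
  then show False using tnnY_open_support[of p V F1 G1] tnnY_open_support[of p V F2 G2] assms by simp
qed

text \<open>The characteristic map of a cell is the inverse of the homeomorphism from its closure to
  the model ball, hence regularity. The sphere goes to the closure minus the cell, which consists of
  cells for strictly smaller intervals of flats and thus of smaller rank difference.\<close>

lemma tnnY_regular_cw:
  fixes V :: "(real ^ 'e::finite) set"
  assumes V: "subspace V" and FG: "F \<subseteq> G" and ac: "acyclic_flat V F" "acyclic_flat V G"
  shows "regular_cw (subtopology PT (tnnY V F G))
      {tnnY_open V F' G' | F' G'. F \<subseteq> F' \<and> F' \<subseteq> G' \<and> G' \<subseteq> G \<and> acyclic_flat V F' \<and> acyclic_flat V G'}"
    (is "regular_cw ?X ?C")
proof -
  \<comment> \<open>The dimension must be a function of the cell as a set, so the two flats are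
    recovered from an arbitrarily chosen point of it.\<close>
  define dimf where "dimf c = (let p = SOME p. p \<in> c in
      rk V {e. p e \<noteq> None} - rk V {e. p e = Some 0})" for c :: "('e \<Rightarrow> real option) set"
  have dimf: "dimf (tnnY_open V F' G') = rk V G' - rk V F'" if "tnnY_open V F' G' \<noteq> {}" for F' G'
  proof -
    have "(SOME p. p \<in> tnnY_open V F' G') \<in> tnnY_open V F' G'" using that some_in_eq by blast
    from tnnY_open_support[OF this] show ?thesis by (simp add: dimf_def Let_def)
  qed
  have Un: "\<Union>?C = tnnY V F G" by (rule tnnY_decomposition[OF V FG ac, symmetric])
  have cells: "\<exists>h. continuous_map (top_of_set (closed_nball (dimf c))) ?X h \<and>
        h ` open_nball (dimf c) = c \<and>
        homeomorphic_map (top_of_set (open_nball (dimf c))) (subtopology ?X c) h \<and>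
        h ` nsphere (dimf c) \<subseteq> \<Union>{c' \<in> ?C. dimf c' < dimf c}"
    and closures: "subtopology ?X (?X closure_of c) homeomorphic_space top_of_set (closed_nball (dimf c))"
    if c: "c \<in> ?C" for c
  proof -
    obtain F' G' where FG': "F \<subseteq> F'" "F' \<subseteq> G'" "G' \<subseteq> G" "acyclic_flat V F'" "acyclic_flat V G'"
      and ceq: "c = tnnY_open V F' G'" using c by blast
    define k where "k = rk V G' - rk V F'"
    have "tnnY_open V F' G' \<noteq> {}" using tnnY_open_nonempty_iff[OF V FG'(2)] FG' by blast
    then have dk: "dimf c = k" using dimf ceq by (simp add: k_def)
    define T where "T = tnnY V F' G'"
    have Tdec: "T = \<Union>{tnnY_open V F'' G'' | F'' G''. F' \<subseteq> F'' \<and> F'' \<subseteq> G'' \<and> G'' \<subseteq> G' \<and>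
        acyclic_flat V F'' \<and> acyclic_flat V G''}"
      unfolding T_def by (rule tnnY_decomposition[OF V FG'(2,4,5)])
    have "{tnnY_open V F'' G'' | F'' G''. F' \<subseteq> F'' \<and> F'' \<subseteq> G'' \<and> G'' \<subseteq> G' \<and>
        acyclic_flat V F'' \<and> acyclic_flat V G''} \<subseteq> ?C" using FG' by blast
    then have TT: "T \<subseteq> tnnY V F G" unfolding Tdec Un[symmetric] by (rule Union_mono)
    have cT: "c \<subseteq> T" unfolding Tdec ceq using FG' by blast
    obtain h where h: "homeomorphic_map (subtopology PT T) (top_of_set (closed_nball k)) h"
      "h ` c = open_nball k"
      using tnnY_homeomorphic_nball[OF V FG'(2,4,5)] unfolding T_def ceq k_def by blast
    \<comment> \<open>The closure in \<open>PT\<close> already lies in the subspace, so the relative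
      closure is the same.\<close>
    have "?X closure_of c = T"
      using TT cT by (simp add: closure_of_subtopology T_def tnnY_def ceq inf.absorb2 Int_absorb1)
    moreover have "subtopology ?X T = subtopology PT T"
      using TT by (simp add: subtopology_subtopology inf.absorb2)
    ultimately show "subtopology ?X (?X closure_of c) homeomorphic_space top_of_set (closed_nball (dimf c))"
      unfolding dk using homeomorphic_map_imp_homeomorphic_space[OF h(1)] by simp
    obtain g where hg: "homeomorphic_maps (subtopology PT T) (top_of_set (closed_nball k)) h g"
      using h(1) homeomorphic_map_maps by blast
    have g: "homeomorphic_map (top_of_set (closed_nball k)) (subtopology PT T) g"
      using hg homeomorphic_maps_sym homeomorphic_maps_imp_map by blast
    have gh: "g (h x) = x" if "x \<in> T" for x using hg that by (simp add: homeomorphic_maps_def)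
    have hgy: "h (g y) = y" if "y \<in> closed_nball k" for y using hg that by (simp add: homeomorphic_maps_def)
    have gT: "g y \<in> T" if "y \<in> closed_nball k" for y
      using homeomorphic_imp_surjective_map[OF g] that by auto
    have sub: "open_nball k \<subseteq> closed_nball k" "nsphere k \<subseteq> closed_nball k"
      unfolding open_nball_def closed_nball_def nsphere_def
      by (blast intro: less_imp_le eq_refl)+
    have dis: "y \<notin> open_nball k" if "y \<in> nsphere k" for y
      using that unfolding open_nball_def nsphere_def by simp
    have gc: "g ` open_nball k = c"
    proof -
      have "g ` h ` c = c" using gh cT by (force simp: image_image)
      then show ?thesis using h(2) by simp
    qed
    have "continuous_map (top_of_set (closed_nball k)) ?X g"
      using homeomorphic_imp_continuous_map[OF g] TT by (auto simp: continuous_map_in_subtopology)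
    moreover have "homeomorphic_map (top_of_set (open_nball k)) (subtopology ?X c) g"
    proof -
      have "homeomorphic_map (subtopology (top_of_set (closed_nball k)) (open_nball k))
          (subtopology (subtopology PT T) c) g"
        by (rule homeomorphic_map_subtopologies[OF g]) (use sub gc cT in \<open>auto simp: inf.absorb2\<close>)
      moreover have "subtopology (subtopology PT T) c = subtopology ?X c"
        using cT TT by (simp add: subtopology_subtopology inf.absorb2)
      ultimately show ?thesis using sub by (simp add: subtopology_subtopology inf.absorb2)
    qed
    moreover have "g ` nsphere k \<subseteq> \<Union>{c' \<in> ?C. dimf c' < k}"
    proof
      fix p assume "p \<in> g ` nsphere k"
      then obtain y where y: "y \<in> nsphere k" "p = g y" by blast
      have "p \<in> T" using gT y sub by blast
      \<comment> \<open>\<open>h\<close> undoes \<open>g\<close> and maps \<open>c\<close> onto the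
        open ball, which is disjoint from the sphere.\<close>
      moreover have "p \<notin> c"
      proof
        assume "p \<in> c"
        then have "h p \<in> open_nball k" using h(2) by blast
        moreover have "h p = y" using hgy[of y] y sub(2) by blast
        ultimately show False using dis[OF y(1)] by simp
      qed
      ultimately obtain F'' G'' where F: "F' \<subseteq> F''" "F'' \<subseteq> G''" "G'' \<subseteq> G'"
        "acyclic_flat V F''" "acyclic_flat V G''" "p \<in> tnnY_open V F'' G''" "(F'', G'') \<noteq> (F', G')"
        unfolding Tdec ceq by blast
      have "rk V G'' - rk V F'' < k"
        unfolding k_def by (rule rk_diff_less[OF V F(1-3) FG'(4) F(5,7)])
      moreover have "dimf (tnnY_open V F'' G'') = rk V G'' - rk V F''" using dimf F(6) by blast
      ultimately have "dimf (tnnY_open V F'' G'') < k" by simp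
      moreover have "tnnY_open V F'' G'' \<in> ?C" using F FG' by blast
      ultimately show "p \<in> \<Union>{c' \<in> ?C. dimf c' < k}" using F(6) by blast
    qed
    ultimately show "\<exists>h. continuous_map (top_of_set (closed_nball (dimf c))) ?X h \<and>
        h ` open_nball (dimf c) = c \<and>
        homeomorphic_map (top_of_set (open_nball (dimf c))) (subtopology ?X c) h \<and>
        h ` nsphere (dimf c) \<subseteq> \<Union>{c' \<in> ?C. dimf c' < dimf c}"
      unfolding dk using gc by blast
  qed
  have "finite ?C"
    by (rule finite_subset[of _ "(\<lambda>(F', G'). tnnY_open V F' G') ` UNIV"]) auto
  moreover have "{} \<notin> ?C" using tnnY_open_nonempty_iff[OF V] by blast
  moreover have "disjoint ?C"
  proof (rule disjointI)
    fix a b assume "a \<in> ?C" "b \<in> ?C" "a \<noteq> b"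
    then obtain F1 G1 F2 G2 where ab: "a = tnnY_open V F1 G1" "b = tnnY_open V F2 G2" by blast
    then have "(F1, G1) \<noteq> (F2, G2)" using \<open>a \<noteq> b\<close> by auto
    then show "a \<inter> b = {}" unfolding ab by (rule tnnY_open_disjoint)
  qed
  moreover have "Hausdorff_space ?X" by (simp add: Hausdorff_space_PT Hausdorff_space_subtopology)
  moreover have "\<Union>?C = topspace ?X" using Un by simp
  ultimately have "finite_cw ?X ?C dimf"
    unfolding finite_cw_def by (intro conjI ballI cells) auto
  then show ?thesis unfolding regular_cw_def by (intro exI[of _ dimf] conjI ballI closures)
qed

theorem theorem1p1:
  fixes V :: "(real ^ 'e::finite) set"
  assumes "subspace V"
  shows
    "(\<forall>F G. F \<subseteq> G \<longrightarrow>
        ((tnnY_open V F G \<noteq> {} \<longleftrightarrow> acyclic_flat V F \<and> acyclic_flat V G) \<and>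
         (tnnY_open V F G \<noteq> {} \<longrightarrow>
            tnnY_open V F G \<in> connected_components_of (subtopology PT (Y_open V F G)) \<and>
            (\<exists>f. semialg_iso (G - F) (coords F G (tnnY_open V F G))
                              {..<rk V G - rk V F} (pos_orthant (rk V G - rk V F)) f))))
   \<and> (\<forall>F G. F \<subseteq> G \<longrightarrow> tnnY_open V F G \<noteq> {} \<longrightarrow>
        tnnY V F G = \<Union>{tnnY_open V F' G' | F' G'.
                          F \<subseteq> F' \<and> F' \<subseteq> G' \<and> G' \<subseteq> G \<and> acyclic_flat V F' \<and> acyclic_flat V G'} \<and>
        (\<forall>F1 G1 F2 G2. (F1, G1) \<noteq> (F2, G2) \<longrightarrow>
            tnnY_open V F1 G1 \<inter> tnnY_open V F2 G2 = {}))
   \<and> (\<forall>F G. F \<subseteq> G \<longrightarrow> tnnY_open V F G \<noteq> {} \<longrightarrow>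
        regular_cw (subtopology PT (tnnY V F G))
          {tnnY_open V F' G' | F' G'.
              F \<subseteq> F' \<and> F' \<subseteq> G' \<and> G' \<subseteq> G \<and> acyclic_flat V F' \<and> acyclic_flat V G'} \<and>
        (\<exists>n. subtopology PT (tnnY V F G) homeomorphic_space
               subtopology euclidean (closed_nball n)))"
proof (intro conjI allI impI)
  fix F G :: "'e set" assume FG: "F \<subseteq> G"
  show "tnnY_open V F G \<noteq> {} \<longleftrightarrow> acyclic_flat V F \<and> acyclic_flat V G"
    by (rule tnnY_open_nonempty_iff[OF assms FG])
  assume "tnnY_open V F G \<noteq> {}"
  then have ac: "acyclic_flat V F" "acyclic_flat V G" using tnnY_open_nonempty_iff[OF assms FG] by auto
  show "tnnY_open V F G \<in> connected_components_of (subtopology PT (Y_open V F G))"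
    by (rule tnnY_open_component[OF assms FG ac])
  show "\<exists>f. semialg_iso (G - F) (coords F G (tnnY_open V F G))
            {..<rk V G - rk V F} (pos_orthant (rk V G - rk V F)) f"
    by (rule tnnY_open_semialg_iso[OF assms FG ac])
next
  fix F G :: "'e set" assume FG: "F \<subseteq> G" and "tnnY_open V F G \<noteq> {}"
  then have ac: "acyclic_flat V F" "acyclic_flat V G" using tnnY_open_nonempty_iff[OF assms FG] by auto
  show "tnnY V F G = \<Union>{tnnY_open V F' G' | F' G'.
            F \<subseteq> F' \<and> F' \<subseteq> G' \<and> G' \<subseteq> G \<and> acyclic_flat V F' \<and> acyclic_flat V G'}"
    by (rule tnnY_decomposition[OF assms FG ac])
  show "tnnY_open V F1 G1 \<inter> tnnY_open V F2 G2 = {}" if "(F1, G1) \<noteq> (F2, G2)" for F1 G1 F2 G2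
    by (rule tnnY_open_disjoint[OF that])
next
  fix F G :: "'e set" assume FG: "F \<subseteq> G" and "tnnY_open V F G \<noteq> {}"
  then have ac: "acyclic_flat V F" "acyclic_flat V G" using tnnY_open_nonempty_iff[OF assms FG] by auto
  show "regular_cw (subtopology PT (tnnY V F G))
      {tnnY_open V F' G' | F' G'. F \<subseteq> F' \<and> F' \<subseteq> G' \<and> G' \<subseteq> G \<and> acyclic_flat V F' \<and> acyclic_flat V G'}"
    by (rule tnnY_regular_cw[OF assms FG ac])
  obtain h where "homeomorphic_map (subtopology PT (tnnY V F G))
      (top_of_set (closed_nball (rk V G - rk V F))) h"
    using tnnY_homeomorphic_nball[OF assms FG ac] .
  then show "\<exists>n. subtopology PT (tnnY V F G) homeomorphic_space top_of_set (closed_nball n)"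
    using homeomorphic_map_imp_homeomorphic_space by blast
qed

end
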